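(* Assume A1 and A3. Then for every $\theta=(\theta_i)_{i\ge1}$ satisfying A2, $$\lim_{n\to\infty}\Big(R_n\big(\theta,\hat q(\hat\eta_n^{D},\hat\tau_n^{D})\big)-\mathbb{E}\big[L_n\big(\theta,\hat q(\eta_n^{\mathsf{DOR}},\tau_n^{\mathsf{DOR}})\big)\big]\Big)=0,$$ where $(\hat\eta_n^{D},\hat\tau_n^{D})=\arg\min_{(\eta,\tau)\in(\Lambda_{n,1}\cap\hat M_n)\times\Lambda_{n,2}}\widehat{\mathrm{ARE}}^{D}_n(\eta,\tau)$ and $(\eta_n^{\mathsf{DOR}},\tau_n^{\mathsf{DOR}})=\arg\min_{\eta\in\hat M_n,\,\tau\in[0,\infty]}L_n(\theta,\hat q(\eta,\tau))$.
   Context: Setting. $(\theta_i)_{i\ge1}$ are real numbers and $(\nu_{p,i}),(\nu_{f,i}),(b_i),(h_i)$ are known sequences of positive numbers. $N(\mu,\nu)$ is the normal law with mean $\mu$ and variance $\nu$; $\phi,\Phi$ are the standard normal density and CDF. For each $n$ (large enough that $\log\log n>0$), $X=(X_1,\dots,X_n)$ has independent coordinates $X_i\sim N(\theta_i,\nu_{p,i})$. Put $\tilde b_i=b_i/(b_i+h_i)$ and $G(w,\beta)=\phi(w)+w\Phi(w)-\beta w$. The loss of a prediction $q\in\mathbb{R}^n$ is $L_n(\theta,q)=\frac1n\sum_{i=1}^n l_i(\theta_i,q_i)$ with $l_i(\theta_i,q_i)=\sqrt{\nu_{f,i}}\,(b_i+h_i)\,G\big((q_i-\theta_i)/\sqrt{\nu_{f,i}},\tilde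 b_i\big)$, which equals $\mathbb{E}_{Y\sim N(\theta_i,\nu_{f,i})}[b_i(Y-q_i)^++h_i(q_i-Y)^+]$. The risk of a data-dependent predictor $\hat q=\hat q(X)$ (including one with data-dependent tuning parameters) is $R_n(\theta,\hat q)=\mathbb{E}[L_n(\theta,\hat q(X))]$. Predictors. For $\eta\in\mathbb{R}$, $\tau\in[0,\infty]$: $\alpha_i(\tau)=\tau/(\tau+\nu_{p,i})$ ($\alpha_i(\infty)=1$), $\hat q_i(\eta,\tau)=\alpha_i(\tau)X_i+(1-\alpha_i(\tau))\eta+\sqrt{\nu_{f,i}+\alpha_i(\tau)\nu_{p,i}}\;\Phi^{-1}(\tilde b_i)$, $\hat q(\eta,\tau)=(\hat q_1(\eta,\tau),\dots,\hat q_n(\eta,\tau))$. Assumptions. A1: $0<\inf_i\tilde b_i\le\sup_i\tilde b_i<1$ and $\sup_i(b_i+h_i)<\infty$. A2: $\limsup_{n\to\infty}\frac1n\sum_{i=1}^n|\theta_i|<\infty$. A3: $\sup_i\nu_{p,i}/\nu_{f,i}<1/(4e)$, $\sup_i\nu_{f,i}<\infty$, $\inf_i\nu_{p,i}>0$. Risk estimate. For $\tau\in[0,\infty)$ (the grid $\Lambda_{n,2}$ below has only finite points) let $$c_i(\tau)=\sqrt{\frac{\nu_{f,i}+\alpha_i(\tau)\nu_{p,i}}{\nu_{f,i}+\alpha_i(\tau)^2\nu_{p,i}}}\;\Phi^{-1}(\tilde b_i),\qquad d_i(\tau)=-\frac{1-\alpha_i(\tau)}{\sqrt{\nu_{f,i}+\alpha_i(\tau)^2\nu_{p,i}}},\qquad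 s_i(\tau)=\sqrt{2\nu_{p,i}}\,|d_i(\tau)|.$$ Fix for each $i$ any number $\gamma(i)$ with $0<\gamma(i)<1/\sqrt{4e}-\sqrt{\nu_{p,i}/\nu_{f,i}}$, and set $\lambda_n(i)=\gamma(i)\sqrt{2\log n}$ and $K_n(i)=1+\big\lceil e^2\big(\gamma(i)+\sqrt{2\nu_{p,i}/\nu_{f,i}}\big)^2(2\log n)\big\rceil$. With $H_k$ the probabilists' Hermite polynomials and $G'$ the derivative of $G$ in its first argument, put $$S_{i,\tau}(u)=G(0,\tilde b_i)+G'(0,\tilde b_i)\,u+\phi(0)\sum_{k=0}^{K_n(i)-2}\frac{(-1)^kH_k(0)}{(k+2)!}\,s_i(\tau)^{k+2}H_{k+2}\big(u/s_i(\tau)\big)$$ and $\tilde S_{i,\tau}(u)=\mathrm{sign}(S_{i,\tau}(u))\min\{|S_{i,\tau}(u)|,n\}$. For $x,z\in\mathbb{R}$ let $U=c_i(\tau)+d_i(\tau)(x+\sqrt{\nu_{p,i}}z)$, $V=c_i(\tau)+d_i(\tau)(x-\sqrt{\nu_{p,i}}z)$, and define $\hat T_i(x,z,\tau)=-\tilde b_iU$ if $V<-\lambda_n(i)$; $=\tilde S_{i,\tau}(U)$ if $|V|\le\lambda_n(i)$; $=(1-\tilde b_i)U$ if $V>\lambda_n(i)$. Let $\hat T_i(x,\tau)=\mathbb{E}_{Z\sim N(0,1)}[\hat T_i(x,Z,\tau)]$ and $$\widehat{\mathrm{ARE}}^{D}_n(\eta,\tau)=\frac1n\sum_{i=1}^n(b_i+h_i)\sqrt{\nu_{f,i}+\nu_{p,i}\alpha_i(\tau)^2}\;\hat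 T_i(X_i-\eta,\tau).$$ Location range and grids. $\hat M_n=[\hat m_n(\underline\beta_n),\hat m_n(\overline\beta_n)]$, where $\hat m_n(\beta)$ is the empirical $\beta$-quantile of $X_1,\dots,X_n$, $\underline\beta_n=\inf_{i\le n}\tilde b_i$, $\overline\beta_n=\sup_{i\le n}\tilde b_i$. Let $a_n=\log\log n$. $C_1,\dots,C_4$ are constants, independent of $n$, such that for all large $n$: $\sup_{i\le n}(b_i+h_i)\le C_1$; $\max\{\sup_{i\le n}\nu_{p,i},\sup_{i\le n}\nu_{p,i}^{-1}\}\le C_2$; $\big(\sup_{i\le n}\nu_{p,i}/\nu_{f,i}\big)\big(\sup_{i\le n}|\Phi^{-1}(\tilde b_i)|\big)\le C_3$; $\sup_{\theta\in\Theta_n}\frac1n\sum_{i=1}^n|\theta_i|\le C_4\sqrt{a_n}$, where $\Theta_n\subseteq\mathbb{R}^n$ is the parameter set containing all $\theta$ obeying A2. $\Lambda_{n,1}$ is an equispaced grid in $[-a_n,a_n]$ with spacing $\delta_{n,1}=(2C_1a_n)^{-1}$. With $\delta_{n,2}=\{2C_1C_2(2\phi(0)+C_3+\sqrt{a_n}\,C_4+a_n+a_n^2)\}^{-1}$, $\Lambda_{n,2}=\{\tau\ge0:\tau/(\tau+1)=(j-1)\delta_{n,2}\text{ for some }j\in\{1,\dots,\lceil1/\delta_{n,2}\rceil\}\}$. Neither grid depends on $X$.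
   Formalization: Assumes additionally inf_i γ(i) > 0 (the claim fails for rapidly decaying γ(i)); when Λ_{n,1}∩M̂_n is empty, the minimum is over the points of Λ_{n,1} nearest to M̂_n; Θ_n need contain (θ_1,…,θ_n) only for all large n; the minimizer (η̂^D, τ̂^D) is taken measurable. *)

theory Defs
  imports "HOL-Probability.Probability"
begin

section \<open>The check-loss prediction model\<close>

text \<open>Coordinates are indexed by \<open>{1..n}\<close>; sequences are functions \<open>nat \<Rightarrow> real\<close> whose value
  at 0 is never used. Quantities that depend on a single coordinate take the scalars of that
  coordinate as arguments: \<open>b\<close>, \<open>h\<close> (costs), \<open>vp\<close> (past variance \<open>\<nu>\<^sub>p\<close>), \<open>vf\<close> (future
  variance \<open>\<nu>\<^sub>f\<close>), \<open>bt\<close> (the critical ratio) and \<open>g\<close> (the constant \<open>\<gamma>\<close>).\<close>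

abbreviation phi :: "real \<Rightarrow> real" where
  "phi \<equiv> std_normal_density"

definition Phi :: "real \<Rightarrow> real" where
  "Phi = cdf std_normal_distribution"

definition Phi_inv :: "real \<Rightarrow> real" where
  "Phi_inv p = (THE x. Phi x = p)"

definition btilde :: "real \<Rightarrow> real \<Rightarrow> real" where
  "btilde b h = b / (b + h)"

definition G :: "real \<Rightarrow> real \<Rightarrow> real" where
  "G w \<beta> = phi w + w * Phi w - \<beta> * w"

definition coord_loss :: "real \<Rightarrow> real \<Rightarrow> real \<Rightarrow> real \<Rightarrow> real \<Rightarrow> real" where
  "coord_loss b h vf t q = sqrt vf * (b + h) * G ((q - t) / sqrt vf) (btilde b h)"

definition avg_loss ::
  "nat \<Rightarrow> (nat \<Rightarrow> real) \<Rightarrow> (nat \<Rightarrow> real) \<Rightarrow> (nat \<Rightarrow> real) \<Rightarrow> (nat \<Rightarrow> real) \<Rightarrow> (nat \<Rightarrow> real) \<Rightarrow> real"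
where
  "avg_loss n b h vf \<theta> q = (1 / real n) * (\<Sum>i=1..n. coord_loss (b i) (h i) (vf i) (\<theta> i) (q i))"

text \<open>\<^const>\<open>normal_density\<close> takes the standard deviation, not the variance.\<close>

definition data_law :: "nat \<Rightarrow> (nat \<Rightarrow> real) \<Rightarrow> (nat \<Rightarrow> real) \<Rightarrow> (nat \<Rightarrow> real) measure" where
  "data_law n vp \<theta> = (\<Pi>\<^sub>M i\<in>{1..n}. density lborel (normal_density (\<theta> i) (sqrt (vp i))))"

definition risk ::
  "nat \<Rightarrow> (nat \<Rightarrow> real) \<Rightarrow> (nat \<Rightarrow> real) \<Rightarrow> (nat \<Rightarrow> real) \<Rightarrow> (nat \<Rightarrow> real) \<Rightarrow> (nat \<Rightarrow> real)
    \<Rightarrow> ((nat \<Rightarrow> real) \<Rightarrow> (nat \<Rightarrow> real)) \<Rightarrow> real"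
where
  "risk n b h vp vf \<theta> q = (\<integral>x. avg_loss n b h vf \<theta> (q x) \<partial>data_law n vp \<theta>)"

section \<open>Predictors\<close>

text \<open>The scale hyperparameter \<open>\<tau>\<close> ranges over \<open>[0, \<infinity>]\<close>, that is, over \<^typ>\<open>ennreal\<close>.\<close>

definition alpha :: "real \<Rightarrow> ennreal \<Rightarrow> real" where
  "alpha vp \<tau> = (if \<tau> = \<infinity> then 1 else enn2real \<tau> / (enn2real \<tau> + vp))"

definition coord_predictor ::
  "real \<Rightarrow> real \<Rightarrow> real \<Rightarrow> real \<Rightarrow> real \<Rightarrow> ennreal \<Rightarrow> real \<Rightarrow> real"
where
  "coord_predictor b h vp vf \<eta> \<tau> x =
     alpha vp \<tau> * x + (1 - alpha vp \<tau>) * \<eta> + sqrt (vf + alpha vp \<tau> * vp) * Phi_inv (btilde b h)"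

definition predictor ::
  "(nat \<Rightarrow> real) \<Rightarrow> (nat \<Rightarrow> real) \<Rightarrow> (nat \<Rightarrow> real) \<Rightarrow> (nat \<Rightarrow> real) \<Rightarrow> real \<Rightarrow> ennreal
    \<Rightarrow> (nat \<Rightarrow> real) \<Rightarrow> (nat \<Rightarrow> real)"
where
  "predictor b h vp vf \<eta> \<tau> x = (\<lambda>i. coord_predictor (b i) (h i) (vp i) (vf i) \<eta> \<tau> (x i))"

section \<open>Assumptions\<close>

text \<open>Suprema, infima and limits superior are taken in \<^typ>\<open>ereal\<close>, so that they are meaningful
  without a separate boundedness condition.\<close>

definition assumption_A1 :: "(nat \<Rightarrow> real) \<Rightarrow> (nat \<Rightarrow> real) \<Rightarrow> bool" where
  "assumption_A1 b h \<longleftrightarrow>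
     0 < (INF i\<in>{1..}. ereal (btilde (b i) (h i))) \<and>
     (SUP i\<in>{1..}. ereal (btilde (b i) (h i))) < 1 \<and>
     (SUP i\<in>{1..}. ereal (b i + h i)) < \<infinity>"

definition assumption_A2 :: "(nat \<Rightarrow> real) \<Rightarrow> bool" where
  "assumption_A2 \<theta> \<longleftrightarrow> limsup (\<lambda>n. ereal ((1 / real n) * (\<Sum>i=1..n. \<bar>\<theta> i\<bar>))) < \<infinity>"

definition assumption_A3 :: "(nat \<Rightarrow> real) \<Rightarrow> (nat \<Rightarrow> real) \<Rightarrow> bool" where
  "assumption_A3 vp vf \<longleftrightarrow>
     (SUP i\<in>{1..}. ereal (vp i / vf i)) < ereal (1 / (4 * exp 1)) \<and>
     (SUP i\<in>{1..}. ereal (vf i)) < \<infinity> \<and>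
     0 < (INF i\<in>{1..}. ereal (vp i))"

section \<open>The asymptotic risk estimate\<close>

text \<open>Probabilists' Hermite polynomials.\<close>

fun hermite :: "nat \<Rightarrow> real \<Rightarrow> real" where
  "hermite 0 x = 1"
| "hermite (Suc 0) x = x"
| "hermite (Suc (Suc k)) x = x * hermite (Suc k) x - real (Suc k) * hermite k x"

definition c_coef :: "real \<Rightarrow> real \<Rightarrow> real \<Rightarrow> real \<Rightarrow> real" where
  "c_coef bt vp vf \<tau> =
     sqrt ((vf + alpha vp (ennreal \<tau>) * vp) / (vf + (alpha vp (ennreal \<tau>))\<^sup>2 * vp)) * Phi_inv bt"

definition d_coef :: "real \<Rightarrow> real \<Rightarrow> real \<Rightarrow> real" where
  "d_coef vp vf \<tau> =
     - (1 - alpha vp (ennreal \<tau>)) / sqrt (vf + (alpha vp (ennreal \<tau>))\<^sup>2 * vp)"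

definition s_coef :: "real \<Rightarrow> real \<Rightarrow> real \<Rightarrow> real" where
  "s_coef vp vf \<tau> = sqrt (2 * vp) * \<bar>d_coef vp vf \<tau>\<bar>"

definition lam :: "nat \<Rightarrow> real \<Rightarrow> real" where
  "lam n g = g * sqrt (2 * ln (real n))"

definition trunc_order :: "nat \<Rightarrow> real \<Rightarrow> real \<Rightarrow> real \<Rightarrow> nat" where
  "trunc_order n g vp vf =
     1 + nat \<lceil>(exp 1)\<^sup>2 * (g + sqrt (2 * vp / vf))\<^sup>2 * (2 * ln (real n))\<rceil>"

text \<open>The index condition \<open>k < K - 1\<close> is \<open>k \<le> K - 2\<close>, without truncated subtraction at \<open>K = 1\<close>.\<close>

definition S_poly :: "nat \<Rightarrow> real \<Rightarrow> real \<Rightarrow> real \<Rightarrow> real \<Rightarrow> real \<Rightarrow> real \<Rightarrow> real" where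
  "S_poly n bt vp vf g \<tau> u =
     G 0 bt + deriv (\<lambda>w. G w bt) 0 * u +
     phi 0 * (\<Sum>k<trunc_order n g vp vf - 1.
        (- 1) ^ k * hermite k 0 / fact (k + 2) *
        s_coef vp vf \<tau> ^ (k + 2) * hermite (k + 2) (u / s_coef vp vf \<tau>))"

definition S_trunc :: "nat \<Rightarrow> real \<Rightarrow> real \<Rightarrow> real \<Rightarrow> real \<Rightarrow> real \<Rightarrow> real \<Rightarrow> real" where
  "S_trunc n bt vp vf g \<tau> u =
     sgn (S_poly n bt vp vf g \<tau> u) * min \<bar>S_poly n bt vp vf g \<tau> u\<bar> (real n)"

definition T_rand :: "nat \<Rightarrow> real \<Rightarrow> real \<Rightarrow> real \<Rightarrow> real \<Rightarrow> real \<Rightarrow> real \<Rightarrow> real \<Rightarrow> real" where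
  "T_rand n bt vp vf g x z \<tau> =
     (let U = c_coef bt vp vf \<tau> + d_coef vp vf \<tau> * (x + sqrt vp * z);
          V = c_coef bt vp vf \<tau> + d_coef vp vf \<tau> * (x - sqrt vp * z)
      in if V < - lam n g then - bt * U
         else if V > lam n g then (1 - bt) * U
         else S_trunc n bt vp vf g \<tau> U)"

definition T_hat :: "nat \<Rightarrow> real \<Rightarrow> real \<Rightarrow> real \<Rightarrow> real \<Rightarrow> real \<Rightarrow> real \<Rightarrow> real" where
  "T_hat n bt vp vf g x \<tau> = (\<integral>z. T_rand n bt vp vf g x z \<tau> \<partial>std_normal_distribution)"

definition ARE_D ::
  "nat \<Rightarrow> (nat \<Rightarrow> real) \<Rightarrow> (nat \<Rightarrow> real) \<Rightarrow> (nat \<Rightarrow> real) \<Rightarrow> (nat \<Rightarrow> real) \<Rightarrow> (nat \<Rightarrow> real)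
    \<Rightarrow> (nat \<Rightarrow> real) \<Rightarrow> real \<Rightarrow> real \<Rightarrow> real"
where
  "ARE_D n b h vp vf \<gamma> x \<eta> \<tau> =
     (1 / real n) * (\<Sum>i=1..n. (b i + h i) * sqrt (vf i + vp i * (alpha (vp i) (ennreal \<tau>))\<^sup>2) *
        T_hat n (btilde (b i) (h i)) (vp i) (vf i) (\<gamma> i) (x i - \<eta>) \<tau>)"

section \<open>Location range and grids\<close>

definition emp_quantile :: "nat \<Rightarrow> (nat \<Rightarrow> real) \<Rightarrow> real \<Rightarrow> real" where
  "emp_quantile n x \<beta> = Inf {t. \<beta> \<le> real (card {i\<in>{1..n}. x i \<le> t}) / real n}"

definition location_range :: "nat \<Rightarrow> (nat \<Rightarrow> real) \<Rightarrow> (nat \<Rightarrow> real) \<Rightarrow> (nat \<Rightarrow> real) \<Rightarrow> real set" where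
  "location_range n b h x =
     {emp_quantile n x (INF i\<in>{1..n}. btilde (b i) (h i)) ..
      emp_quantile n x (SUP i\<in>{1..n}. btilde (b i) (h i))}"

definition a_seq :: "nat \<Rightarrow> real" where
  "a_seq n = ln (ln (real n))"

text \<open>The spacing need not divide \<open>2 a\<^sub>n\<close>, so the position of the equispaced grid inside
  \<open>[- a\<^sub>n, a\<^sub>n]\<close> is left as a parameter \<open>p\<close>; \<open>p = - a\<^sub>n\<close> starts it at the left end point.\<close>

definition location_grid :: "nat \<Rightarrow> real \<Rightarrow> real \<Rightarrow> real set" where
  "location_grid n C1 p =
     {\<eta>\<in>{- a_seq n .. a_seq n}. \<exists>j::int. \<eta> = p + real_of_int j * (1 / (2 * C1 * a_seq n))}"

definition scale_step :: "nat \<Rightarrow> real \<Rightarrow> real \<Rightarrow> real \<Rightarrow> real \<Rightarrow> real" where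
  "scale_step n C1 C2 C3 C4 =
     1 / (2 * C1 * C2 * (2 * phi 0 + C3 + sqrt (a_seq n) * C4 + a_seq n + (a_seq n)\<^sup>2))"

definition scale_grid :: "nat \<Rightarrow> real \<Rightarrow> real \<Rightarrow> real \<Rightarrow> real \<Rightarrow> real set" where
  "scale_grid n C1 C2 C3 C4 =
     {\<tau>. 0 \<le> \<tau> \<and> (\<exists>j\<in>{1..nat \<lceil>1 / scale_step n C1 C2 C3 C4\<rceil>}.
        \<tau> / (\<tau> + 1) = (real j - 1) * scale_step n C1 C2 C3 C4)}"

text \<open>The candidates are the grid points in the location range. For every \<open>n\<close> this set is empty
  with positive probability (and almost surely so when all \<open>btilde (b i) (h i)\<close> coincide, since the
  range is then a single order statistic). In that event the candidates are the grid points
  nearest to the range.\<close>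

definition location_candidates :: "real set \<Rightarrow> real set \<Rightarrow> real set" where
  "location_candidates L M =
     (if L \<inter> M \<noteq> {} then L \<inter> M else {\<eta>\<in>L. \<forall>\<eta>'\<in>L. infdist \<eta> M \<le> infdist \<eta>' M})"

end

theory Submission
  imports Defs "HOL-Real_Asymp.Real_Asymp"
begin

text \<open>Fix \<open>(\<eta>, \<tau>)\<close>. The \<open>i\<close>-th summand of the risk estimate is a function of two variables \<open>U\<close>, \<open>V\<close>, which a
  rotation of \<open>(X\<^sub>i, Z)\<close> shows to be independent with law \<open>N(\<mu>, s\<^sup>2)\<close>; its target is \<open>G(\<mu>)\<close>. The
  expansion in the scaled Hermite polynomials of \<open>U\<close> is unbiased for the Taylor polynomial of \<open>G\<close>
  at \<open>\<mu>\<close> and has second moment at most \<open>K exp(5\<mu>\<^sup>2/4)\<close>, up to a constant, because \<open>s\<^sup>2 \<le> 1/5\<close>. It is used only if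
  \<open>|V| \<le> \<lambda>\<close>, which has probability at most \<open>exp(-(|\<mu>| - \<lambda>)\<^sup>2/(2s\<^sup>2))\<close> for \<open>|\<mu>| > \<lambda>\<close>. As
  \<open>\<lambda>\<^sup>2 \<le> (log n)/5\<close>, the product of the two bounds is of order \<open>n\<^bsup>1/2\<^esup> log n\<close> for every \<open>\<mu>\<close>, and the
  bias is of order \<open>log n\<close> times a negative power of \<open>n\<close>. The summands being independent, the risk
  estimate differs from the loss, in mean, by a negative power of \<open>n\<close> up to logarithms, uniformly in
  \<open>\<eta>\<close>, \<open>\<tau>\<close> and the unknown \<open>\<theta>\<^sub>i\<close>.

  The grids have only \<open>O(a\<^sub>n\<^sup>4)\<close> points, so these errors may be summed over the grids. The loss is
  Lipschitz in \<open>\<eta>\<close> and in \<open>\<tau>/(\<tau> + 1)\<close>, with a constant that is linear in the mean of the \<open>|X\<^sub>i|\<close>, and the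
  grids are fine enough for the oracle to be replaced by a grid point. The same mean bounds the empirical
  quantiles, hence the probability that the location range leaves \<open>[-a\<^sub>n, a\<^sub>n]\<close>.\<close>

section \<open>Gaussian integrals\<close>

text \<open>The obstacle is that only the mean of the |\<theta>_i| is controlled: a single \<mu> may
  be arbitrarily large, so every estimate for one coordinate has to be uniform in \<mu>. The
  constants have one source, (g + r)^2 <= 1/(4e) <= 1/10 with r^2 =
  \<open>\<nu>p\<close>/\<open>\<nu>f\<close> and g = \<gamma>(i). It gives s^2 <= 2 r^2 <= 1/5,
  hence the moment exponent 1/(1 - s^2) <= 5/4 and the tail exponent 1/(2 s^2) >= 5/2. The latter is
  at least twice as large, so that (l + t)^2 <= 2 l^2 + 2 t^2 cancels the growth in t = |\<mu>| - l.
  The slowest bias term is exp(- l^2/16) = n^(- g^2/8), which a positive infimum of the \<gamma>(i)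
  makes uniform in i. Independence of the summands is available only for nonrandom (\<eta>, \<tau>),
  while the minimiser depends on the data; summing over the whole grid bridges the two. In the
  comparison with the oracle all dependence on the sample is carried by W = 1 + mean |X_i|, whose
  square has bounded mean.\<close>

abbreviation "N \<equiv> std_normal_distribution"

lemma prob_space_N: "prob_space N"
  by (rule prob_space_normal_density) simp

interpretation N: prob_space N by (rule prob_space_N)
interpretation NN: pair_prob_space N N ..

section \<open>Invariance of the planar standard Gaussian under an orthogonal map\<close>

lemma phi_rotate:
  assumes "a\<^sup>2 + b\<^sup>2 = 1"
  shows "phi (a * p + b * q) * phi (b * p - a * q) = phi p * phi q"
proof -
  have "(a * p + b * q)\<^sup>2 + (b * p - a * q)\<^sup>2 = (a\<^sup>2 + b\<^sup>2) * (p\<^sup>2 + q\<^sup>2)" by algebra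
  then have "(a * p + b * q)\<^sup>2 + (b * p - a * q)\<^sup>2 = p\<^sup>2 + q\<^sup>2" using assms by simp
  then show ?thesis
    by (simp add: std_normal_density_def mult_exp_exp flip: add_divide_distrib)
qed

text \<open>The map (x, z) -> (a x + b z, b x - a z) is orthogonal. Two affine substitutions on the
  line suffice, with Tonelli's theorem in between: x is replaced by p with z fixed, then z by q with
  p fixed. The Jacobians 1/|a| and |a| cancel; this is where \<open>a \<noteq> 0\<close>
  enters.\<close>

lemma nn_integral_rotate:
  fixes f :: "real \<times> real \<Rightarrow> ennreal"
  assumes ab: "a\<^sup>2 + b\<^sup>2 = 1" and a: "a \<noteq> 0" and f[measurable]: "f \<in> borel_measurable (borel \<Otimes>\<^sub>M borel)"
  shows "(\<integral>\<^sup>+x. \<integral>\<^sup>+z. f (a * x + b * z, b * x - a * z) \<partial>N \<partial>N) = (\<integral>\<^sup>+p. \<integral>\<^sup>+q. f (p, q) \<partial>N \<partial>N)"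
proof -
  have "(\<integral>\<^sup>+x. \<integral>\<^sup>+z. f (a * x + b * z, b * x - a * z) \<partial>N \<partial>N)
     = (\<integral>\<^sup>+x. \<integral>\<^sup>+z. ennreal (phi x * phi z) * f (a * x + b * z, b * x - a * z) \<partial>lborel \<partial>lborel)"
    by (simp add: nn_integral_density ennreal_mult' mult.assoc nn_integral_cmult)
  also have "\<dots> = (\<integral>\<^sup>+z. \<integral>\<^sup>+x. ennreal (phi x * phi z) * f (a * x + b * z, b * x - a * z) \<partial>lborel \<partial>lborel)"
    by (rule lborel_pair.Fubini') measurable
  also have "\<dots> = (\<integral>\<^sup>+z. ennreal \<bar>1 / a\<bar> * (\<integral>\<^sup>+p. ennreal (phi ((p - b * z) / a) * phi z) * f (p, (b * p - z) / a) \<partial>lborel) \<partial>lborel)"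
  proof (rule nn_integral_cong)
    fix z
    have *: "b * ((p - b * z) / a) - a * z = (b * p - z) / a" for p
    proof -
      have "b * ((p - b * z) / a) - a * z = (b * p - (a\<^sup>2 + b\<^sup>2) * z) / a"
        using a by (simp add: field_simps power2_eq_square)
      then show ?thesis using ab by simp
    qed
    have ***: "- (b * z / a) + 1 / a * p = (p - b * z) / a" for p
      using a by (simp add: field_simps)
    have **: "a * ((p - b * z) / a) + b * z = p" for p
      using a by (simp add: field_simps)
    show "(\<integral>\<^sup>+x. ennreal (phi x * phi z) * f (a * x + b * z, b * x - a * z) \<partial>lborel)
      = ennreal \<bar>1 / a\<bar> * (\<integral>\<^sup>+p. ennreal (phi ((p - b * z) / a) * phi z) * f (p, (b * p - z) / a) \<partial>lborel)"
      using a nn_integral_real_affine[of "\<lambda>x. ennreal (phi x * phi z) * f (a * x + b * z, b * x - a * z)" "1 / a" "- (b * z / a)"]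
      by (simp only: * ** *** divide_eq_0_iff) simp
  qed
  also have "\<dots> = (\<integral>\<^sup>+z. \<integral>\<^sup>+p. ennreal \<bar>1 / a\<bar> * (ennreal (phi ((p - b * z) / a) * phi z) * f (p, (b * p - z) / a)) \<partial>lborel \<partial>lborel)"
    by (subst nn_integral_cmult) auto
  also have "\<dots> = (\<integral>\<^sup>+p. \<integral>\<^sup>+z. ennreal \<bar>1 / a\<bar> * (ennreal (phi ((p - b * z) / a) * phi z) * f (p, (b * p - z) / a)) \<partial>lborel \<partial>lborel)"
    by (rule lborel_pair.Fubini') measurable
  also have "\<dots> = (\<integral>\<^sup>+p. \<integral>\<^sup>+q. ennreal (phi p * phi q) * f (p, q) \<partial>lborel \<partial>lborel)"
  proof (rule nn_integral_cong)
    fix p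
    have 1: "(p - b * (b * p + - a * q)) / a = a * p + b * q" for q
    proof -
      have "(p - b * (b * p + - a * q)) / a = (p * (1 - b\<^sup>2) + a * b * q) / a"
        by (simp add: algebra_simps power2_eq_square)
      also have "1 - b\<^sup>2 = a\<^sup>2" using ab by simp
      finally show ?thesis using a by (simp add: field_simps power2_eq_square)
    qed
    have 2: "(b * p - (b * p + - a * q)) / a = q" for q
      using a by (simp add: field_simps)
    have c: "ennreal \<bar>- a\<bar> * (ennreal \<bar>1 / a\<bar> * x) = x" for x
      using a by (simp add: mult.assoc[symmetric] ennreal_mult'[symmetric])
    have "(\<integral>\<^sup>+z. ennreal \<bar>1 / a\<bar> * (ennreal (phi ((p - b * z) / a) * phi z) * f (p, (b * p - z) / a)) \<partial>lborel)
      = ennreal \<bar>- a\<bar> * (\<integral>\<^sup>+q. ennreal \<bar>1 / a\<bar> * (ennreal (phi (a * p + b * q) * phi (b * p - a * q)) * f (p, q)) \<partial>lborel)"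
      using a by (subst nn_integral_real_affine[where c="- a" and t="b * p"]) (auto simp: 1[simplified] 2[simplified])
    also have "\<dots> = (\<integral>\<^sup>+q. ennreal (phi (a * p + b * q) * phi (b * p - a * q)) * f (p, q) \<partial>lborel)"
      using c by (simp add: nn_integral_cmult)
    finally show "(\<integral>\<^sup>+z. ennreal \<bar>1 / a\<bar> * (ennreal (phi ((p - b * z) / a) * phi z) * f (p, (b * p - z) / a)) \<partial>lborel)
      = (\<integral>\<^sup>+q. ennreal (phi p * phi q) * f (p, q) \<partial>lborel)"
      by (simp add: phi_rotate[OF ab])
  qed
  also have "\<dots> = (\<integral>\<^sup>+p. \<integral>\<^sup>+q. f (p, q) \<partial>N \<partial>N)"
    by (simp add: nn_integral_density ennreal_mult' mult.assoc nn_integral_cmult)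
  finally show ?thesis .
qed

lemma sets_NN: "sets (N \<Otimes>\<^sub>M N) = sets (borel \<Otimes>\<^sub>M borel)"
  by (intro sets_pair_measure_cong) auto

lemma distr_rotate:
  assumes ab: "a\<^sup>2 + b\<^sup>2 = 1" and a: "a \<noteq> 0"
  shows "distr (N \<Otimes>\<^sub>M N) (N \<Otimes>\<^sub>M N) (\<lambda>(x, z). (a * x + b * z, b * x - a * z)) = N \<Otimes>\<^sub>M N"
proof (rule measure_eqI)
  fix A assume "A \<in> sets (distr (N \<Otimes>\<^sub>M N) (N \<Otimes>\<^sub>M N) (\<lambda>(x, z). (a * x + b * z, b * x - a * z)))"
  then have A[measurable]: "A \<in> sets (N \<Otimes>\<^sub>M N)" by simp
  have [measurable]: "A \<in> sets (borel \<Otimes>\<^sub>M borel)" using A sets_NN by blast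
  have [measurable]: "(\<lambda>(x, z). (a * x + b * z, b * x - a * z)) \<in> N \<Otimes>\<^sub>M N \<rightarrow>\<^sub>M N \<Otimes>\<^sub>M N"
    by measurable
  have "emeasure (distr (N \<Otimes>\<^sub>M N) (N \<Otimes>\<^sub>M N) (\<lambda>(x, z). (a * x + b * z, b * x - a * z))) A
     = (\<integral>\<^sup>+w. indicator A w \<partial>distr (N \<Otimes>\<^sub>M N) (N \<Otimes>\<^sub>M N) (\<lambda>(x, z). (a * x + b * z, b * x - a * z)))"
    by simp
  also have "\<dots> = (\<integral>\<^sup>+w. indicator A (case w of (x, z) \<Rightarrow> (a * x + b * z, b * x - a * z)) \<partial>(N \<Otimes>\<^sub>M N))"
    by (rule nn_integral_distr) measurable
  also have "\<dots> = (\<integral>\<^sup>+x. \<integral>\<^sup>+z. indicator A (a * x + b * z, b * x - a * z) \<partial>N \<partial>N)"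
    by (subst N.nn_integral_fst[symmetric]) auto
  also have "\<dots> = (\<integral>\<^sup>+p. \<integral>\<^sup>+q. indicator A (p, q) \<partial>N \<partial>N)"
    by (rule nn_integral_rotate[OF ab a]) measurable
  also have "\<dots> = (\<integral>\<^sup>+w. indicator A w \<partial>(N \<Otimes>\<^sub>M N))"
    by (subst N.nn_integral_fst[symmetric]) auto
  finally show "emeasure (distr (N \<Otimes>\<^sub>M N) (N \<Otimes>\<^sub>M N) (\<lambda>(x, z). (a * x + b * z, b * x - a * z))) A = emeasure (N \<Otimes>\<^sub>M N) A"
    by simp
qed simp

text \<open>Iterated integrals are the form needed in both uses: merging two Gaussian noises in
  \<open>G_convolution\<close>, and decoupling the datum from the auxiliary noise in the analysis of
  \<open>T_hat\<close>.\<close>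

lemma integral_rotate:
  fixes f :: "real \<times> real \<Rightarrow> real"
  assumes ab: "a\<^sup>2 + b\<^sup>2 = 1" "a \<noteq> 0" and f: "integrable (N \<Otimes>\<^sub>M N) f"
  shows "integrable (N \<Otimes>\<^sub>M N) (\<lambda>(x, z). f (a * x + b * z, b * x - a * z))"
    and "(\<integral>x. \<integral>z. f (a * x + b * z, b * x - a * z) \<partial>N \<partial>N) = (\<integral>p. \<integral>q. f (p, q) \<partial>N \<partial>N)"
proof -
  have [measurable]: "(\<lambda>(x, z). (a * x + b * z, b * x - a * z)) \<in> N \<Otimes>\<^sub>M N \<rightarrow>\<^sub>M N \<Otimes>\<^sub>M N"
    by measurable
  have "integrable (distr (N \<Otimes>\<^sub>M N) (N \<Otimes>\<^sub>M N) (\<lambda>(x, z). (a * x + b * z, b * x - a * z))) f"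
    using f by (simp only: distr_rotate[OF ab])
  then show I: "integrable (N \<Otimes>\<^sub>M N) (\<lambda>(x, z). f (a * x + b * z, b * x - a * z))"
    by (subst (asm) integrable_distr_eq) (use f in \<open>auto simp: case_prod_beta'\<close>)
  have "(\<integral>p. \<integral>q. f (p, q) \<partial>N \<partial>N) = integral\<^sup>L (N \<Otimes>\<^sub>M N) f"
    by (rule NN.integral_fst'[OF f])
  also have "\<dots> = integral\<^sup>L (distr (N \<Otimes>\<^sub>M N) (N \<Otimes>\<^sub>M N) (\<lambda>(x, z). (a * x + b * z, b * x - a * z))) f"
    by (simp only: distr_rotate[OF ab])
  also have "\<dots> = (\<integral>w. f (case w of (x, z) \<Rightarrow> (a * x + b * z, b * x - a * z)) \<partial>(N \<Otimes>\<^sub>M N))"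
    by (rule integral_distr) (use f in auto)
  also have "\<dots> = (\<integral>w. (\<lambda>(x, z). f (a * x + b * z, b * x - a * z)) w \<partial>(N \<Otimes>\<^sub>M N))"
    by (simp add: case_prod_beta')
  also have "\<dots> = (\<integral>x. \<integral>z. (\<lambda>(x, z). f (a * x + b * z, b * x - a * z)) (x, z) \<partial>N \<partial>N)"
    by (rule NN.integral_fst'[OF I, symmetric])
  finally show "(\<integral>x. \<integral>z. f (a * x + b * z, b * x - a * z) \<partial>N \<partial>N) = (\<integral>p. \<integral>q. f (p, q) \<partial>N \<partial>N)"
    by simp
qed

section \<open>Moments and tails of the standard normal law\<close>

lemma N_UNIV[simp]: "measure N UNIV = 1"
  using N.prob_space by simp

lemma integral_N:
  "f \<in> borel_measurable borel \<Longrightarrow> (\<integral>x. f x \<partial>N) = (\<integral>x. phi x * f x \<partial>lborel)"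
  for f :: "real \<Rightarrow> real"
  by (subst integral_density) auto

lemma integrable_N:
  "f \<in> borel_measurable borel \<Longrightarrow> integrable N f \<longleftrightarrow> integrable lborel (\<lambda>x. phi x * f x)"
  for f :: "real \<Rightarrow> real"
  by (subst integrable_density) auto

lemma integrable_N_power[simp, intro]: "integrable N (\<lambda>z. z ^ k)"
  by (subst integrable_N) (auto intro: integrable_std_normal_moment)

lemma integrable_N_id[simp, intro]: "integrable N (\<lambda>z. z)"
  using integrable_N_power[of 1] by simp

lemma integrable_N_abs[simp, intro]: "integrable N (\<lambda>z. \<bar>z\<bar>)"
  using integrable_N_id by (rule integrable_abs)

lemma integral_N_id[simp]: "(\<integral>z. z \<partial>N) = 0"
  using integral_std_normal_moment_odd[of 0] by (simp add: integral_N mult.commute)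

lemma integral_N_square[simp]: "(\<integral>z. z\<^sup>2 \<partial>N) = 1"
  using integral_std_normal_moment_even[of 1] by (simp add: integral_N)

text \<open>For x >= t >= 0 one has x^2 >= t^2 + (x - t)^2, so \<open>phi x\<close> is at most exp(-
  t^2/2) times the density shifted to t.\<close>

lemma N_upper_tail:
  assumes "0 \<le> t" shows "measure N {t..} \<le> exp (- t\<^sup>2 / 2)"
proof -
  have "emeasure N {t..} = (\<integral>\<^sup>+x. ennreal (phi x) * indicator {t..} x \<partial>lborel)"
    by (rule emeasure_density) auto
  also have "\<dots> \<le> (\<integral>\<^sup>+x. ennreal (exp (- t\<^sup>2 / 2)) * ennreal (phi (- t + 1 * x)) \<partial>lborel)"
  proof (rule nn_integral_mono)
    fix x
    show "ennreal (phi x) * indicator {t..} x \<le> ennreal (exp (- t\<^sup>2 / 2)) * ennreal (phi (- t + 1 * x))"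
    proof (cases "t \<le> x")
      case True
      then have "0 \<le> t * (x - t)" using assms by simp
      then have "- (x\<^sup>2) / 2 \<le> - t\<^sup>2 / 2 + - ((- t + x)\<^sup>2) / 2"
        by (simp add: power2_eq_square algebra_simps)
      then have "exp (- (x\<^sup>2) / 2) \<le> exp (- t\<^sup>2 / 2) * exp (- ((- t + x)\<^sup>2) / 2)"
        by (simp only: mult_exp_exp exp_le_cancel_iff)
      then have "phi x \<le> exp (- t\<^sup>2 / 2) * phi (- t + x)"
        by (simp add: std_normal_density_def divide_right_mono)
      then show ?thesis using True by (simp add: ennreal_mult'[symmetric] ennreal_leI)
    qed simp
  qed
  also have "\<dots> = ennreal (exp (- t\<^sup>2 / 2)) * (\<integral>\<^sup>+x. ennreal (phi (- t + 1 * x)) \<partial>lborel)"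
    by (rule nn_integral_cmult) auto
  also have "(\<integral>\<^sup>+x. ennreal (phi (- t + 1 * x)) \<partial>lborel) = (\<integral>\<^sup>+x. ennreal (phi x) \<partial>lborel)"
    by (subst (2) nn_integral_real_affine[where c=1 and t="-t"]) auto
  also have "\<dots> = 1"
    by (subst nn_integral_eq_integral) auto
  finally show ?thesis by (simp add: N.emeasure_eq_measure)
qed

lemma phi_even: "phi (- x) = phi x"
  by (simp add: std_normal_density_def)

lemma distr_N_uminus: "distr N borel uminus = N"
proof -
  have "distributed N lborel (\<lambda>x. x) phi"
    by (simp add: distributed_def distr_id2)
  from N.normal_density_affine[OF this, of "-1" 0]
  have "distributed N lborel (\<lambda>x. - x) phi" by simp
  then have "distr N lborel (\<lambda>x. - x) = N" by (simp add: distributed_def)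
  then show ?thesis by (simp cong: distr_cong)
qed

lemma N_lower_tail:
  assumes "0 \<le> t" shows "measure N {..- t} \<le> exp (- t\<^sup>2 / 2)"
proof -
  have "measure N {..- t} = measure (distr N borel uminus) {..- t}" by (simp only: distr_N_uminus)
  also have "\<dots> = measure N (uminus -` {..- t} \<inter> space N)" by (rule measure_distr) auto
  also have "uminus -` {..- t} \<inter> space N = {t..}" by auto
  finally show ?thesis using N_upper_tail[OF assms] by simp
qed

section \<open>The distribution function and the loss function G\<close>

lemma Phi_nonneg: "0 \<le> Phi x" and Phi_le_1: "Phi x \<le> 1"
  by (auto simp: Phi_def cdf_def)

lemma one_minus_Phi: "1 - Phi x = measure N {x<..}"
proof -
  have "1 - Phi x = 1 - measure N {..x}" by (simp add: Phi_def cdf_def)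
  also have "\<dots> = measure N (space N - {..x})" by (subst N.prob_compl) auto
  also have "space N - {..x} = {x<..}" by auto
  finally show ?thesis .
qed

lemma Phi_uminus: "Phi (- x) = 1 - Phi x"
proof -
  have "Phi (- x) = measure (distr N borel uminus) {..- x}" by (simp only: distr_N_uminus Phi_def cdf_def)
  also have "\<dots> = measure N (uminus -` {..- x} \<inter> space N)" by (rule measure_distr) auto
  also have "uminus -` {..- x} \<inter> space N = {x..}" by auto
  also have "measure N {x..} = measure N {x<..} + measure N {x}"
    by (subst N.finite_measure_Union[symmetric]) (auto intro: arg_cong[where f="measure N"])
  also have "measure N {x} = 0"
  proof -
    have "emeasure N {x} = (\<integral>\<^sup>+y. ennreal (phi y) * indicator {x} y \<partial>lborel)"
      by (rule emeasure_density) auto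
    also have "\<dots> = 0" by (subst nn_integral_0_iff_AE) (auto intro!: AE_I[where N="{x}"])
    finally show ?thesis by (simp add: N.emeasure_eq_measure)
  qed
  finally show ?thesis by (simp add: one_minus_Phi)
qed

lemma DERIV_phi: "(phi has_real_derivative - x * phi x) (at x)"
proof -
  have "((\<lambda>x. 1 / sqrt (2 * pi) * exp (- x\<^sup>2 / 2)) has_real_derivative
      1 / sqrt (2 * pi) * (exp (- x\<^sup>2 / 2) * (- (2 * x) / 2))) (at x)"
    by (rule derivative_eq_intros refl | simp)+
  then show ?thesis by (simp add: std_normal_density_def[abs_def] mult_ac)
qed

lemma continuous_phi: "continuous_on A phi"
  unfolding std_normal_density_def by (intro continuous_intros) auto

lemma Phi_diff: "a \<le> b \<Longrightarrow> Phi b - Phi a = integral {a..b} phi"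
proof -
  assume ab: "a \<le> b"
  have "Phi b - Phi a = measure N {a<..b}"
    using ab unfolding Phi_def cdf_def
    by (subst N.finite_measure_Diff[symmetric]) (auto intro!: arg_cong[where f="measure N"])
  also have "\<dots> = (\<integral>x. indicator {a<..b} x \<partial>N)" by simp
  also have "\<dots> = (\<integral>x. phi x * indicator {a<..b} x \<partial>lborel)" by (subst integral_N) auto
  also have "\<dots> = (\<integral>x. indicator {a..b} x *\<^sub>R phi x \<partial>lborel)"
    by (intro integral_cong_AE) (auto intro!: AE_I[where N="{a}"] simp: indicator_def)
  also have "\<dots> = integral {a..b} phi"
    using set_borel_integral_eq_integral(2)[of "{a..b}" phi] borel_integrable_atLeastAtMost'[OF continuous_phi]
    by (simp add: set_lebesgue_integral_def)
  finally show ?thesis .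
qed

lemma DERIV_Phi: "(Phi has_real_derivative phi x) (at x)"
proof -
  have "((\<lambda>u. integral {x - 1..u} phi) has_real_derivative phi x) (at x within {x - 1..x + 1})"
    using integral_has_real_derivative[OF continuous_phi, of x "x - 1" "x + 1"] by auto
  then have "((\<lambda>u. integral {x - 1..u} phi) has_real_derivative phi x) (at x)"
    by (subst (asm) at_within_interior) auto
  then have "((\<lambda>u. Phi (x - 1) + integral {x - 1..u} phi) has_real_derivative phi x) (at x)"
    by (auto intro!: derivative_eq_intros)
  then show ?thesis
  proof (rule has_field_derivative_transform_within_open[where S="{x - 1<..}"])
    fix y assume "y \<in> {x - 1<..}"
    then show "Phi (x - 1) + integral {x - 1..y} phi = Phi y"
      using Phi_diff[of "x - 1" y] by simp
  qed auto
qed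

lemma DERIV_G: "((\<lambda>w. G w \<beta>) has_real_derivative Phi w - \<beta>) (at w)"
  unfolding G_def by (auto intro!: derivative_eq_intros DERIV_phi DERIV_Phi)

lemma G_lipschitz:
  assumes "0 \<le> \<beta>" "\<beta> \<le> 1" shows "\<bar>G u \<beta> - G w \<beta>\<bar> \<le> \<bar>u - w\<bar>"
proof -
  have "\<bar>G y \<beta> - G x \<beta>\<bar> \<le> \<bar>y - x\<bar>" if xy: "x < y" for x y
  proof -
    obtain z where "G y \<beta> - G x \<beta> = (y - x) * (Phi z - \<beta>)"
      using MVT2[OF xy, of "\<lambda>w. G w \<beta>" "\<lambda>w. Phi w - \<beta>"] DERIV_G by blast
    moreover have "\<bar>Phi z - \<beta>\<bar> \<le> 1"
      using Phi_nonneg[of z] Phi_le_1[of z] assms by (simp add: abs_le_iff)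
    ultimately show ?thesis by (simp add: abs_mult mult_left_le)
  qed
  from this[of u w] this[of w u] show ?thesis
    by (cases u w rule: linorder_cases) (auto simp: abs_minus_commute)
qed

lemma phi_0_le_1: "phi 0 \<le> 1" and phi_le_1: "phi x \<le> 1"
proof -
  have p: "1 \<le> sqrt (2 * pi)" using pi_gt3 by simp
  show 1: "phi 0 \<le> 1" using p by (simp add: std_normal_density_def)
  have "phi x \<le> phi 0" by (simp add: std_normal_density_def divide_right_mono)
  then show "phi x \<le> 1" using 1 by linarith
qed

lemma G_0: "G 0 \<beta> = phi 0" by (simp add: G_def)

lemma abs_G_le:
  assumes "0 \<le> \<beta>" "\<beta> \<le> 1" shows "\<bar>G w \<beta>\<bar> \<le> 1 + \<bar>w\<bar>"
  using G_lipschitz[OF assms, of w 0] phi_0_le_1 normal_density_nonneg[of 0 1 0] G_0[of \<beta>] by linarith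

text \<open>max(0, w - z) differs from w - z by (w - z) on {z > w}, so only the mean of z over {z >
  w} is needed; it is \<open>phi w\<close>, because - phi is an antiderivative of x phi(x).\<close>

lemma integral_pos_part:
  "(\<integral>z. max 0 (w - z) \<partial>N) = phi w + w * Phi w" and "integrable N (\<lambda>z. max 0 (w - z))"
proof -
  show I: "integrable N (\<lambda>z. max 0 (w - z))"
    by (rule Bochner_Integration.integrable_bound[where f="\<lambda>z. \<bar>w\<bar> + \<bar>z\<bar>"]) auto
  have tend: "((\<lambda>x. phi x) \<longlongrightarrow> 0) at_top"
    unfolding std_normal_density_def by real_asymp
  have FT: "(\<integral>\<^sup>+x. ennreal (x * phi x) * indicator {a..} x \<partial>lborel) = ennreal (phi a)" if "0 \<le> a" for a
  proof -
    have "(\<integral>\<^sup>+x. ennreal (x * phi x) * indicator {a..} x \<partial>lborel) = ennreal (0 - (- phi a))"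
    proof (rule nn_integral_FTC_atLeast)
      show "((\<lambda>x. - phi x) has_real_derivative x * phi x) (at x)" for x
        using DERIV_minus[OF DERIV_phi, of x] by simp
      show "0 \<le> x * phi x" if "a \<le> x" for x using that \<open>0 \<le> a\<close> by simp
      show "((\<lambda>x. - phi x) \<longlongrightarrow> 0) at_top" using tendsto_minus[OF tend] by simp
    qed auto
    then show ?thesis by simp
  qed
  have I': "integrable lborel (\<lambda>x. phi x * x)" using integrable_std_normal_moment[of 1] by simp
  have up: "(\<integral>x. phi x * (x * indicator {a<..} x) \<partial>lborel) = phi a" for a
  proof -
    have pos: "(\<integral>x. phi x * (x * indicator {a<..} x) \<partial>lborel) = phi a" if "0 \<le> a" for a
    proof -
      have "(\<integral>x. phi x * (x * indicator {a<..} x) \<partial>lborel) = (\<integral>x. x * phi x * indicator {a..} x \<partial>lborel)"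
        by (intro integral_cong_AE) (auto intro!: AE_I[where N="{a}"] simp: indicator_def)
      also have "\<dots> = enn2real (\<integral>\<^sup>+x. ennreal (x * phi x * indicator {a..} x) \<partial>lborel)"
        using that by (intro integral_eq_nn_integral) (auto simp: indicator_def)
      also have "(\<integral>\<^sup>+x. ennreal (x * phi x * indicator {a..} x) \<partial>lborel)
           = (\<integral>\<^sup>+x. ennreal (x * phi x) * indicator {a..} x \<partial>lborel)"
        by (intro nn_integral_cong) (auto simp: indicator_def)
      finally show ?thesis using FT[OF that] by simp
    qed
    show ?thesis
    proof (cases "0 \<le> a")
      case False
      have "(\<integral>x. phi x * (x * indicator {a<..} x) \<partial>lborel) = (\<integral>x. phi x * (x * indicator {-a<..} x) + phi x * (x * indicator {a<..- a} x) \<partial>lborel)"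
        using False by (intro Bochner_Integration.integral_cong) (auto simp: indicator_def)
      also have "\<dots> = (\<integral>x. phi x * (x * indicator {-a<..} x) \<partial>lborel) + (\<integral>x. phi x * (x * indicator {a<..- a} x) \<partial>lborel)"
        using I' by (intro Bochner_Integration.integral_add)
          (auto intro!: Bochner_Integration.integrable_bound[OF I'] simp: abs_mult indicator_def)
      \<comment> \<open>The fundamental theorem was applied to nonnegative integrands only, so a
        negative a is reduced to - a: over (a, - a] the integrand is odd up to the end points, and
        its integral equals its own negative.\<close>
      also have "(\<integral>x. phi x * (x * indicator {a<..- a} x) \<partial>lborel) = 0"
      proof -
        have "(\<integral>x. phi x * (x * indicator {a<..- a} x) \<partial>lborel)
          = (\<integral>x. phi (- x) * (- x * indicator {a<..- a} (- x)) \<partial>lborel)"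
          by (subst lborel_integral_real_affine[where c="-1" and t=0]) auto
        also have "\<dots> = (\<integral>x. - (phi x * (x * indicator {a<..- a} x)) \<partial>lborel)"
          by (intro integral_cong_AE) (auto intro!: AE_I[where N="{a, -a}"] simp: phi_even indicator_def emeasure_lborel_countable)
        also have "\<dots> = - (\<integral>x. phi x * (x * indicator {a<..- a} x) \<partial>lborel)" by simp
        finally show ?thesis by simp
      qed
      finally show ?thesis using pos[of "-a"] False by (simp add: phi_even)
    qed (rule pos)
  qed
  have J: "integrable N (\<lambda>x. x * indicator {w<..} x)" "integrable N (\<lambda>x. indicator {w<..} x :: real)"
    by (rule Bochner_Integration.integrable_bound[OF integrable_N_abs], auto simp: indicator_def)
       (rule N.integrable_const_bound[where B=1], auto simp: indicator_def)
  have "(\<integral>z. max 0 (w - z) \<partial>N) = (\<integral>z. (w - z) - (w * indicator {w<..} z - z * indicator {w<..} z) \<partial>N)"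
    by (intro Bochner_Integration.integral_cong) (auto simp: indicator_def)
  also have "\<dots> = w - (w * measure N {w<..} - (\<integral>z. z * indicator {w<..} z \<partial>N))"
    using J by (simp add: N.prob_space)
  also have "(\<integral>z. z * indicator {w<..} z \<partial>N) = phi w"
    using up[of w] by (subst integral_N) auto
  finally show "(\<integral>z. max 0 (w - z) \<partial>N) = phi w + w * Phi w"
    by (simp add: one_minus_Phi[symmetric] algebra_simps)
qed

text \<open>\<open>sqrt v * G (w / sqrt v) \<beta>\<close> is the mean check loss of \<open>w\<close> under \<open>N(0, v)\<close>, so Gaussian noise
  added to \<open>w\<close> only increases \<open>v\<close>.\<close>

lemma G_scaled:
  assumes "0 < v"
  shows "sqrt v * G (w / sqrt v) \<beta> = (\<integral>y. max 0 (w - sqrt v * y) \<partial>N) - \<beta> * w"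
proof -
  have "(\<integral>y. max 0 (w - sqrt v * y) \<partial>N) = (\<integral>y. sqrt v * max 0 (w / sqrt v - y) \<partial>N)"
    using assms by (intro Bochner_Integration.integral_cong) (auto simp: max_def field_simps)
  then show ?thesis using assms by (simp add: integral_pos_part G_def algebra_simps)
qed

lemma integrable_NN_mult:
  fixes f g :: "real \<Rightarrow> real"
  assumes "integrable N f" "integrable N g"
  shows "integrable (N \<Otimes>\<^sub>M N) (\<lambda>w. f (fst w) * g (snd w))"
proof (rule NN.Fubini_integrable)
  have [measurable]: "f \<in> borel_measurable N" "g \<in> borel_measurable N" using assms by auto
  show "(\<lambda>w. f (fst w) * g (snd w)) \<in> borel_measurable (N \<Otimes>\<^sub>M N)" by measurable
qed (use assms in \<open>auto simp: abs_mult\<close>)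

lemma integrable_NN_fst: "integrable N f \<Longrightarrow> integrable (N \<Otimes>\<^sub>M N) (\<lambda>w. f (fst w))" for f :: "real \<Rightarrow> real"
  using integrable_NN_mult[of f "\<lambda>_. 1"] by simp

text \<open>Independent Gaussian noises merge: sqrt v y - \<sigma> z is \<rho> times one coordinate
  of a rotated pair, with \<rho>^2 = v + \<sigma>^2. The coordinate loss averaged over X_i is an
  instance, with \<sigma> the standard deviation of the predictor.\<close>

lemma G_convolution:
  assumes v: "0 < v" and \<beta>: "0 \<le> \<beta>" "\<beta> \<le> 1"
  shows "(\<integral>z. sqrt v * G ((m + \<sigma> * z) / sqrt v) \<beta> \<partial>N) = sqrt (v + \<sigma>\<^sup>2) * G (m / sqrt (v + \<sigma>\<^sup>2)) \<beta>"
proof -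
  define \<rho> where "\<rho> = sqrt (v + \<sigma>\<^sup>2)"
  have \<rho>2: "\<rho>\<^sup>2 = v + \<sigma>\<^sup>2" and \<rho>: "0 < \<rho>" using v by (auto simp: \<rho>_def add_pos_nonneg)
  let ?f = "\<lambda>w. max 0 (m - \<rho> * fst w)"
  let ?a = "sqrt v / \<rho>" and ?b = "- \<sigma> / \<rho>"
  have ab: "?a\<^sup>2 + ?b\<^sup>2 = 1" "?a \<noteq> 0"
    using v \<rho> add_pos_nonneg[of v "\<sigma>\<^sup>2"] by (auto simp: power_divide \<rho>2 simp flip: add_divide_distrib)
  have "integrable N (\<lambda>x. max 0 (m - \<rho> * x))"
  proof (rule Bochner_Integration.integrable_bound[where f="\<lambda>x. \<bar>m\<bar> + \<rho> * \<bar>x\<bar>"])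
    have "m - \<rho> * x \<le> \<bar>m\<bar> + \<rho> * \<bar>x\<bar>" for x
      using \<rho> mult_left_mono[OF abs_ge_minus_self[of x], of \<rho>] abs_ge_self[of m] by simp
    then show "AE x in N. norm (max 0 (m - \<rho> * x)) \<le> norm (\<bar>m\<bar> + \<rho> * \<bar>x\<bar>)"
      using \<rho> by (auto simp: max_def)
  qed auto
  then have I: "integrable (N \<Otimes>\<^sub>M N) ?f" by (rule integrable_NN_fst)
  have eq: "\<rho> * (?a * x + ?b * z) = sqrt v * x - \<sigma> * z" for x z
    using \<rho> by (simp add: field_simps)
  have J: "integrable (N \<Otimes>\<^sub>M N) (\<lambda>(x, z). max 0 (m - (sqrt v * x - \<sigma> * z)))"
    using integral_rotate(1)[OF ab I] by (simp only: fst_conv eq)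
  have "(\<integral>z. sqrt v * G ((m + \<sigma> * z) / sqrt v) \<beta> \<partial>N)
      = (\<integral>z. (\<integral>y. max 0 (m - (sqrt v * y - \<sigma> * z)) \<partial>N) - \<beta> * (m + \<sigma> * z) \<partial>N)"
    by (simp add: G_scaled[OF v] algebra_simps)
  also have "\<dots> = (\<integral>z. (\<integral>y. max 0 (m - (sqrt v * y - \<sigma> * z)) \<partial>N) \<partial>N) - \<beta> * m"
    using NN.integrable_snd[OF J] by (subst Bochner_Integration.integral_diff) (auto simp: N.prob_space)
  also have "(\<integral>z. (\<integral>y. max 0 (m - (sqrt v * y - \<sigma> * z)) \<partial>N) \<partial>N)
      = (\<integral>y. (\<integral>z. max 0 (m - (sqrt v * y - \<sigma> * z)) \<partial>N) \<partial>N)"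
    using NN.Fubini_integral[OF J] by simp
  also have "\<dots> = (\<integral>p. \<integral>q. ?f (p, q) \<partial>N \<partial>N)"
    using integral_rotate(2)[OF ab I] by (simp only: fst_conv eq)
  also have "\<dots> = (\<integral>p. max 0 (m - \<rho> * p) \<partial>N)" by (simp add: N.prob_space)
  also have "\<dots> - \<beta> * m = \<rho> * G (m / \<rho>) \<beta>"
    using G_scaled[of "\<rho>\<^sup>2" m \<beta>] \<rho> by simp
  finally show ?thesis by (simp add: \<rho>_def)
qed

section \<open>Hermite polynomials\<close>

lemma hermite_0: "hermite 0 = (\<lambda>x. 1)" by auto

text \<open>The Appell property, on which the addition formula and the orthogonality rest. The
  defining recursion has depth two, hence the strong induction.\<close>

lemma DERIV_hermite: "(hermite (Suc k) has_real_derivative real (Suc k) * hermite k x) (at x)"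
proof (induction k arbitrary: x rule: less_induct)
  case (less k)
  show ?case
  proof (cases k)
    case 0
    then show ?thesis by (auto intro!: derivative_eq_intros)
  next
    case (Suc j)
    have "(hermite j has_real_derivative real j * hermite (j - 1) x) (at x)"
      using less.IH[of "j - 1"] Suc by (cases j) (auto simp: hermite_0)
    moreover have "(hermite (Suc j) has_real_derivative real (Suc j) * hermite j x) (at x)"
      using less.IH[of j] Suc by simp
    ultimately have "((\<lambda>x. x * hermite (Suc j) x - real (Suc j) * hermite j x) has_real_derivative
        hermite (Suc j) x + x * (real (Suc j) * hermite j x) - real (Suc j) * (real j * hermite (j - 1) x)) (at x)"
      by (auto intro!: derivative_eq_intros)
    also have "hermite (Suc j) x + x * (real (Suc j) * hermite j x) - real (Suc j) * (real j * hermite (j - 1) x)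
        = real (Suc k) * hermite k x"
      unfolding Suc by (cases j) (auto simp: algebra_simps)
    finally show ?thesis by (simp add: Suc)
  qed
qed

lemma DERIV_hermite': "(hermite k has_real_derivative real k * hermite (k - 1) x) (at x)"
  using DERIV_hermite[of "k - 1" x] by (cases k) (auto simp: hermite_0)

lemma hermite_Suc: "hermite (Suc k) x = x * hermite k x - real k * hermite (k - 1) x"
  by (cases k) auto

text \<open>Taylor's formula in x. In the induction step both sides have the same derivative in x,
  namely k + 1 times the identity for k, and they agree at x = 0.\<close>

lemma hermite_add:
  "hermite k (x + y) = (\<Sum>j\<le>k. real (k choose j) * x ^ (k - j) * hermite j y)"
proof (induction k arbitrary: x)
  case (Suc k)
  define f where "f x = hermite (Suc k) (x + y) - (\<Sum>j\<le>Suc k. real (Suc k choose j) * x ^ (Suc k - j) * hermite j y)" for x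
  have "(f has_real_derivative 0) (at x)" for x
  proof -
    have DERIV_h: "((\<lambda>x. hermite (Suc k) (x + y)) has_real_derivative real (Suc k) * hermite k (x + y)) (at x)"
      by (rule DERIV_hermite[of k "x + y", unfolded DERIV_shift])
    have "(f has_real_derivative real (Suc k) * hermite k (x + y)
       - (\<Sum>j\<le>Suc k. real (Suc k choose j) * (real (Suc k - j) * x ^ (Suc k - j - 1)) * hermite j y)) (at x)"
      unfolding f_def
      by (rule DERIV_diff[OF DERIV_h], intro DERIV_sum DERIV_cmult DERIV_cmult_right)
         (auto intro!: derivative_eq_intros)
    also have "(\<Sum>j\<le>Suc k. real (Suc k choose j) * (real (Suc k - j) * x ^ (Suc k - j - 1)) * hermite j y)
       = (\<Sum>j\<le>k. real (Suc k) * (real (k choose j) * x ^ (k - j) * hermite j y))"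
    proof -
      have "real (Suc k choose j) * real (Suc k - j) = real (Suc k) * real (k choose j)" for j
        using binomial_absorb_comp[of "Suc k" j] by (metis diff_Suc_1 mult.commute of_nat_mult)
      then have "real (Suc k choose j) * (real (Suc k - j) * x ^ (Suc k - j - 1)) * hermite j y
         = real (Suc k) * (real (k choose j) * x ^ (Suc k - j - 1) * hermite j y)" for j
        by (metis mult.assoc)
      then show ?thesis by (simp only: sum.atMost_Suc) (simp del: of_nat_Suc)
    qed
    finally show ?thesis using Suc.IH[of x] by (simp add: sum_distrib_left)
  qed
  then have "f x = f 0" using DERIV_isconst_all[of f x 0] by blast
  \<comment> \<open>At x = 0 only the term j = k + 1 survives, where
    \<open>0 ^ 0 = 1\<close>.\<close>
  also have "f 0 = 0"
  proof -
    have "(\<Sum>j\<le>Suc k. real (Suc k choose j) * 0 ^ (Suc k - j) * hermite j y)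
      = (\<Sum>j\<le>Suc k. if j = Suc k then hermite (Suc k) y else 0)"
      by (intro sum.cong) (auto simp: power_0_left)
    then show ?thesis by (simp add: f_def)
  qed
  finally show ?case by (simp add: f_def)
qed simp

text \<open>Products of Hermite polynomials become values of \<open>poly\<close>, so that they
  inherit integrability under \<open>N\<close> and integration by parts.\<close>

lemma ex_poly_hermite: "\<exists>p. \<forall>x. hermite k x = poly p x"
proof (induction k rule: less_induct)
  case (less k)
  show ?case
  proof (cases k)
    case 0
    then show ?thesis by (intro exI[of _ 1]) auto
  next
    case (Suc j)
    obtain p where p: "\<And>x. hermite j x = poly p x" using less.IH[of j] Suc by auto
    obtain q where q: "\<And>x. real j * hermite (j - 1) x = poly (smult (real j) q) x"
    proof -
      have "j - 1 < k" using Suc by simp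
      then obtain q where q: "\<forall>x. hermite (j - 1) x = poly q x" using less.IH by blast
      show ?thesis by (rule that[of q]) (metis poly_smult q)
    qed
    show ?thesis
      by (intro exI[of _ "[:0, 1:] * p - smult (real j) q"] allI)
         (simp only: Suc hermite_Suc poly_diff poly_mult p q, simp)
  qed
qed

section \<open>Gaussian integration by parts and orthogonality\<close>

lemma integrable_N_poly: "integrable N (poly p)"
  unfolding poly_altdef[abs_def] by auto

lemma integrable_N_poly_like: "(\<And>x. f x = poly p x) \<Longrightarrow> integrable N f"
proof -
  assume "\<And>x. f x = poly p x"
  then have "f = poly p" by auto
  then show ?thesis using integrable_N_poly by simp
qed

text \<open>Integration by parts for a monomial, read off the explicit moments. At i = 0 the
  truncated difference i - 1 is multiplied by 0.\<close>

lemma N_moment_rec: "(\<integral>z. z * z ^ i \<partial>N) = real i * (\<integral>z. z ^ (i - 1) \<partial>N)"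
proof (cases i)
  case (Suc j)
  have "(\<integral>z. z ^ Suc (Suc j) \<partial>N) = real (Suc j) * (\<integral>z. z ^ j \<partial>N)"
  proof (cases "even j")
    case True
    then obtain m where m: "j = 2 * m" by blast
    have "(\<integral>z. z ^ (2 * Suc m) \<partial>N) = fact (2 * Suc m) / (2 ^ Suc m * fact (Suc m))"
      using integral_std_normal_moment_even[of "Suc m"] by (subst integral_N) auto
    moreover have "(\<integral>z. z ^ (2 * m) \<partial>N) = fact (2 * m) / (2 ^ m * fact m)"
      using integral_std_normal_moment_even[of m] by (subst integral_N) auto
    moreover have "fact (2 * Suc m) / (2 ^ Suc m * fact (Suc m)) = real (Suc (2 * m)) * (fact (2 * m) / (2 ^ m * fact m) :: real)"
    proof -
      have "fact (2 * Suc m) = (2 * real (Suc m)) * (real (Suc (2 * m)) * fact (2 * m))" by simp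
      moreover have "2 ^ Suc m * fact (Suc m) = (2 * real (Suc m)) * (2 ^ m * fact m)" by simp
      ultimately show ?thesis by (simp only: times_divide_eq_right mult_divide_mult_cancel_left_if) simp
    qed
    ultimately show ?thesis by (simp add: m)
  next
    case False
    then obtain m where m: "j = 2 * m + 1" by (auto elim: oddE)
    show ?thesis
      using integral_std_normal_moment_odd[of "Suc m"] integral_std_normal_moment_odd[of m]
      by (simp add: integral_N m del: power_Suc)
  qed
  then show ?thesis by (simp add: Suc)
qed simp

lemma stein_poly: "(\<integral>z. z * poly p z \<partial>N) = (\<integral>z. poly (pderiv p) z \<partial>N)"
proof -
  have d: "poly (pderiv p) z = (\<Sum>i\<le>degree p. coeff p i * (real i * z ^ (i - 1)))" for z
  proof -
    have "((\<lambda>z. \<Sum>i\<le>degree p. coeff p i * z ^ i) has_real_derivative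
        (\<Sum>i\<le>degree p. coeff p i * (real i * z ^ (i - 1)))) (at z)"
      by (intro DERIV_sum DERIV_cmult) (auto intro!: derivative_eq_intros)
    then have "(poly p has_real_derivative (\<Sum>i\<le>degree p. coeff p i * (real i * z ^ (i - 1)))) (at z)"
      by (simp only: poly_altdef[abs_def])
    then show ?thesis using poly_DERIV[of p z] DERIV_unique by blast
  qed
  have i: "integrable N (\<lambda>z. z * z ^ i)" for i using integrable_N_power[of "Suc i"] by simp
  have "(\<integral>z. z * poly p z \<partial>N) = (\<integral>z. (\<Sum>i\<le>degree p. coeff p i * (z * z ^ i)) \<partial>N)"
    by (simp add: poly_altdef sum_distrib_left mult_ac)
  also have "\<dots> = (\<Sum>i\<le>degree p. coeff p i * (\<integral>z. z * z ^ i \<partial>N))"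
    by (subst Bochner_Integration.integral_sum) (auto simp: i)
  also have "\<dots> = (\<Sum>i\<le>degree p. coeff p i * (real i * (\<integral>z. z ^ (i - 1) \<partial>N)))"
    by (simp only: N_moment_rec)
  also have "\<dots> = (\<integral>z. poly (pderiv p) z \<partial>N)"
    unfolding d by (subst Bochner_Integration.integral_sum) auto
  finally show ?thesis .
qed

lemma integrable_hermite_mult: "integrable N (\<lambda>z. hermite j z * hermite k z)"
proof -
  obtain p q where "\<And>x. hermite j x = poly p x" "\<And>x. hermite k x = poly q x"
    using ex_poly_hermite by metis
  then show ?thesis by (intro integrable_N_poly_like[of _ "p * q"]) auto
qed

text \<open>H_{j+1} = z H_j - H_j', so the integrand is z (H_j H_k) - H_j' H_k. Stein's identity
  replaces the factor z by a derivative; the terms with H_j' cancel and H_j H_k' = k H_j H_{k-1} is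
  left.\<close>

lemma hermite_orthogonal_rec:
  "(\<integral>z. hermite (Suc j) z * hermite k z \<partial>N) = real k * (\<integral>z. hermite j z * hermite (k - 1) z \<partial>N)"
proof -
  obtain p q where p: "\<And>x. hermite j x = poly p x" and q: "\<And>x. hermite k x = poly q x"
    using ex_poly_hermite by metis
  have d: "poly (pderiv (p * q)) x = real j * hermite (j - 1) x * hermite k x + real k * (hermite j x * hermite (k - 1) x)" for x
  proof -
    have "((\<lambda>x. hermite j x * hermite k x) has_real_derivative
      real j * hermite (j - 1) x * hermite k x + real k * hermite (k - 1) x * hermite j x) (at x)"
      by (rule DERIV_mult[OF DERIV_hermite' DERIV_hermite'])
    moreover have "(\<lambda>x. hermite j x * hermite k x) = poly (p * q)" by (auto simp: p q)
    ultimately show ?thesis using poly_DERIV[of "p * q" x] DERIV_unique by (metis (no_types, lifting) mult.assoc mult.commute)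
  qed
  have i1: "integrable N (\<lambda>z. z * (hermite j z * hermite k z))"
    by (intro integrable_N_poly_like[of _ "[:0, 1:] * (p * q)"]) (auto simp: p q)
  have i2: "integrable N (\<lambda>z. real j * (hermite (j - 1) z * hermite k z))"
    by (intro integrable_mult_right integrable_hermite_mult)
  have "(\<integral>z. hermite (Suc j) z * hermite k z \<partial>N)
     = (\<integral>z. z * (hermite j z * hermite k z) - real j * (hermite (j - 1) z * hermite k z) \<partial>N)"
    by (simp add: hermite_Suc algebra_simps)
  also have "\<dots> = (\<integral>z. z * poly (p * q) z \<partial>N) - (\<integral>z. real j * (hermite (j - 1) z * hermite k z) \<partial>N)"
    using i1 i2 by (simp add: p q)
  also have "(\<integral>z. z * poly (p * q) z \<partial>N) = (\<integral>z. real j * (hermite (j - 1) z * hermite k z) + real k * (hermite j z * hermite (k - 1) z) \<partial>N)"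
    unfolding stein_poly d by (simp add: mult.assoc)
  also have "\<dots> = (\<integral>z. real j * (hermite (j - 1) z * hermite k z) \<partial>N) + real k * (\<integral>z. hermite j z * hermite (k - 1) z \<partial>N)"
    using i2 integrable_hermite_mult by simp
  finally show ?thesis by simp
qed

lemma hermite_orthogonal:
  "(\<integral>z. hermite j z * hermite k z \<partial>N) = (if j = k then fact k else 0)"
proof (induction j arbitrary: k)
  case 0
  show ?case
  proof (cases k)
    case (Suc i)
    show ?thesis using hermite_orthogonal_rec[of i 0] by (simp add: Suc mult.commute)
  qed simp
next
  case (Suc j)
  show ?case by (subst hermite_orthogonal_rec) (cases k; auto simp: Suc.IH)
qed

section \<open>Scaled Hermite polynomials of a N(\<mu>, s^2) variable\<close>

lemma hermite_shift:
  assumes "s \<noteq> 0"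
  shows "s ^ m * hermite m ((\<mu> + s * p) / s)
    = (\<Sum>j\<le>m. real (m choose j) * s ^ j * \<mu> ^ (m - j) * hermite j p)"
proof -
  have "(\<mu> + s * p) / s = \<mu> / s + p" using assms by (simp add: field_simps)
  then have "s ^ m * hermite m ((\<mu> + s * p) / s) = (\<Sum>j\<le>m. s ^ m * (real (m choose j) * (\<mu> / s) ^ (m - j) * hermite j p))"
    by (simp add: hermite_add sum_distrib_left)
  also have "\<dots> = (\<Sum>j\<le>m. real (m choose j) * s ^ j * \<mu> ^ (m - j) * hermite j p)"
  proof (rule sum.cong)
    fix j assume "j \<in> {..m}"
    then have "s ^ m = s ^ j * s ^ (m - j)" by (simp flip: power_add)
    then show "s ^ m * (real (m choose j) * (\<mu> / s) ^ (m - j) * hermite j p)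
        = real (m choose j) * s ^ j * \<mu> ^ (m - j) * hermite j p"
      using assms by (simp add: power_divide)
  qed simp
  finally show ?thesis .
qed

lemma integrable_hermite: "integrable N (hermite k)"
  using integrable_hermite_mult[of k 0] by simp

lemma integral_hermite: "(\<integral>z. hermite k z \<partial>N) = (if k = 0 then 1 else 0)"
  using hermite_orthogonal[of 0 k] by (cases k) auto

text \<open>All H_j with j > 0 have mean zero, so only the term j = 0 of the expansion in p
  survives. Hence every polynomial in the unknown \<mu> has an unbiased estimate in U = \<mu> + s
  p.\<close>

lemma hermite_unbiased:
  assumes "s \<noteq> 0"
  shows "(\<integral>p. s ^ m * hermite m ((\<mu> + s * p) / s) \<partial>N) = \<mu> ^ m"
proof -
  have "(\<integral>p. s ^ m * hermite m ((\<mu> + s * p) / s) \<partial>N)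
    = (\<Sum>j\<le>m. real (m choose j) * s ^ j * \<mu> ^ (m - j) * (\<integral>p. hermite j p \<partial>N))"
    unfolding hermite_shift[OF assms] by (subst Bochner_Integration.integral_sum) (auto simp: integrable_hermite)
  also have "\<dots> = (\<Sum>j\<le>m. if j = 0 then \<mu> ^ m else 0)"
    by (intro sum.cong) (auto simp: integral_hermite)
  finally show ?thesis by simp
qed

text \<open>Orthogonality in p leaves the diagonal. The summation index is reversed to i = m - j,
  half the exponent of \<mu>, so that \<mu>^(2i)/i! becomes the general term of an exponential
  series once the sum over m is taken.\<close>

lemma hermite_second_moment:
  assumes "s \<noteq> 0"
  shows "(\<integral>p. (s ^ m * hermite m ((\<mu> + s * p) / s))\<^sup>2 \<partial>N)
    = fact m * (\<Sum>i\<le>m. real (m choose i) * (s\<^sup>2) ^ (m - i) * ((\<mu>\<^sup>2) ^ i / fact i))"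
proof -
  let ?a = "\<lambda>j. real (m choose j) * s ^ j * \<mu> ^ (m - j)"
  have "(\<integral>p. (s ^ m * hermite m ((\<mu> + s * p) / s))\<^sup>2 \<partial>N)
    = (\<integral>p. (\<Sum>j\<le>m. \<Sum>k\<le>m. ?a j * ?a k * (hermite j p * hermite k p)) \<partial>N)"
    unfolding hermite_shift[OF assms]
    by (simp add: power2_eq_square sum_product mult_ac)
  also have "\<dots> = (\<Sum>j\<le>m. \<Sum>k\<le>m. ?a j * ?a k * (\<integral>p. hermite j p * hermite k p \<partial>N))"
    by (simp add: Bochner_Integration.integral_sum integrable_hermite_mult)
  also have "\<dots> = (\<Sum>j\<le>m. (?a j)\<^sup>2 * fact j)"
  proof (intro sum.cong refl)
    fix j assume "j \<in> {..m}"
    have "(\<Sum>k\<le>m. ?a j * ?a k * (\<integral>p. hermite j p * hermite k p \<partial>N))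
      = (\<Sum>k\<le>m. if k = j then (?a j)\<^sup>2 * fact j else 0)"
      by (intro sum.cong) (auto simp: hermite_orthogonal power2_eq_square)
    then show "(\<Sum>k\<le>m. ?a j * ?a k * (\<integral>p. hermite j p * hermite k p \<partial>N)) = (?a j)\<^sup>2 * fact j"
      using \<open>j \<in> {..m}\<close> by simp
  qed
  also have "\<dots> = (\<Sum>i\<le>m. (?a (m - i))\<^sup>2 * fact (m - i))"
    by (rule sum.reindex_bij_witness[of _ "\<lambda>i. m - i" "\<lambda>i. m - i"]) auto
  also have "\<dots> = (\<Sum>i\<le>m. fact m * (real (m choose i) * (s\<^sup>2) ^ (m - i) * ((\<mu>\<^sup>2) ^ i / fact i)))"
  proof (intro sum.cong refl)
    fix i assume "i \<in> {..m}"
    then have i: "i \<le> m" by simp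
    have c: "real (m choose (m - i)) = real (m choose i)" using binomial_symmetric[OF i] by simp
    have f: "real (m choose i) * fact (m - i) = fact m / fact i"
      using binomial_fact[OF i, where ?'a=real] by simp
    have "(?a (m - i))\<^sup>2 * fact (m - i) = real (m choose i) * (real (m choose i) * fact (m - i)) * (s\<^sup>2) ^ (m - i) * (\<mu>\<^sup>2) ^ i"
      using i by (simp add: c power_mult_distrib power2_eq_square[of "real (m choose i)"] mult_ac flip: power_mult)
    then show "(?a (m - i))\<^sup>2 * fact (m - i) = fact m * (real (m choose i) * (s\<^sup>2) ^ (m - i) * ((\<mu>\<^sup>2) ^ i / fact i))"
      unfolding f by simp
  qed
  finally show ?thesis by (simp add: sum_distrib_left)
qed

text \<open>Partial sums of the negative binomial series of (1 - x)^(-(i+1)). The induction on i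
  works because multiplication by 1 - x lowers i by one, by Pascal's rule.\<close>

lemma negative_binomial_sum_le:
  fixes x :: real assumes x: "0 \<le> x" "x < 1"
  shows "(\<Sum>n\<le>M. real ((n + i) choose i) * x ^ n) \<le> (1 / (1 - x)) ^ Suc i"
proof (induction i)
  case 0
  have "(\<Sum>n\<le>M. x ^ n) \<le> (\<Sum>n. x ^ n)" using x by (intro sum_le_suminf) auto
  then show ?case using x by (simp add: suminf_geometric)
next
  case (Suc i)
  \<comment> \<open>Cutting the series at M leaves a boundary term; it is nonnegative and is dropped
    below.\<close>
  have eq: "(1 - x) * (\<Sum>n\<le>M. real ((n + Suc i) choose Suc i) * x ^ n) + real ((M + Suc i) choose Suc i) * x ^ Suc M
     = (\<Sum>n\<le>M. real ((n + i) choose i) * x ^ n)" for M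
  proof (induction M)
    case (Suc M)
    have "real ((Suc M + Suc i) choose Suc i) = real ((M + Suc i) choose Suc i) + real ((Suc M + i) choose i)"
      by simp
    then show ?case unfolding sum.atMost_Suc using Suc by (simp add: algebra_simps)
  qed (simp add: algebra_simps)
  have "(1 - x) * (\<Sum>n\<le>M. real ((n + Suc i) choose Suc i) * x ^ n) \<le> (\<Sum>n\<le>M. real ((n + i) choose i) * x ^ n)"
    using eq[of M] x by (smt (verit) mult_nonneg_nonneg of_nat_0_le_iff zero_le_power)
  also have "\<dots> \<le> (1 / (1 - x)) ^ Suc i" by (rule Suc)
  finally have "(1 / (1 - x)) * ((1 - x) * (\<Sum>n\<le>M. real ((n + Suc i) choose Suc i) * x ^ n)) \<le> (1 / (1 - x)) * (1 / (1 - x)) ^ Suc i"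
    using x by (intro mult_left_mono) auto
  then show ?case using x by simp
qed

text \<open>With m = n + i the double sum is reordered: the inner sum over n is a negative binomial
  series, at most (1 - s^2)^(-(i+1)) <= (5/4)^(i+1), and the outer one an exponential series in 5/4
  \<mu>^2. The weights 1/m! are those of \<open>hcoef_sq_le\<close>.\<close>

lemma weighted_hermite_second_moment_le:
  assumes s: "s \<noteq> 0" "s\<^sup>2 \<le> 1 / 5"
  shows "(\<Sum>m<M. (\<integral>p. (s ^ m * hermite m ((\<mu> + s * p) / s))\<^sup>2 \<partial>N) / fact m) \<le> 5 / 4 * exp (5 / 4 * \<mu>\<^sup>2)"
proof -
  let ?x = "s\<^sup>2"
  have x: "0 \<le> ?x" "?x < 1" using s by auto
  have "(\<Sum>m<M. (\<integral>p. (s ^ m * hermite m ((\<mu> + s * p) / s))\<^sup>2 \<partial>N) / fact m)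
     = (\<Sum>m<M. \<Sum>i\<le>m. real (m choose i) * ?x ^ (m - i) * ((\<mu>\<^sup>2) ^ i / fact i))"
    by (simp add: hermite_second_moment[OF s(1)])
  also have "\<dots> = (\<Sum>(m, i)\<in>Sigma {..<M} (\<lambda>m. {..m}). real (m choose i) * ?x ^ (m - i) * ((\<mu>\<^sup>2) ^ i / fact i))"
    by (rule sum.Sigma) auto
  also have "\<dots> = (\<Sum>(i, n)\<in>Sigma {..<M} (\<lambda>i. {..<M - i}). real ((n + i) choose i) * ?x ^ n * ((\<mu>\<^sup>2) ^ i / fact i))"
    by (rule sum.reindex_bij_witness[of _ "\<lambda>(i, n). (n + i, i)" "\<lambda>(m, i). (i, m - i)"]) auto
  also have "\<dots> = (\<Sum>i<M. \<Sum>n<M - i. real ((n + i) choose i) * ?x ^ n * ((\<mu>\<^sup>2) ^ i / fact i))"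
    by (rule sum.Sigma[symmetric]) auto
  also have "\<dots> \<le> (\<Sum>i<M. (5 / 4) ^ Suc i * ((\<mu>\<^sup>2) ^ i / fact i))"
  proof (rule sum_mono)
    fix i
    have "(\<Sum>n<M - i. real ((n + i) choose i) * ?x ^ n) \<le> (\<Sum>n\<le>M - i. real ((n + i) choose i) * ?x ^ n)"
      by (intro sum_mono2) auto
    also have "\<dots> \<le> (1 / (1 - ?x)) ^ Suc i" by (rule negative_binomial_sum_le[OF x])
    also have "\<dots> \<le> (5 / 4) ^ Suc i"
      using s x by (intro power_mono) (auto simp: field_simps)
    finally have "(\<Sum>n<M - i. real ((n + i) choose i) * ?x ^ n) * ((\<mu>\<^sup>2) ^ i / fact i) \<le> (5 / 4) ^ Suc i * ((\<mu>\<^sup>2) ^ i / fact i)"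
      by (intro mult_right_mono) auto
    then show "(\<Sum>n<M - i. real ((n + i) choose i) * ?x ^ n * ((\<mu>\<^sup>2) ^ i / fact i)) \<le> (5 / 4) ^ Suc i * ((\<mu>\<^sup>2) ^ i / fact i)"
      by (simp only: sum_distrib_right)
  qed
  also have "\<dots> = 5 / 4 * (\<Sum>i<M. (5 / 4 * \<mu>\<^sup>2) ^ i / fact i)"
    unfolding sum_distrib_left power_mult_distrib by (intro sum.cong) auto
  also have "(\<Sum>i<M. (5 / 4 * \<mu>\<^sup>2) ^ i / fact i) \<le> exp (5 / 4 * \<mu>\<^sup>2)"
  proof -
    have "(\<Sum>i<M. y ^ i / fact i) \<le> exp y" if "0 \<le> y" for y :: real
    proof -
      have "(\<Sum>i<M. y ^ i /\<^sub>R fact i) \<le> (\<Sum>i. y ^ i /\<^sub>R fact i)"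
        using that by (intro sum_le_suminf[OF summable_exp_generic]) auto
      then show ?thesis by (simp add: exp_def divide_inverse mult.commute)
    qed
    then show ?thesis by simp
  qed
  finally show ?thesis by simp
qed

section \<open>The truncated Hermite expansion\<close>

text \<open>The truncated expansion \<open>S\<close> as a combination of all scaled Hermite polynomials: the constant and
  linear terms fit the pattern \<open>c m * s ^ m * H\<^sub>m (u / s)\<close> as well.\<close>

definition hcoef :: "real \<Rightarrow> nat \<Rightarrow> real" where
  "hcoef \<beta> m = (if m = 0 then phi 0 else if m = 1 then Phi 0 - \<beta>
     else phi 0 * ((- 1) ^ (m - 2) * hermite (m - 2) 0 / fact m))"

text \<open>H_{k+2}(0) = - (k + 1) H_k(0), and (k + 1)^2 <= (k + 1)(k + 2).\<close>

lemma hermite_0_sq_le: "(hermite k 0)\<^sup>2 \<le> fact k"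
proof (induction k rule: less_induct)
  case (less k)
  consider "k = 0" | "k = 1" | j where "k = Suc (Suc j)" by (metis One_nat_def not0_implies_Suc)
  then show ?case
  proof cases
    case (3 j)
    have "(hermite k 0)\<^sup>2 = (real (Suc j))\<^sup>2 * (hermite j 0)\<^sup>2" by (simp add: 3 power_mult_distrib)
    also have "\<dots> \<le> (real (Suc j) * real (Suc (Suc j))) * fact j"
      using less.IH[of j] by (intro mult_mono) (auto simp: 3 power2_eq_square)
    also have "\<dots> = fact k" by (simp add: 3)
    finally show ?thesis .
  qed auto
qed

lemma hcoef_sq_le:
  assumes "0 \<le> \<beta>" "\<beta> \<le> 1" shows "(hcoef \<beta> m)\<^sup>2 \<le> 1 / fact m"
proof -
  consider "m = 0" | "m = 1" | k where "m = k + 2" by (metis add_2_eq_Suc' One_nat_def not0_implies_Suc)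
  then show ?thesis
  proof cases
    case 1
    then show ?thesis using phi_0_le_1 by (simp add: hcoef_def power_le_one)
  next
    case 2
    then show ?thesis using Phi_nonneg[of 0] Phi_le_1[of 0] assms by (simp add: hcoef_def abs_square_le_1)
  next
    case (3 k)
    have "(hcoef \<beta> m)\<^sup>2 = (phi 0)\<^sup>2 * ((hermite k 0)\<^sup>2 / (fact m)\<^sup>2)"
      by (simp add: hcoef_def 3 power_mult_distrib power_divide del: fact_Suc flip: power_mult)
    also have "\<dots> \<le> 1 * (fact m / (fact m)\<^sup>2)"
    proof (intro mult_mono divide_right_mono)
      show "(phi 0)\<^sup>2 \<le> 1" using phi_0_le_1 by (simp add: power_le_one)
      have "(fact k :: real) \<le> fact m" by (rule fact_mono) (simp add: 3)
      then show "(hermite k 0)\<^sup>2 \<le> fact m" using hermite_0_sq_le[of k] by linarith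
    qed auto
    finally show ?thesis by (simp add: power2_eq_square)
  qed
qed

definition hsum :: "real \<Rightarrow> nat \<Rightarrow> real \<Rightarrow> real \<Rightarrow> real" where
  "hsum \<beta> M s u = (\<Sum>m<M. hcoef \<beta> m * (s ^ m * hermite m (u / s)))"

text \<open>The sum in \<open>S_poly\<close> has \<open>trunc_order\<close> - 1 terms, of degrees 2
  and up; with the constant and the linear term this makes \<open>trunc_order\<close> + 1. For s = 0
  the linear terms would differ, as s H_1(u/s) is then 0 and not u.\<close>

lemma S_poly_eq_hsum:
  assumes "s_coef vp vf \<tau> \<noteq> 0"
  shows "S_poly n \<beta> vp vf g \<tau> u = hsum \<beta> (Suc (trunc_order n g vp vf)) (s_coef vp vf \<tau>) u"
proof -
  define K where "K = trunc_order n g vp vf - 1"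
  have K: "Suc (trunc_order n g vp vf) = Suc (Suc K)" by (simp add: K_def trunc_order_def)
  have d: "deriv (\<lambda>w. G w \<beta>) 0 = Phi 0 - \<beta>" by (rule DERIV_imp_deriv[OF DERIV_G])
  show ?thesis
    unfolding hsum_def K S_poly_def K_def[symmetric] d G_0
    using assms by (simp add: sum.lessThan_Suc_shift hcoef_def sum_distrib_left mult_ac del: sum.lessThan_Suc)
qed

lemma measurable_hermite[measurable]: "hermite k \<in> borel_measurable borel"
proof -
  obtain p where "\<And>x. hermite k x = poly p x" using ex_poly_hermite by metis
  then have "hermite k = (\<lambda>x. poly p x)" by auto
  then show ?thesis by (auto intro!: borel_measurable_continuous_onI continuous_intros)
qed

lemma measurable_hsum[measurable]: "hsum \<beta> M s \<in> borel_measurable borel"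
  unfolding hsum_def by measurable

lemma integrable_scaled_hermite:
  assumes "s \<noteq> 0"
  shows "integrable N (\<lambda>p. s ^ m * hermite m ((\<mu> + s * p) / s))"
    and "integrable N (\<lambda>p. (s ^ m * hermite m ((\<mu> + s * p) / s))\<^sup>2)"
proof -
  show "integrable N (\<lambda>p. s ^ m * hermite m ((\<mu> + s * p) / s))"
    unfolding hermite_shift[OF assms] by (auto simp: integrable_hermite)
  show "integrable N (\<lambda>p. (s ^ m * hermite m ((\<mu> + s * p) / s))\<^sup>2)"
    unfolding hermite_shift[OF assms] power2_eq_square sum_product
    by (intro Bochner_Integration.integrable_sum)
       (auto intro!: integrable_mult_right integrable_hermite_mult simp: mult.assoc mult.left_commute[of "hermite _ _"])
qed

lemma integral_hsum:
  assumes "s \<noteq> 0"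
  shows "integrable N (\<lambda>p. hsum \<beta> M s (\<mu> + s * p))"
    and "(\<integral>p. hsum \<beta> M s (\<mu> + s * p) \<partial>N) = (\<Sum>m<M. hcoef \<beta> m * \<mu> ^ m)"
proof -
  show "integrable N (\<lambda>p. hsum \<beta> M s (\<mu> + s * p))"
    unfolding hsum_def by (intro Bochner_Integration.integrable_sum integrable_mult_right[OF integrable_scaled_hermite(1)[OF assms]])
  show "(\<integral>p. hsum \<beta> M s (\<mu> + s * p) \<partial>N) = (\<Sum>m<M. hcoef \<beta> m * \<mu> ^ m)"
  proof -
    have "(\<integral>p. c * (s ^ m * hermite m ((\<mu> + s * p) / s)) \<partial>N) = c * \<mu> ^ m" for c m
      by (subst integral_mult_right_zero) (simp only: hermite_unbiased[OF assms])
    then show ?thesis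
      unfolding hsum_def
      by (subst Bochner_Integration.integral_sum)
         (simp_all only: integrable_mult_right[OF integrable_scaled_hermite(1)[OF assms]])
  qed
qed

text \<open>The scaled polynomials in U are not orthogonal unless \<mu> = 0, so the square of the
  sum is estimated by Cauchy-Schwarz. This costs the factor M, which will be only logarithmic in
  n.\<close>

lemma hsum_second_moment_le:
  assumes s: "s \<noteq> 0" "s\<^sup>2 \<le> 1 / 5" and \<beta>: "0 \<le> \<beta>" "\<beta> \<le> 1"
  shows "integrable N (\<lambda>p. (hsum \<beta> M s (\<mu> + s * p))\<^sup>2)"
    and "(\<integral>p. (hsum \<beta> M s (\<mu> + s * p))\<^sup>2 \<partial>N) \<le> real M * (5 / 4 * exp (5 / 4 * \<mu>\<^sup>2))"
proof -
  let ?h = "\<lambda>m p. s ^ m * hermite m ((\<mu> + s * p) / s)"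
  note I2 = integrable_scaled_hermite(2)[OF s(1)]
  have bound: "(hsum \<beta> M s (\<mu> + s * p))\<^sup>2 \<le> real M * (\<Sum>m<M. (?h m p)\<^sup>2 / fact m)" for p
  proof -
    have "(hsum \<beta> M s (\<mu> + s * p))\<^sup>2 \<le> real (card {..<M}) * (\<Sum>m<M. (hcoef \<beta> m * ?h m p)\<^sup>2)"
      using sum_squared_le_sum_of_squares unfolding hsum_def by (subst mult.commute)
    also have "\<dots> = real M * (\<Sum>m<M. (hcoef \<beta> m)\<^sup>2 * (?h m p)\<^sup>2)"
      by (simp add: power_mult_distrib)
    also have "\<dots> \<le> real M * (\<Sum>m<M. 1 / fact m * (?h m p)\<^sup>2)"
      by (intro mult_left_mono sum_mono mult_right_mono hcoef_sq_le \<beta>) auto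
    finally show ?thesis by simp
  qed
  have J: "integrable N (\<lambda>p. real M * (\<Sum>m<M. (?h m p)\<^sup>2 / fact m))"
    using I2 by (intro integrable_mult_right Bochner_Integration.integrable_sum integrable_divide) auto
  show I: "integrable N (\<lambda>p. (hsum \<beta> M s (\<mu> + s * p))\<^sup>2)"
    by (rule Bochner_Integration.integrable_bound[OF J]) (use bound in \<open>auto intro: order_trans[OF _ abs_ge_self]\<close>)
  have "(\<integral>p. (hsum \<beta> M s (\<mu> + s * p))\<^sup>2 \<partial>N) \<le> (\<integral>p. real M * (\<Sum>m<M. (?h m p)\<^sup>2 / fact m) \<partial>N)"
    by (rule integral_mono[OF I J bound])
  also have "\<dots> = real M * (\<Sum>m<M. (\<integral>p. (?h m p)\<^sup>2 \<partial>N) / fact m)"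
    using I2 by (subst integral_mult_right_zero, subst Bochner_Integration.integral_sum) auto
  also have "\<dots> \<le> real M * (5 / 4 * exp (5 / 4 * \<mu>\<^sup>2))"
    by (intro mult_left_mono weighted_hermite_second_moment_le s) auto
  finally show "(\<integral>p. (hsum \<beta> M s (\<mu> + s * p))\<^sup>2 \<partial>N) \<le> real M * (5 / 4 * exp (5 / 4 * \<mu>\<^sup>2))" .
qed

section \<open>The Taylor polynomial of G at 0\<close>

lemma exp_minus_remainder_le:
  fixes y :: real assumes "0 \<le> y"
  shows "\<bar>exp (- y) - (\<Sum>j<J. (- y) ^ j / fact j)\<bar> \<le> y ^ J / fact J"
proof (cases "J = 0 \<or> y = 0")
  case True
  then show ?thesis
  proof (cases "J = 0")
    case False
    then have "y = 0" using True by simp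
    then have "(\<Sum>j<J. (- y) ^ j / fact j) = 1" using False by (cases J) (auto simp: sum.lessThan_Suc_shift simp del: sum.lessThan_Suc)
    then show ?thesis using \<open>y = 0\<close> by simp
  qed (use assms in auto)
next
  case False
  obtain t where t: "- y < t" "t < 0"
    and eq: "exp (- y) = (\<Sum>m<J. exp 0 / fact m * (- y) ^ m) + exp t / fact J * (- y) ^ J"
    using Maclaurin_minus[of "- y" J "\<lambda>_. exp" exp] False assms by (auto intro: DERIV_exp)
  have "\<bar>exp (- y) - (\<Sum>j<J. (- y) ^ j / fact j)\<bar> = exp t * (y ^ J / fact J)"
    using assms by (simp add: eq abs_mult power_abs)
  also have "\<dots> \<le> 1 * (y ^ J / fact J)"
    using t assms by (intro mult_right_mono) auto
  finally show ?thesis by simp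
qed

text \<open>H_k(0) vanishes for odd k, and H_{2j}(0)/(2j)! = (-1/2)^j/j!, so this is the series of
  exp(- w^2/2). Exactly (M + 1) div 2 of the indices k < M are even.\<close>

lemma hermite_0_series:
  "(\<Sum>k<M. (- 1) ^ k * hermite k 0 / fact k * w ^ k) = (\<Sum>j<(M + 1) div 2. (- (w\<^sup>2 / 2)) ^ j / fact j)"
proof -
  have odd: "hermite (2 * j + 1) 0 = 0" for j by (induction j) auto
  have even: "hermite (2 * j) 0 / fact (2 * j) = (- 1 / 2) ^ j / fact j" for j
  proof (induction j)
    case (Suc j)
    have "hermite (2 * Suc j) 0 / fact (2 * Suc j) = - real (2 * j + 1) * hermite (2 * j) 0 / (real (2 * j + 2) * (real (2 * j + 1) * fact (2 * j)))"
    proof -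
      have "hermite (2 * Suc j) 0 = - real (2 * j + 1) * hermite (2 * j) 0" by (simp add: algebra_simps)
      moreover have "(fact (2 * Suc j) :: real) = real (2 * j + 2) * (real (2 * j + 1) * fact (2 * j))"
        by (simp add: add.commute)
      ultimately show ?thesis by (simp only:)
    qed
    also have "\<dots> = - 1 / real (2 * j + 2) * (hermite (2 * j) 0 / fact (2 * j))"
    proof -
      have "- real (2 * j + 1) * hermite (2 * j) 0 / (real (2 * j + 2) * (real (2 * j + 1) * fact (2 * j)))
        = real (2 * j + 1) * (- hermite (2 * j) 0) / (real (2 * j + 1) * (real (2 * j + 2) * fact (2 * j)))"
        by (simp only: mult_minus_left mult_minus_right mult.left_commute)
      then show ?thesis by simp
    qed
    also have "\<dots> = (- 1 / 2) ^ Suc j / fact (Suc j)"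
      unfolding Suc by (simp add: field_simps)
    finally show ?case .
  qed simp
  have eterm: "(- 1) ^ (2 * j) * hermite (2 * j) 0 / fact (2 * j) * w ^ (2 * j) = (- (w\<^sup>2 / 2)) ^ j / fact j" for j
  proof -
    have "(- 1) ^ (2 * j) * hermite (2 * j) 0 / fact (2 * j) * w ^ (2 * j) = (hermite (2 * j) 0 / fact (2 * j)) * (w\<^sup>2) ^ j"
      by (simp add: power_mult)
    also have "\<dots> = (- 1 / 2 * w\<^sup>2) ^ j / fact j" by (simp only: even power_mult_distrib) simp
    finally show ?thesis by simp
  qed
  have pair: "(\<Sum>k<2 * J. (- 1) ^ k * hermite k 0 / fact k * w ^ k) = (\<Sum>j<J. (- (w\<^sup>2 / 2)) ^ j / fact j)" for J
  proof (induction J)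
    case (Suc J)
    have e: "2 * Suc J = Suc (Suc (2 * J))" by simp
    have o: "hermite (Suc (2 * J)) 0 = 0" using odd[of J] by simp
    show ?case unfolding e sum.lessThan_Suc[of _ "Suc (2 * J)"] sum.lessThan_Suc[of _ "2 * J"] sum.lessThan_Suc[of _ J] Suc eterm o by simp
  qed simp
  show ?thesis
  proof (cases "even M")
    case True
    then obtain J where "M = 2 * J" by blast
    then show ?thesis using pair[of J] by simp
  next
    case False
    then obtain J where M: "M = Suc (2 * J)" by (auto elim: oddE)
    show ?thesis unfolding M sum.lessThan_Suc pair eterm by simp
  qed
qed

text \<open>G'' = \<open>phi\<close>, so the second derivative of the remainder is
  \<open>phi\<close> minus its own Taylor polynomial, which is a remainder of the exponential series
  in - t^2/2. The remainder of G and its first derivative vanish at 0, and Taylor's formula of order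
  two transfers the bound.\<close>

lemma G_taylor_remainder:
  shows "\<bar>G w \<beta> - (\<Sum>m<M + 2. hcoef \<beta> m * w ^ m)\<bar> \<le> w\<^sup>2 / 2 * ((w\<^sup>2 / 2) ^ ((M + 1) div 2) / fact ((M + 1) div 2))"
proof -
  let ?J = "(M + 1) div 2"
  let ?c = "\<lambda>k. (- 1) ^ k * hermite k 0 / fact k :: real"
  \<comment> \<open>The factors (k + 1)(k + 2) are split off (k + 2)! so that two differentiations
    remove them.\<close>
  define R where "R w = G w \<beta> - (phi 0 + (Phi 0 - \<beta>) * w + (\<Sum>k<M. phi 0 * (?c k / ((real k + 1) * (real k + 2))) * w ^ (k + 2)))" for w
  define R1 where "R1 w = Phi w - \<beta> - (Phi 0 - \<beta> + (\<Sum>k<M. phi 0 * (?c k / (real k + 1)) * w ^ (k + 1)))" for w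
  define R2 where "R2 w = phi w - (\<Sum>k<M. phi 0 * ?c k * w ^ k)" for w
  have eqR: "G w \<beta> - (\<Sum>m<M + 2. hcoef \<beta> m * w ^ m) = R w"
    by (simp add: R_def hcoef_def sum.lessThan_Suc_shift mult_ac add_ac del: sum.lessThan_Suc)
  have d1: "(R has_real_derivative R1 w) (at w)" for w
  proof -
    have "(R has_real_derivative Phi w - \<beta> - (0 + (Phi 0 - \<beta>) * 1 + (\<Sum>k<M. phi 0 * (?c k / ((real k + 1) * (real k + 2))) * (real (k + 2) * w ^ (k + 2 - Suc 0))))) (at w)"
      unfolding R_def by (intro DERIV_diff DERIV_G DERIV_add DERIV_const DERIV_cmult DERIV_ident DERIV_sum DERIV_pow)
    also have "(\<Sum>k<M. phi 0 * (?c k / ((real k + 1) * (real k + 2))) * (real (k + 2) * w ^ (k + 2 - Suc 0))) = (\<Sum>k<M. phi 0 * (?c k / (real k + 1)) * w ^ (k + 1))"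
    proof (intro sum.cong refl)
      fix k
      have "c / ((real k + 1) * (real k + 2)) * real (k + 2) = c / (real k + 1)" for c
        by (simp add: divide_simps)
      then have "?c k / ((real k + 1) * (real k + 2)) * real (k + 2) = ?c k / (real k + 1)" .
      then show "phi 0 * (?c k / ((real k + 1) * (real k + 2))) * (real (k + 2) * w ^ (k + 2 - Suc 0)) = phi 0 * (?c k / (real k + 1)) * w ^ (k + 1)"
      proof -
        assume a: "?c k / ((real k + 1) * (real k + 2)) * real (k + 2) = ?c k / (real k + 1)"
        have "phi 0 * (?c k / ((real k + 1) * (real k + 2))) * (real (k + 2) * w ^ (k + 2 - Suc 0))
          = phi 0 * (?c k / ((real k + 1) * (real k + 2)) * real (k + 2)) * w ^ (k + 1)" by simp
        then show ?thesis by (simp only: a)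
      qed
    qed
    finally show ?thesis by (simp add: R1_def)
  qed
  have d2: "(R1 has_real_derivative R2 w) (at w)" for w
  proof -
    have "(R1 has_real_derivative phi w - 0 - (0 + (\<Sum>k<M. phi 0 * (?c k / (real k + 1)) * (real (k + 1) * w ^ (k + 1 - Suc 0))))) (at w)"
      unfolding R1_def by (intro DERIV_diff DERIV_Phi DERIV_add DERIV_const DERIV_cmult DERIV_sum DERIV_pow)
    also have "(\<Sum>k<M. phi 0 * (?c k / (real k + 1)) * (real (k + 1) * w ^ (k + 1 - Suc 0))) = (\<Sum>k<M. phi 0 * ?c k * w ^ k)"
    proof (intro sum.cong refl)
      fix k
      have "c / (real k + 1) * real (k + 1) = c" for c by (simp add: add.commute)
      then have a: "?c k / (real k + 1) * real (k + 1) = ?c k" .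
      have "phi 0 * (?c k / (real k + 1)) * (real (k + 1) * w ^ (k + 1 - Suc 0))
        = phi 0 * (?c k / (real k + 1) * real (k + 1)) * w ^ k" by simp
      then show "phi 0 * (?c k / (real k + 1)) * (real (k + 1) * w ^ (k + 1 - Suc 0)) = phi 0 * ?c k * w ^ k"
        by (simp only: a)
    qed
    finally show ?thesis by (simp add: R2_def)
  qed
  have R2_le: "\<bar>R2 t\<bar> \<le> (w\<^sup>2 / 2) ^ ?J / fact ?J" if "\<bar>t\<bar> \<le> \<bar>w\<bar>" for t
  proof -
    have "R2 t = phi 0 * (exp (- (t\<^sup>2 / 2)) - (\<Sum>k<M. ?c k * t ^ k))"
      by (simp add: R2_def right_diff_distrib sum_distrib_left mult_ac) (simp add: std_normal_density_def)
    also have "\<dots> = phi 0 * (exp (- (t\<^sup>2 / 2)) - (\<Sum>j<?J. (- (t\<^sup>2 / 2)) ^ j / fact j))"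
      by (simp only: hermite_0_series)
    finally have "\<bar>R2 t\<bar> = phi 0 * \<bar>exp (- (t\<^sup>2 / 2)) - (\<Sum>j<?J. (- (t\<^sup>2 / 2)) ^ j / fact j)\<bar>"
      by (simp add: abs_mult)
    also have "\<dots> \<le> 1 * ((t\<^sup>2 / 2) ^ ?J / fact ?J)"
      by (intro mult_mono exp_minus_remainder_le phi_0_le_1) auto
    also have "\<dots> \<le> (w\<^sup>2 / 2) ^ ?J / fact ?J"
      using that by (auto intro!: divide_right_mono power_mono simp: abs_le_square_iff)
    finally show ?thesis .
  qed
  define diff where "diff m = (if m = (0::nat) then R else if m = 1 then R1 else R2)" for m
  have "\<exists>t. \<bar>t\<bar> \<le> \<bar>w\<bar> \<and> R w = (\<Sum>m<2. diff m 0 / fact m * w ^ m) + diff 2 t / fact 2 * w ^ 2"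
    by (rule Maclaurin_bi_le) (use d1 d2 in \<open>auto simp: diff_def less_2_cases_iff\<close>)
  then obtain t where t: "\<bar>t\<bar> \<le> \<bar>w\<bar>" and Rw: "R w = (\<Sum>m<2. diff m 0 / fact m * w ^ m) + diff 2 t / fact 2 * w ^ 2"
    by blast
  have "R 0 = 0" "R1 0 = 0" by (auto simp: R_def R1_def G_0)
  then have "R w = w\<^sup>2 / 2 * R2 t" using Rw by (simp add: diff_def numeral_2_eq_2)
  then have "\<bar>R w\<bar> = w\<^sup>2 / 2 * \<bar>R2 t\<bar>" by (simp only: abs_mult) simp
  also have "\<dots> \<le> w\<^sup>2 / 2 * ((w\<^sup>2 / 2) ^ ?J / fact ?J)" by (intro mult_left_mono R2_le t) auto
  finally show ?thesis unfolding eqR .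
qed

section \<open>The randomized estimate for one coordinate\<close>

text \<open>\<open>T_rand\<close> with U and V as separate arguments and the middle branch left
  open. The branch depends on v alone, the value within a branch on u alone; after the rotation the
  two are independent.\<close>

definition T_split :: "real \<Rightarrow> real \<Rightarrow> (real \<Rightarrow> real) \<Rightarrow> real \<Rightarrow> real \<Rightarrow> real" where
  "T_split \<beta> l S u v = (if v < - l then - \<beta> * u else if v > l then (1 - \<beta>) * u else S u)"

definition clip :: "real \<Rightarrow> real \<Rightarrow> real" where
  "clip n y = sgn y * min \<bar>y\<bar> n"

text \<open>Beyond the level n the clipping error is at most |y|, which is then at most y^2/n. The
  last bound turns the bias caused by clipping into a second moment divided by n.\<close>

lemma clip_bounds:
  assumes "0 < n" shows "\<bar>clip n y\<bar> \<le> \<bar>y\<bar>" "\<bar>clip n y\<bar> \<le> n" "\<bar>clip n y - y\<bar> \<le> y\<^sup>2 / n"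
proof -
  have "\<bar>clip n y\<bar> = \<bar>sgn y\<bar> * min \<bar>y\<bar> n" using assms by (simp add: clip_def abs_mult)
  also have "\<dots> \<le> 1 * min \<bar>y\<bar> n" using assms by (intro mult_right_mono) (auto simp: sgn_if)
  finally show "\<bar>clip n y\<bar> \<le> \<bar>y\<bar>" "\<bar>clip n y\<bar> \<le> n" by auto
  show "\<bar>clip n y - y\<bar> \<le> y\<^sup>2 / n"
  proof (cases "\<bar>y\<bar> \<le> n")
    case True
    then have "clip n y = y" by (simp add: clip_def sgn_mult_abs)
    then show ?thesis using assms by simp
  next
    case False
    then have "\<bar>clip n y - y\<bar> \<le> \<bar>y\<bar>" using assms by (auto simp: clip_def sgn_if abs_if)
    also have "\<bar>y\<bar> * n \<le> \<bar>y\<bar> * \<bar>y\<bar>" using False by (intro mult_left_mono) auto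
    then have "\<bar>y\<bar> \<le> y\<^sup>2 / n" using assms by (simp add: power2_eq_square field_simps)
    finally show ?thesis .
  qed
qed

lemma measurable_clip[measurable]: "clip n \<in> borel_measurable borel"
  unfolding clip_def by measurable

lemma tail_above:
  assumes "0 < s" "\<mu> \<le> a"
  shows "measure N {p. a \<le> \<mu> + s * p} \<le> exp (- (a - \<mu>)\<^sup>2 / (2 * s\<^sup>2))"
proof -
  have "{p. a \<le> \<mu> + s * p} = {(a - \<mu>) / s..}" using assms by (auto simp: field_simps)
  then show ?thesis using N_upper_tail[of "(a - \<mu>) / s"] assms by (simp add: power_divide mult.commute)
qed

lemma tail_below:
  assumes "0 < s" "a \<le> \<mu>"
  shows "measure N {p. \<mu> + s * p \<le> a} \<le> exp (- (\<mu> - a)\<^sup>2 / (2 * s\<^sup>2))"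
proof -
  have "{p. \<mu> + s * p \<le> a} = {..- ((\<mu> - a) / s)}" using assms by (auto simp: field_simps)
  then show ?thesis using N_lower_tail[of "(\<mu> - a) / s"] assms by (simp add: power_divide mult.commute)
qed

text \<open>Here U = \<mu> + s p and V = \<mu> + s q for independent standard normal p and q, and l
  stands for the threshold \<open>lam\<close>. The three probabilities defined next belong to the
  three branches and are events of q only.\<close>

locale coord_gauss =
  fixes s l \<mu> \<beta> :: real
  assumes s: "0 < s" "s\<^sup>2 \<le> 1 / 5" and l: "0 \<le> l" and \<beta>: "0 \<le> \<beta>" "\<beta> \<le> 1"
begin

definition "P_low = measure N {p. \<mu> + s * p < - l}"
definition "P_high = measure N {p. l < \<mu> + s * p}"
definition "P_mid = measure N {p. \<bar>\<mu> + s * p\<bar> \<le> l}"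

lemma P_bounds: "0 \<le> P_low" "P_low \<le> 1" "0 \<le> P_high" "P_high \<le> 1" "0 \<le> P_mid" "P_mid \<le> 1"
  by (auto simp: P_low_def P_high_def P_mid_def)

lemma rate: "5 / 2 * x\<^sup>2 \<le> x\<^sup>2 / (2 * s\<^sup>2)"
proof -
  have "s\<^sup>2 * (5 * x\<^sup>2) \<le> 1 / 5 * (5 * x\<^sup>2)" using s by (intro mult_right_mono) auto
  then show ?thesis using s by (simp add: field_simps)
qed

text \<open>The rate stays in terms of s. For |\<mu>| beyond l + 2 r sqrt(ln n) the bias estimate
  needs (|\<mu>| - l)^2/(2 s^2) >= ln n, which the rate 5/2 would lose when r is small.\<close>

lemma P_mid_tail: "l \<le> \<bar>\<mu>\<bar> \<Longrightarrow> P_mid \<le> exp (- (\<bar>\<mu>\<bar> - l)\<^sup>2 / (2 * s\<^sup>2))"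
proof -
  assume l': "l \<le> \<bar>\<mu>\<bar>"
  show ?thesis
  proof (cases "0 \<le> \<mu>")
    case True
    have "P_mid \<le> measure N {p. \<mu> + s * p \<le> l}" unfolding P_mid_def
      by (intro N.finite_measure_mono) auto
    also have "\<dots> \<le> exp (- (\<bar>\<mu>\<bar> - l)\<^sup>2 / (2 * s\<^sup>2))" using tail_below[of s l \<mu>] s l' True by simp
    finally show ?thesis .
  next
    case False
    have "P_mid \<le> measure N {p. - l \<le> \<mu> + s * p}" unfolding P_mid_def
      by (intro N.finite_measure_mono) auto
    also have "\<dots> \<le> exp (- (\<bar>\<mu>\<bar> - l)\<^sup>2 / (2 * s\<^sup>2))"
    proof -
      have eq: "(- l - \<mu>)\<^sup>2 = (\<bar>\<mu>\<bar> - l)\<^sup>2" using False by (simp add: power2_eq_square algebra_simps)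
      have "\<mu> \<le> - l" using l' False by simp
      from tail_above[OF s(1) this] show ?thesis by (simp only: eq)
    qed
    finally show ?thesis .
  qed
qed

lemma P_high_tail: "\<mu> \<le> l \<Longrightarrow> P_high \<le> exp (- 5 / 2 * (l - \<mu>)\<^sup>2)"
proof -
  assume "\<mu> \<le> l"
  have "P_high \<le> measure N {p. l \<le> \<mu> + s * p}" unfolding P_high_def
    by (intro N.finite_measure_mono) auto
  also have "\<dots> \<le> exp (- (l - \<mu>)\<^sup>2 / (2 * s\<^sup>2))" using tail_above s \<open>\<mu> \<le> l\<close> by blast
  also have "\<dots> \<le> exp (- 5 / 2 * (l - \<mu>)\<^sup>2)" using rate[of "l - \<mu>"] by simp
  finally show ?thesis .
qed

lemma P_low_tail: "- \<mu> \<le> l \<Longrightarrow> P_low \<le> exp (- 5 / 2 * (l - - \<mu>)\<^sup>2)"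
proof -
  assume "- \<mu> \<le> l"
  have "P_low \<le> measure N {p. \<mu> + s * p \<le> - l}" unfolding P_low_def
    by (intro N.finite_measure_mono) auto
  also have "\<dots> \<le> exp (- (\<mu> - - l)\<^sup>2 / (2 * s\<^sup>2))" using tail_below[of s "- l" \<mu>] s \<open>- \<mu> \<le> l\<close> by simp
  also have "\<dots> \<le> exp (- 5 / 2 * (l - - \<mu>)\<^sup>2)" using rate[of "\<mu> + l"] by (simp add: add.commute)
  finally show ?thesis .
qed

text \<open>The second moment of the Hermite expansion may exceed \<open>n\<close>, but only for means \<open>\<mu>\<close> for which
  the expansion is rarely used.\<close>

lemma P_mid_exp_le: "P_mid * exp (5 / 4 * \<mu>\<^sup>2) \<le> exp (5 / 2 * l\<^sup>2)"
proof (cases "l \<le> \<bar>\<mu>\<bar>")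
  case True
  define t where "t = \<bar>\<mu>\<bar> - l"
  have \<mu>: "\<mu>\<^sup>2 = (l + t)\<^sup>2" by (simp add: t_def)
  have "P_mid \<le> exp (- (5 / 2 * t\<^sup>2))"
    by (rule order_trans[OF P_mid_tail[OF True]]) (use rate[of t] in \<open>simp add: t_def\<close>)
  then have "P_mid * exp (5 / 4 * \<mu>\<^sup>2) \<le> exp (- (5 / 2 * t\<^sup>2)) * exp (5 / 4 * \<mu>\<^sup>2)"
    by (intro mult_right_mono) auto
  also have "\<dots> \<le> exp (5 / 2 * l\<^sup>2)"
  proof -
    \<comment> \<open>Equivalent to (l + t)^2 <= 2 l^2 + 2 t^2. As 5/4 is half of 5/2, the terms in
      t^2 cancel against the tail.\<close>
    have "0 \<le> (l - t)\<^sup>2" by simp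
    then show ?thesis unfolding \<mu> mult_exp_exp by (simp add: power2_eq_square algebra_simps)
  qed
  finally show ?thesis .
next
  case False
  then have "\<mu>\<^sup>2 \<le> l\<^sup>2" using abs_le_square_iff[of \<mu> l] by simp
  have "P_mid * exp (5 / 4 * \<mu>\<^sup>2) \<le> 1 * exp (5 / 2 * l\<^sup>2)"
  proof (intro mult_mono P_bounds)
    show "exp (5 / 4 * \<mu>\<^sup>2) \<le> exp (5 / 2 * l\<^sup>2)"
      unfolding exp_le_cancel_iff using \<open>\<mu>\<^sup>2 \<le> l\<^sup>2\<close> zero_le_power2[of l] by linarith
  qed auto
  then show ?thesis by simp
qed

lemma integral_cases:
  "(\<integral>q. (if \<mu> + s * q < - l then a else if \<mu> + s * q > l then c else b) \<partial>N) = P_low * a + P_high * c + P_mid * b"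
proof -
  have "(\<integral>q. (if \<mu> + s * q < - l then a else if \<mu> + s * q > l then c else b) \<partial>N)
    = (\<integral>q. a * indicator {p. \<mu> + s * p < - l} q + c * indicator {p. l < \<mu> + s * p} q + b * indicator {p. \<bar>\<mu> + s * p\<bar> \<le> l} q \<partial>N)"
    using l by (intro Bochner_Integration.integral_cong) (auto simp: indicator_def abs_le_iff)
  also have "\<dots> = a * P_low + c * P_high + b * P_mid"
    unfolding P_low_def P_high_def P_mid_def
    by (simp add: N.emeasure_eq_measure integrable_real_indicator)
  finally show ?thesis by (simp add: mult.commute)
qed

lemma P_sum: "P_low + P_high + P_mid = 1"
  using integral_cases[of 1 1 1] by (simp only: if_cancel) simp

lemma U_moments:
  "integrable N (\<lambda>p. \<mu> + s * p)" "(\<integral>p. \<mu> + s * p \<partial>N) = \<mu>"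
  "integrable N (\<lambda>p. (a * (\<mu> + s * p) - m)\<^sup>2)" "(\<integral>p. (a * (\<mu> + s * p) - m)\<^sup>2 \<partial>N) = a\<^sup>2 * s\<^sup>2 + (a * \<mu> - m)\<^sup>2"
proof -
  show "integrable N (\<lambda>p. \<mu> + s * p)" "(\<integral>p. \<mu> + s * p \<partial>N) = \<mu>" by auto
  have *: "(a * (\<mu> + s * p) - m)\<^sup>2 = (a * \<mu> - m)\<^sup>2 + 2 * (a * \<mu> - m) * a * s * p + a\<^sup>2 * s\<^sup>2 * p\<^sup>2" for p
    by (simp add: power2_eq_square algebra_simps)
  show "integrable N (\<lambda>p. (a * (\<mu> + s * p) - m)\<^sup>2)" unfolding * by auto
  show "(\<integral>p. (a * (\<mu> + s * p) - m)\<^sup>2 \<partial>N) = a\<^sup>2 * s\<^sup>2 + (a * \<mu> - m)\<^sup>2" unfolding * by simp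
qed

end

section \<open>Mean and second moment of the estimate with a clipped polynomial branch\<close>

locale coord_poly = coord_gauss +
  fixes M :: nat and n :: real
  assumes n: "1 \<le> n" and M: "1 \<le> M" and ln: "5 * l\<^sup>2 \<le> ln n"
begin

definition "S u = clip n (hsum \<beta> M s u)"

lemma measurable_S[measurable]: "S \<in> borel_measurable borel"
  unfolding S_def by measurable

lemma S_integrable: "integrable N (\<lambda>p. S (\<mu> + s * p))"
  by (rule N.integrable_const_bound[where B=n]) (use clip_bounds(2)[of n] n in \<open>auto simp: S_def\<close>)

lemma n_pos: "0 < n" using n by simp

lemma exp_l_le: "exp (5 / 2 * l\<^sup>2) \<le> sqrt n"
proof -
  have "exp (5 / 2 * l\<^sup>2) \<le> exp (ln n / 2)" using ln by simp
  also have "\<dots> = sqrt n" using n by (simp add: ln_sqrt[symmetric])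
  finally show ?thesis .
qed

text \<open>The branch is decided by q and the polynomial is evaluated at p, so probability and
  second moment multiply. Only their product is bounded uniformly in \<mu>.\<close>

lemma hsum_sq: "P_mid * (\<integral>p. (hsum \<beta> M s (\<mu> + s * p))\<^sup>2 \<partial>N) \<le> 5 / 4 * M * sqrt n"
proof -
  have "P_mid * (\<integral>p. (hsum \<beta> M s (\<mu> + s * p))\<^sup>2 \<partial>N) \<le> P_mid * (M * (5 / 4 * exp (5 / 4 * \<mu>\<^sup>2)))"
    using s \<beta> P_bounds by (intro mult_left_mono hsum_second_moment_le) auto
  also have "\<dots> = 5 / 4 * M * (P_mid * exp (5 / 4 * \<mu>\<^sup>2))" by simp
  also have "\<dots> \<le> 5 / 4 * M * sqrt n"
    using P_mid_exp_le exp_l_le by (intro mult_left_mono) auto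
  finally show ?thesis .
qed

lemma S_sq_integrable: "integrable N (\<lambda>p. (a * S (\<mu> + s * p) - m)\<^sup>2)"
proof (rule N.integrable_const_bound[where B="(\<bar>a\<bar> * n + \<bar>m\<bar>)\<^sup>2"])
  have "\<bar>a * S u - m\<bar> \<le> \<bar>a\<bar> * n + \<bar>m\<bar>" for u
  proof -
    have "\<bar>a * S u - m\<bar> \<le> \<bar>a\<bar> * \<bar>S u\<bar> + \<bar>m\<bar>" by (simp add: abs_mult[symmetric])
    also have "\<dots> \<le> \<bar>a\<bar> * n + \<bar>m\<bar>" using clip_bounds(2)[OF n_pos] by (auto simp: S_def intro!: mult_left_mono)
    finally show ?thesis .
  qed
  from power_mono[OF this abs_ge_zero, where n=2]
  show "AE x in N. norm ((a * S (\<mu> + s * x) - m)\<^sup>2) \<le> (\<bar>a\<bar> * n + \<bar>m\<bar>)\<^sup>2"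
    by (intro AE_I2) simp
qed measurable

abbreviation "T p q \<equiv> T_split \<beta> l S (\<mu> + s * p) (\<mu> + s * q)"

lemma T_cases: "f (T p q) = (if \<mu> + s * q < - l then f (- \<beta> * (\<mu> + s * p)) else if \<mu> + s * q > l then f ((1 - \<beta>) * (\<mu> + s * p)) else f (S (\<mu> + s * p)))"
  by (simp add: T_split_def)

lemma measurable_T: "(\<lambda>w. T (fst w) (snd w)) \<in> borel_measurable (N \<Otimes>\<^sub>M N)"
  unfolding T_split_def by measurable

lemma T_integrable: "integrable (N \<Otimes>\<^sub>M N) (\<lambda>w. T (fst w) (snd w))"
proof (rule Bochner_Integration.integrable_bound[where f="\<lambda>w. \<bar>\<mu> + s * fst w\<bar> + n"])
  show "integrable (N \<Otimes>\<^sub>M N) (\<lambda>w. \<bar>\<mu> + s * fst w\<bar> + n)"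
    using integrable_NN_fst[of "\<lambda>p. \<bar>\<mu> + s * p\<bar> + n"] U_moments(1) by simp
  show "AE w in N \<Otimes>\<^sub>M N. norm (T (fst w) (snd w)) \<le> norm (\<bar>\<mu> + s * fst w\<bar> + n)"
  proof (rule AE_I2)
    fix w :: "real \<times> real"
    let ?u = "\<mu> + s * fst w"
    have "\<bar>\<beta> * ?u\<bar> \<le> \<bar>?u\<bar>" "\<bar>(1 - \<beta>) * ?u\<bar> \<le> \<bar>?u\<bar>" using \<beta> by (auto simp: abs_mult intro: mult_left_le_one_le)
    then show "norm (T (fst w) (snd w)) \<le> norm (\<bar>?u\<bar> + n)"
      using clip_bounds(2)[OF n_pos, of "hsum \<beta> M s ?u"] n by (auto simp: T_split_def S_def)
  qed
qed (rule measurable_T)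

lemma integral_T: "(\<integral>p. \<integral>q. T p q \<partial>N \<partial>N) = P_low * (- \<beta> * \<mu>) + P_high * ((1 - \<beta>) * \<mu>) + P_mid * (\<integral>p. S (\<mu> + s * p) \<partial>N)"
proof -
  have "(\<integral>p. \<integral>q. T p q \<partial>N \<partial>N) = (\<integral>p. (- \<beta> * P_low + (1 - \<beta>) * P_high) * (\<mu> + s * p) + P_mid * S (\<mu> + s * p) \<partial>N)"
    unfolding T_split_def integral_cases by (simp add: algebra_simps)
  also have "\<dots> = (- \<beta> * P_low + (1 - \<beta>) * P_high) * \<mu> + P_mid * (\<integral>p. S (\<mu> + s * p) \<partial>N)"
    using U_moments(1,2) S_integrable by (subst Bochner_Integration.integral_add) auto
  finally show ?thesis by (simp add: algebra_simps)
qed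

lemma T_sq_integrable: "integrable (N \<Otimes>\<^sub>M N) (\<lambda>w. (T (fst w) (snd w) - m)\<^sup>2)"
proof (rule Bochner_Integration.integrable_bound)
  let ?f = "\<lambda>p. (- \<beta> * (\<mu> + s * p) - m)\<^sup>2 + ((1 - \<beta>) * (\<mu> + s * p) - m)\<^sup>2 + (1 * S (\<mu> + s * p) - m)\<^sup>2"
  show "integrable (N \<Otimes>\<^sub>M N) (\<lambda>w. ?f (fst w))"
    by (rule integrable_NN_fst) (intro Bochner_Integration.integrable_add U_moments(3) S_sq_integrable)
  show "(\<lambda>w. (T (fst w) (snd w) - m)\<^sup>2) \<in> borel_measurable (N \<Otimes>\<^sub>M N)"
    using measurable_T by measurable
  show "AE w in N \<Otimes>\<^sub>M N. norm ((T (fst w) (snd w) - m)\<^sup>2) \<le> norm (?f (fst w))"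
    by (rule AE_I2) (auto simp: T_split_def)
qed

lemma integral_T_sq:
  "(\<integral>p. \<integral>q. (T p q - m)\<^sup>2 \<partial>N \<partial>N) = P_low * (\<beta>\<^sup>2 * s\<^sup>2 + (- \<beta> * \<mu> - m)\<^sup>2) + P_high * ((1 - \<beta>)\<^sup>2 * s\<^sup>2 + ((1 - \<beta>) * \<mu> - m)\<^sup>2)
     + P_mid * (\<integral>p. (S (\<mu> + s * p) - m)\<^sup>2 \<partial>N)"
proof -
  have "(\<integral>p. \<integral>q. (T p q - m)\<^sup>2 \<partial>N \<partial>N) = (\<integral>p. P_low * (- \<beta> * (\<mu> + s * p) - m)\<^sup>2 + P_high * ((1 - \<beta>) * (\<mu> + s * p) - m)\<^sup>2 + P_mid * (1 * S (\<mu> + s * p) - m)\<^sup>2 \<partial>N)"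
    by (simp only: T_cases[of "\<lambda>t. (t - m)\<^sup>2"] integral_cases mult_1)
  also have "\<dots> = P_low * (\<integral>p. (- \<beta> * (\<mu> + s * p) - m)\<^sup>2 \<partial>N) + P_high * (\<integral>p. ((1 - \<beta>) * (\<mu> + s * p) - m)\<^sup>2 \<partial>N) + P_mid * (\<integral>p. (1 * S (\<mu> + s * p) - m)\<^sup>2 \<partial>N)"
    using U_moments(3)[of "- \<beta>" m] U_moments(3)[of "1 - \<beta>" m] S_sq_integrable[of 1 m]
    by (simp only: Bochner_Integration.integral_add Bochner_Integration.integrable_add integrable_mult_right integral_mult_right_zero)
  finally show ?thesis by (simp only: U_moments(4) mult_1 power2_minus)
qed

text \<open>A second moment about 0 would grow with \<mu>^2. The centre m is the asymptote of G at
  \<mu>, which the linear branch on the side of \<mu> hits in mean. The opposite branch misses it by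
  |\<mu>| but has a Gaussian small probability, and in the middle m^2 <= \<mu>^2 is absorbed by
  exp(5/4 \<mu>^2). The centre may differ from the mean, as a variance is at most any second
  moment.\<close>

lemma T_variance:
  defines "m \<equiv> (if 0 \<le> \<mu> then (1 - \<beta>) * \<mu> else - \<beta> * \<mu>)"
  shows "(\<integral>p. \<integral>q. (T p q - m)\<^sup>2 \<partial>N \<partial>N) \<le> 8 * (real M * sqrt n)"
proof -
  have m: "\<bar>m\<bar> \<le> \<bar>\<mu>\<bar>" using \<beta> by (auto simp: m_def abs_mult intro: mult_left_le_one_le)
  have s1: "s\<^sup>2 \<le> 1" using s by simp
  \<comment> \<open>For the linear branch on the wrong side, with x = |\<mu>|: the squared error x^2
    is outweighed by the tail at distance l + x.\<close>
  have xe: "x\<^sup>2 * exp (- 5 / 2 * (l + x)\<^sup>2) \<le> 1" if "0 \<le> x" for x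
  proof -
    have "x\<^sup>2 * exp (- 5 / 2 * (l + x)\<^sup>2) \<le> exp (x\<^sup>2) * exp (- (x\<^sup>2))"
    proof (intro mult_mono)
      show "x\<^sup>2 \<le> exp (x\<^sup>2)" using exp_ge_add_one_self[of "x\<^sup>2"] by linarith
      have "x\<^sup>2 \<le> (l + x)\<^sup>2" using that l by (intro power_mono) auto
      then show "exp (- 5 / 2 * (l + x)\<^sup>2) \<le> exp (- (x\<^sup>2))"
        unfolding exp_le_cancel_iff using zero_le_power2[of "l + x"] by linarith
    qed auto
    then show ?thesis by (simp add: mult_exp_exp)
  qed
  have low: "P_low * (\<beta>\<^sup>2 * s\<^sup>2 + (- \<beta> * \<mu> - m)\<^sup>2) \<le> P_low + 1"
  proof -
    have "\<beta>\<^sup>2 * s\<^sup>2 \<le> 1" using \<beta> s1 by (intro mult_le_one) (auto simp: power_le_one)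
    then have "P_low * (\<beta>\<^sup>2 * s\<^sup>2) \<le> P_low" using P_bounds by (simp add: mult_left_le)
    moreover have "P_low * (- \<beta> * \<mu> - m)\<^sup>2 \<le> 1"
    proof (cases "0 \<le> \<mu>")
      case True
      have "(- \<beta> * \<mu> - m)\<^sup>2 = \<mu>\<^sup>2" using True by (simp add: m_def algebra_simps)
      moreover have "P_low * \<mu>\<^sup>2 \<le> exp (- 5 / 2 * (l + \<mu>)\<^sup>2) * \<mu>\<^sup>2"
        using P_low_tail True l by (intro mult_right_mono) auto
      ultimately show ?thesis using xe[OF True] by (simp add: mult.commute)
    qed (simp add: m_def)
    ultimately show ?thesis by (simp add: distrib_left)
  qed
  have high: "P_high * ((1 - \<beta>)\<^sup>2 * s\<^sup>2 + ((1 - \<beta>) * \<mu> - m)\<^sup>2) \<le> P_high + 1"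
  proof -
    have "(1 - \<beta>)\<^sup>2 * s\<^sup>2 \<le> 1" using \<beta> s1 by (intro mult_le_one) (auto simp: power_le_one)
    then have "P_high * ((1 - \<beta>)\<^sup>2 * s\<^sup>2) \<le> P_high" using P_bounds by (simp add: mult_left_le)
    moreover have "P_high * ((1 - \<beta>) * \<mu> - m)\<^sup>2 \<le> 1"
    proof (cases "0 \<le> \<mu>")
      case False
      have eq: "((1 - \<beta>) * \<mu> - m)\<^sup>2 = (- \<mu>)\<^sup>2" using False by (simp add: m_def algebra_simps)
      have "P_high * (- \<mu>)\<^sup>2 \<le> exp (- 5 / 2 * (l + - \<mu>)\<^sup>2) * (- \<mu>)\<^sup>2"
        using P_high_tail False l by (intro mult_right_mono) auto
      also have "\<dots> \<le> 1" using xe[of "- \<mu>"] False by (simp only: mult.commute)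
      finally show ?thesis unfolding eq .
    qed (simp add: m_def)
    ultimately show ?thesis by (simp add: distrib_left)
  qed
  have mid: "P_mid * (\<integral>p. (S (\<mu> + s * p) - m)\<^sup>2 \<partial>N) \<le> 5 / 2 * (real M * sqrt n) + 2 * sqrt n"
  proof -
    have le: "(S u - m)\<^sup>2 \<le> 2 * (hsum \<beta> M s u)\<^sup>2 + 2 * \<mu>\<^sup>2" for u
    proof -
      have "0 \<le> (S u + m)\<^sup>2" by simp
      then have "(S u - m)\<^sup>2 \<le> 2 * (S u)\<^sup>2 + 2 * m\<^sup>2" by (simp add: power2_eq_square algebra_simps)
      moreover have "(S u)\<^sup>2 \<le> (hsum \<beta> M s u)\<^sup>2"
        unfolding S_def by (rule iffD1[OF abs_le_square_iff clip_bounds(1)[OF n_pos]])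
      moreover have "m\<^sup>2 \<le> \<mu>\<^sup>2" by (rule iffD1[OF abs_le_square_iff m])
      ultimately show ?thesis by linarith
    qed
    have I: "integrable N (\<lambda>p. (hsum \<beta> M s (\<mu> + s * p))\<^sup>2)" using s \<beta> by (intro hsum_second_moment_le) auto
    have "(\<integral>p. (S (\<mu> + s * p) - m)\<^sup>2 \<partial>N) \<le> (\<integral>p. 2 * (hsum \<beta> M s (\<mu> + s * p))\<^sup>2 + 2 * \<mu>\<^sup>2 \<partial>N)"
      using S_sq_integrable[of 1 m] I le by (intro integral_mono) auto
    also have "\<dots> = 2 * (\<integral>p. (hsum \<beta> M s (\<mu> + s * p))\<^sup>2 \<partial>N) + 2 * \<mu>\<^sup>2" using I by simp
    finally have "P_mid * (\<integral>p. (S (\<mu> + s * p) - m)\<^sup>2 \<partial>N) \<le> P_mid * (2 * (\<integral>p. (hsum \<beta> M s (\<mu> + s * p))\<^sup>2 \<partial>N) + 2 * \<mu>\<^sup>2)"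
      using P_bounds by (intro mult_left_mono) auto
    also have "\<dots> = 2 * (P_mid * (\<integral>p. (hsum \<beta> M s (\<mu> + s * p))\<^sup>2 \<partial>N)) + 2 * (P_mid * \<mu>\<^sup>2)" by (simp add: algebra_simps)
    also have "P_mid * \<mu>\<^sup>2 \<le> P_mid * exp (5 / 4 * \<mu>\<^sup>2)"
    proof (intro mult_left_mono P_bounds)
      have "\<mu>\<^sup>2 \<le> 5 / 4 * \<mu>\<^sup>2" by simp
      also have "\<dots> \<le> exp (5 / 4 * \<mu>\<^sup>2)" using exp_ge_add_one_self[of "5 / 4 * \<mu>\<^sup>2"] by linarith
      finally show "\<mu>\<^sup>2 \<le> exp (5 / 4 * \<mu>\<^sup>2)" .
    qed
    also have "\<dots> \<le> sqrt n" using P_mid_exp_le exp_l_le by linarith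
    finally show ?thesis using hsum_sq by simp
  qed
  \<comment> \<open>Everything is compared with M sqrt n: the two linear branches contribute at most
    3, the middle one 5/2 + 2.\<close>
  have "1 \<le> real M * sqrt n" "sqrt n \<le> real M * sqrt n"
    using M n mult_mono[of 1 "real M" 1 "sqrt n"] mult_right_mono[of 1 "real M" "sqrt n"] by auto
  moreover have "P_low + P_high \<le> 1" using P_sum P_bounds by linarith
  ultimately have "(P_low + 1) + (P_high + 1) + (5 / 2 * (real M * sqrt n) + 2 * sqrt n) \<le> 8 * (real M * sqrt n)"
    by linarith
  with add_mono[OF add_mono[OF low high] mid] show ?thesis
    unfolding integral_T_sq by (rule order_trans)
qed

end

section \<open>Bias of the estimate\<close>

lemma one_plus_le_exp: "1 + x \<le> 2 * exp (x\<^sup>2 / 4)" for x :: real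
proof -
  have "0 \<le> (x - 1)\<^sup>2" by simp
  then have "1 + x \<le> 2 * (1 + x\<^sup>2 / 4)" by (simp add: power2_eq_square algebra_simps)
  also have "\<dots> \<le> 2 * exp (x\<^sup>2 / 4)" by (intro mult_left_mono exp_ge_add_one_self) simp
  finally show ?thesis .
qed

text \<open>The quantity in absolute value is E max(0, Z - \<mu>), the error of replacing G by its
  right asymptote, and P is the probability of the branch that does so. For \<mu> >= l/2 this error
  is small, for \<mu> < l/2 the probability is. The left branch is the same statement at -
  \<mu>.\<close>

lemma positive_part_mean_tail:
  assumes "0 \<le> l" "0 \<le> P" "P \<le> 1" and P: "\<mu> \<le> l \<Longrightarrow> P \<le> exp (- 5 / 2 * (l - \<mu>)\<^sup>2)"
  shows "P * \<bar>phi \<mu> + \<mu> * Phi \<mu> - \<mu>\<bar> \<le> 2 * exp (- l\<^sup>2 / 16)"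
proof -
  have eq: "phi \<mu> + \<mu> * Phi \<mu> - \<mu> = phi \<mu> - \<mu> * (1 - Phi \<mu>)" by (simp add: algebra_simps)
  have le: "\<bar>phi \<mu> + \<mu> * Phi \<mu> - \<mu>\<bar> \<le> phi \<mu> + \<bar>\<mu>\<bar> * (1 - Phi \<mu>)"
    unfolding eq using Phi_le_1[of \<mu>] normal_density_nonneg[of 0 1 \<mu>] abs_triangle_ineq4[of "phi \<mu>" "\<mu> * (1 - Phi \<mu>)"]
    by (simp add: abs_mult)
  show ?thesis
  proof (cases "l / 2 \<le> \<mu>")
    case True
    then have \<mu>: "0 \<le> \<mu>" using assms by simp
    have "1 - Phi \<mu> \<le> measure N {\<mu>..}" unfolding one_minus_Phi by (intro N.finite_measure_mono) auto
    then have 1: "1 - Phi \<mu> \<le> exp (- \<mu>\<^sup>2 / 2)" using N_upper_tail[OF \<mu>] by linarith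
    have 2: "phi \<mu> \<le> exp (- \<mu>\<^sup>2 / 2)"
    proof -
      have "1 \<le> sqrt (2 * pi)" using pi_gt3 by simp
      then have "1 / sqrt (2 * pi) * exp (- \<mu>\<^sup>2 / 2) \<le> 1 * exp (- \<mu>\<^sup>2 / 2)" by (intro mult_right_mono) auto
      then show ?thesis by (simp add: std_normal_density_def)
    qed
    have "P * \<bar>phi \<mu> + \<mu> * Phi \<mu> - \<mu>\<bar> \<le> 1 * (phi \<mu> + \<bar>\<mu>\<bar> * (1 - Phi \<mu>))"
      using assms le by (intro mult_mono) auto
    also have "\<dots> \<le> exp (- \<mu>\<^sup>2 / 2) + \<mu> * exp (- \<mu>\<^sup>2 / 2)"
      using 1 2 \<mu> by (auto intro!: add_mono mult_left_mono)
    also have "\<dots> = (1 + \<mu>) * exp (- \<mu>\<^sup>2 / 2)" by (simp add: algebra_simps)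
    also have "\<dots> \<le> 2 * exp (\<mu>\<^sup>2 / 4) * exp (- \<mu>\<^sup>2 / 2)" by (intro mult_right_mono one_plus_le_exp) simp
    also have "\<dots> = 2 * exp (- \<mu>\<^sup>2 / 4)" by (simp add: mult_exp_exp)
    also have "\<dots> \<le> 2 * exp (- l\<^sup>2 / 16)"
    proof -
      have "(l / 2)\<^sup>2 \<le> \<mu>\<^sup>2" using True assms by (intro power_mono) auto
      then show ?thesis by (simp add: power_divide)
    qed
    finally show ?thesis .
  next
    case False
    define y where "y = l - \<mu>"
    have y: "l / 2 \<le> y" "0 \<le> y" "\<bar>\<mu>\<bar> \<le> y" "\<mu> \<le> l" using False assms by (auto simp: y_def abs_le_iff)
    have "\<bar>phi \<mu> + \<mu> * Phi \<mu> - \<mu>\<bar> \<le> 1 + \<bar>\<mu>\<bar> * 1"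
      by (rule order_trans[OF le]) (intro add_mono phi_le_1 mult_left_mono, use Phi_nonneg[of \<mu>] in auto)
    then have "\<bar>phi \<mu> + \<mu> * Phi \<mu> - \<mu>\<bar> \<le> 1 + y" using y by simp
    then have "P * \<bar>phi \<mu> + \<mu> * Phi \<mu> - \<mu>\<bar> \<le> exp (- 5 / 2 * y\<^sup>2) * (1 + y)"
      using P[OF y(4)] assms unfolding y_def by (intro mult_mono) auto
    also have "\<dots> \<le> exp (- 5 / 2 * y\<^sup>2) * (2 * exp (y\<^sup>2 / 4))" by (intro mult_left_mono one_plus_le_exp) simp
    also have "\<dots> = 2 * exp (- 9 / 4 * y\<^sup>2)" by (simp add: mult_exp_exp)
    also have "\<dots> \<le> 2 * exp (- l\<^sup>2 / 16)"
    proof -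
      have "(l / 2)\<^sup>2 \<le> y\<^sup>2" using y assms by (intro power_mono) auto
      then have "l\<^sup>2 / 4 \<le> y\<^sup>2" by (simp add: power_divide)
      then have "- 9 / 4 * y\<^sup>2 \<le> - l\<^sup>2 / 16" using zero_le_power2[of y] by linarith
      then show ?thesis by simp
    qed
    finally show ?thesis .
  qed
qed

text \<open>From J^J/J! <= e^J and y/J <= e^(-2) one gets y^J/J! <= e^(-J) <= e^(-4 y), and y <=
  e^y. This is the origin of the factor e^2 in the truncation order.\<close>

lemma power_div_fact_le:
  fixes y :: real
  assumes "0 \<le> y" "4 * y \<le> real J" and e: "(exp 1)\<^sup>2 * y \<le> real J"
  shows "y * (y ^ J / fact J) \<le> exp (- 3 * y)"
proof (cases "J = 0")
  case True
  then have "y = 0" using assms by simp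
  then show ?thesis using True by simp
next
  case False
  have "(real J) ^ J / fact J \<le> exp (real J)"
  proof -
    have "(real J) ^ J / fact J = (\<Sum>i\<in>{J}. (real J) ^ i /\<^sub>R fact i)" by (simp add: divide_inverse mult.commute)
    also have "\<dots> \<le> (\<Sum>i. (real J) ^ i /\<^sub>R fact i)"
      by (intro sum_le_suminf[OF summable_exp_generic]) auto
    finally show ?thesis by (simp add: exp_def)
  qed
  moreover have "(y / real J) ^ J \<le> exp (- 2 * real J)"
  proof -
    have "y / real J \<le> exp (- 2)"
      using e False by (simp add: exp_minus field_simps flip: exp_of_nat_mult)
    then have "(y / real J) ^ J \<le> exp (- 2) ^ J" using assms False by (intro power_mono) auto
    then show ?thesis by (simp flip: exp_of_nat_mult add: mult.commute)
  qed
  ultimately have "(y / real J) ^ J * ((real J) ^ J / fact J) \<le> exp (- 2 * real J) * exp (real J)"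
    using assms by (intro mult_mono) auto
  also have "\<dots> = exp (- real J)" by (simp add: mult_exp_exp)
  also have "(y / real J) ^ J * ((real J) ^ J / fact J) = y ^ J / fact J" using False by (simp add: power_divide)
  finally have 1: "y ^ J / fact J \<le> exp (- real J)" .
  have "y \<le> exp y" using exp_ge_add_one_self[of y] by linarith
  moreover have "exp (- real J) \<le> exp (- 4 * y)" using assms by simp
  ultimately have "y * (y ^ J / fact J) \<le> exp y * exp (- 4 * y)"
    using assms by (intro mult_mono order_trans[OF 1]) auto
  then show ?thesis by (simp add: mult_exp_exp)
qed

locale coord_taylor = coord_poly +
  fixes r :: real and K :: nat
  assumes r: "0 < r" "r\<^sup>2 \<le> 1 / 10" "s\<^sup>2 \<le> 2 * r\<^sup>2"
    and MK: "M = K + 2" and K: "(exp 1)\<^sup>2 * (l + 2 * r * sqrt (ln n))\<^sup>2 \<le> real K"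
begin

text \<open>Means are separated at l' = l + 2 r sqrt(ln n). Up to l' the order K >= e^2 l'^2 makes
  the Taylor remainder small. Beyond l' the Taylor polynomial is useless; G and the mean of the
  expansion are bounded crudely, and the small probability of the middle branch does the
  work.\<close>

lemma hsum_bias:
  "P_mid * \<bar>(\<integral>p. hsum \<beta> M s (\<mu> + s * p) \<partial>N) - G \<mu> \<beta>\<bar> \<le> exp (- l\<^sup>2 / 16) + (2 * M + 2) * exp (- ln n / 4)"
proof -
  define l' where "l' = l + 2 * r * sqrt (ln n)"
  have L: "0 \<le> ln n" using n by simp
  have l': "l \<le> l'" "0 \<le> l'" using r L l by (auto simp: l'_def)
  have E: "(\<integral>p. hsum \<beta> M s (\<mu> + s * p) \<partial>N) = (\<Sum>m<K + 2. hcoef \<beta> m * \<mu> ^ m)"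
    using integral_hsum(2)[of s \<beta> M \<mu>] s by (simp add: MK)
  show ?thesis
  proof (cases "\<bar>\<mu>\<bar> \<le> l'")
    case True
    define J where "J = (K + 1) div 2"
    \<comment> \<open>J counts the even indices below K, so J >= K/2, and the assumption on K
      becomes e^2 y <= J with y = l'^2/2.\<close>
    have "real K \<le> real (2 * J)" unfolding of_nat_le_iff J_def by presburger
    then have J: "real K / 2 \<le> real J" by simp
    let ?y = "l'\<^sup>2 / 2" and ?x = "\<mu>\<^sup>2 / 2"
    have x: "0 \<le> ?x" "?x \<le> ?y" using True l' abs_le_square_iff[of \<mu> l'] by auto
    have "(2::real) ^ 2 \<le> (exp 1)\<^sup>2" using exp_ge_add_one_self[of 1] by (intro power_mono) auto
    then have "4 * l'\<^sup>2 \<le> (exp 1)\<^sup>2 * l'\<^sup>2" by (intro mult_right_mono) auto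
    moreover have Ky: "(exp 1)\<^sup>2 * ?y \<le> real J" using K J by (simp add: l'_def)
    ultimately have "4 * ?y \<le> real J" by simp
    have "\<bar>G \<mu> \<beta> - (\<Sum>m<K + 2. hcoef \<beta> m * \<mu> ^ m)\<bar> \<le> ?x * (?x ^ J / fact J)"
      unfolding J_def by (rule G_taylor_remainder)
    also have "\<dots> \<le> ?y * (?y ^ J / fact J)"
      by (intro mult_mono divide_right_mono power_mono[OF x(2,1)] x(2)) (use x(1) in auto)
    also have "\<dots> \<le> exp (- 3 * ?y)"
      by (rule power_div_fact_le) (use Ky \<open>4 * ?y \<le> real J\<close> in auto)
    also have "\<dots> \<le> exp (- l\<^sup>2 / 16)"
    proof -
      have "l\<^sup>2 \<le> l'\<^sup>2" using l l' by (intro power_mono) auto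
      then have "l\<^sup>2 / 16 \<le> 3 * ?y" using zero_le_power2[of l'] by linarith
      then show ?thesis by simp
    qed
    finally have b: "\<bar>(\<integral>p. hsum \<beta> M s (\<mu> + s * p) \<partial>N) - G \<mu> \<beta>\<bar> \<le> exp (- l\<^sup>2 / 16)"
      unfolding E by (subst abs_minus_commute)
    have "P_mid * \<bar>(\<integral>p. hsum \<beta> M s (\<mu> + s * p) \<partial>N) - G \<mu> \<beta>\<bar> \<le> 1 * exp (- l\<^sup>2 / 16)"
      by (intro mult_mono b P_bounds) auto
    moreover have "0 \<le> (2 * M + 2) * exp (- ln n / 4)" by simp
    ultimately show ?thesis by linarith
  next
    case False
    define t where "t = \<bar>\<mu>\<bar> - l"
    have t: "2 * r * sqrt (ln n) \<le> t" "0 \<le> t" using False l' by (auto simp: t_def l'_def)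
    have t2: "4 * r\<^sup>2 * ln n \<le> t\<^sup>2"
    proof -
      have "(2 * r * sqrt (ln n))\<^sup>2 \<le> t\<^sup>2" using t r L by (intro power_mono) auto
      then show ?thesis using L by (simp add: power_mult_distrib)
    qed
    have \<mu>: "\<mu>\<^sup>2 = (l + t)\<^sup>2" by (simp add: t_def)
    have P: "P_mid * exp (5 / 8 * \<mu>\<^sup>2) \<le> exp (- ln n / 4)"
    proof -
      have "P_mid \<le> exp (- (t\<^sup>2 / (2 * s\<^sup>2)))"
        using P_mid_tail False l' by (simp add: t_def)
      also have "\<dots> \<le> exp (- (t\<^sup>2 / (4 * r\<^sup>2)))"
        using r s by (auto intro!: divide_left_mono mult_pos_pos)
      finally have "P_mid * exp (5 / 8 * \<mu>\<^sup>2) \<le> exp (- (t\<^sup>2 / (4 * r\<^sup>2))) * exp (5 / 8 * \<mu>\<^sup>2)"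
        by (intro mult_right_mono) auto
      also have "\<dots> \<le> exp (- ln n / 4)"
      proof -
        \<comment> \<open>Budget of exponents: one half of t^2/(4 r^2) absorbs 5/4 t^2 because r^2
          <= 1/10; the other half is at least (ln n)/2, and 5/4 l^2 <= (ln n)/4 is paid from
          it.\<close>
        have "0 \<le> (l - t)\<^sup>2" by simp
        then have 1: "5 / 8 * \<mu>\<^sup>2 \<le> 5 / 4 * l\<^sup>2 + 5 / 4 * t\<^sup>2" unfolding \<mu> by (simp add: power2_eq_square algebra_simps)
        have 2: "5 / 4 * t\<^sup>2 \<le> 1 / 2 * (t\<^sup>2 / (4 * r\<^sup>2))"
        proof -
          have "r\<^sup>2 * (10 * t\<^sup>2) \<le> 1 / 10 * (10 * t\<^sup>2)" using r by (intro mult_right_mono) auto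
          then show ?thesis using r by (simp add: field_simps)
        qed
        have 3: "ln n \<le> t\<^sup>2 / (4 * r\<^sup>2)" using t2 r by (simp add: field_simps)
        have "- (t\<^sup>2 / (4 * r\<^sup>2)) + 5 / 8 * \<mu>\<^sup>2 \<le> - ln n / 4" using 1 2 3 ln by linarith
        then show ?thesis by (simp add: mult_exp_exp)
      qed
      finally show ?thesis .
    qed
    have "\<bar>\<integral>p. hsum \<beta> M s (\<mu> + s * p) \<partial>N\<bar> \<le> 2 * M * exp (5 / 8 * \<mu>\<^sup>2)"
    proof -
      let ?X = "\<lambda>p. hsum \<beta> M s (\<mu> + s * p)"
      have I: "integrable N ?X" "integrable N (\<lambda>p. (?X p)\<^sup>2)" using s \<beta> by (auto intro: integral_hsum hsum_second_moment_le)
      \<comment> \<open>Jensen's inequality: the mean is at most the root of the second moment,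
        which halves the exponent 5/4 to 5/8.\<close>
      have "0 \<le> N.variance ?X" by (rule N.variance_positive)
      then have "(\<integral>p. ?X p \<partial>N)\<^sup>2 \<le> (\<integral>p. (?X p)\<^sup>2 \<partial>N)" using N.variance_eq[OF I] by simp
      also have "\<dots> \<le> M * (5 / 4 * exp (5 / 4 * \<mu>\<^sup>2))" using s \<beta> by (intro hsum_second_moment_le) auto
      also have "\<dots> \<le> (2 * M)\<^sup>2 * exp (5 / 4 * \<mu>\<^sup>2)"
      proof -
        have "5 / 4 * real M \<le> 4 * (real M * real M)" using M mult_right_mono[of 1 "real M" "real M"] by simp
        then have "5 / 4 * real M * exp (5 / 4 * \<mu>\<^sup>2) \<le> 4 * (real M * real M) * exp (5 / 4 * \<mu>\<^sup>2)" by (intro mult_right_mono) auto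
        then show ?thesis by (simp add: power2_eq_square)
      qed
      also have "\<dots> = (2 * M * exp (5 / 8 * \<mu>\<^sup>2))\<^sup>2"
        by (simp add: power_mult_distrib) (simp flip: exp_of_nat_mult)
      finally show ?thesis by (simp add: abs_le_square_iff[symmetric])
    qed
    moreover have "\<bar>G \<mu> \<beta>\<bar> \<le> 2 * exp (5 / 8 * \<mu>\<^sup>2)"
    proof -
      have "\<bar>G \<mu> \<beta>\<bar> \<le> 2 * exp (\<bar>\<mu>\<bar>\<^sup>2 / 4)" using abs_G_le[OF \<beta>, of \<mu>] one_plus_le_exp[of "\<bar>\<mu>\<bar>"] by linarith
      also have "\<dots> \<le> 2 * exp (5 / 8 * \<mu>\<^sup>2)" by simp
      finally show ?thesis .
    qed
    ultimately have "\<bar>(\<integral>p. hsum \<beta> M s (\<mu> + s * p) \<partial>N) - G \<mu> \<beta>\<bar> \<le> (2 * M + 2) * exp (5 / 8 * \<mu>\<^sup>2)"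
      by (simp add: distrib_right)
    then have "P_mid * \<bar>(\<integral>p. hsum \<beta> M s (\<mu> + s * p) \<partial>N) - G \<mu> \<beta>\<bar> \<le> P_mid * ((2 * M + 2) * exp (5 / 8 * \<mu>\<^sup>2))"
      by (intro mult_left_mono P_bounds)
    also have "\<dots> = (2 * M + 2) * (P_mid * exp (5 / 8 * \<mu>\<^sup>2))" by simp
    also have "\<dots> \<le> (2 * M + 2) * exp (- ln n / 4)" by (intro mult_left_mono P) auto
    finally show ?thesis using exp_ge_zero[of "- l\<^sup>2 / 16"] by linarith
  qed
qed

text \<open>The branch probabilities add up to 1, so the error splits over the branches; in the
  middle, clipping is separated from the expansion. The terms in exp(-(ln n)/4) are dominated by
  exp(- l^2/16), since 5 l^2 <= ln n, and the total count 5 + (4 M + 2) is at most 11 M.\<close>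

lemma T_bias: "\<bar>(\<integral>p. \<integral>q. T p q \<partial>N \<partial>N) - G \<mu> \<beta>\<bar> \<le> 11 * M * exp (- l\<^sup>2 / 16)"
proof -
  let ?h = "\<integral>p. hsum \<beta> M s (\<mu> + s * p) \<partial>N" and ?S = "\<integral>p. S (\<mu> + s * p) \<partial>N"
  have L: "0 \<le> ln n" using n by simp
  have I: "integrable N (\<lambda>p. hsum \<beta> M s (\<mu> + s * p))" "integrable N (\<lambda>p. (hsum \<beta> M s (\<mu> + s * p))\<^sup>2)"
    using s \<beta> by (auto intro: integral_hsum hsum_second_moment_le)
  have "(\<integral>p. \<integral>q. T p q \<partial>N \<partial>N) - G \<mu> \<beta> = (\<integral>p. \<integral>q. T p q \<partial>N \<partial>N) - (P_low + P_high + P_mid) * G \<mu> \<beta>"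
    by (simp add: P_sum)
  also have "\<dots> = P_low * (- \<beta> * \<mu> - G \<mu> \<beta>) + P_high * ((1 - \<beta>) * \<mu> - G \<mu> \<beta>) + (P_mid * (?S - ?h) + P_mid * (?h - G \<mu> \<beta>))"
    unfolding integral_T by (simp add: algebra_simps)
  finally have "\<bar>(\<integral>p. \<integral>q. T p q \<partial>N \<partial>N) - G \<mu> \<beta>\<bar> \<le> \<bar>P_low * (- \<beta> * \<mu> - G \<mu> \<beta>)\<bar> + \<bar>P_high * ((1 - \<beta>) * \<mu> - G \<mu> \<beta>)\<bar>
     + (\<bar>P_mid * (?S - ?h)\<bar> + \<bar>P_mid * (?h - G \<mu> \<beta>)\<bar>)"
    by linarith
  moreover have "\<bar>P_low * (- \<beta> * \<mu> - G \<mu> \<beta>)\<bar> \<le> 2 * exp (- l\<^sup>2 / 16)"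
  proof -
    \<comment> \<open>Reflection: by \<open>Phi (- x) = 1 - Phi x\<close> the left branch at \<mu>
      becomes the right branch at - \<mu>.\<close>
    have "- \<beta> * \<mu> - G \<mu> \<beta> = - (phi (- \<mu>) + (- \<mu>) * Phi (- \<mu>) - (- \<mu>))"
      by (simp add: G_def phi_even Phi_uminus algebra_simps)
    then have "\<bar>P_low * (- \<beta> * \<mu> - G \<mu> \<beta>)\<bar> = P_low * \<bar>phi (- \<mu>) + (- \<mu>) * Phi (- \<mu>) - (- \<mu>)\<bar>"
      using P_bounds by (simp only: abs_mult abs_minus_cancel abs_of_nonneg)
    then show ?thesis using positive_part_mean_tail[OF l P_bounds(1,2) P_low_tail] by simp
  qed
  moreover have "\<bar>P_high * ((1 - \<beta>) * \<mu> - G \<mu> \<beta>)\<bar> \<le> 2 * exp (- l\<^sup>2 / 16)"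
  proof -
    have "(1 - \<beta>) * \<mu> - G \<mu> \<beta> = - (phi \<mu> + \<mu> * Phi \<mu> - \<mu>)" by (simp add: G_def algebra_simps)
    then have "\<bar>P_high * ((1 - \<beta>) * \<mu> - G \<mu> \<beta>)\<bar> = P_high * \<bar>phi \<mu> + \<mu> * Phi \<mu> - \<mu>\<bar>"
      using P_bounds by (simp only: abs_mult abs_minus_cancel abs_of_nonneg)
    then show ?thesis using positive_part_mean_tail[OF l P_bounds(3,4) P_high_tail] by simp
  qed
  moreover have "\<bar>P_mid * (?S - ?h)\<bar> \<le> 2 * M * exp (- ln n / 4)"
  proof -
    have "\<bar>?S - ?h\<bar> = \<bar>\<integral>p. S (\<mu> + s * p) - hsum \<beta> M s (\<mu> + s * p) \<partial>N\<bar>" using S_integrable I by simp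
    also have "\<dots> \<le> (\<integral>p. \<bar>S (\<mu> + s * p) - hsum \<beta> M s (\<mu> + s * p)\<bar> \<partial>N)" by (rule integral_abs_bound)
    also have "\<dots> \<le> (\<integral>p. (hsum \<beta> M s (\<mu> + s * p))\<^sup>2 / n \<partial>N)"
      using S_integrable I clip_bounds(3)[OF n_pos] by (intro integral_mono) (auto simp: S_def)
    finally have "P_mid * \<bar>?S - ?h\<bar> \<le> P_mid * (\<integral>p. (hsum \<beta> M s (\<mu> + s * p))\<^sup>2 / n \<partial>N)"
      by (intro mult_left_mono P_bounds)
    also have "\<dots> = P_mid * (\<integral>p. (hsum \<beta> M s (\<mu> + s * p))\<^sup>2 \<partial>N) / n" by simp
    also have "\<dots> \<le> 5 / 4 * M * sqrt n / n" using n by (intro divide_right_mono hsum_sq) auto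
    also have "\<dots> = 5 / 4 * M * exp (- ln n / 2)"
    proof -
      have nn: "sqrt n * sqrt n = n" using n by simp
      have "sqrt n / (sqrt n * sqrt n) = 1 / sqrt n" using n by (intro nonzero_divide_mult_cancel_left) auto
      then have "sqrt n / n = 1 / sqrt n" by (simp only: nn)
      also have "\<dots> = exp (- ln n / 2)"
      proof -
        have "exp (ln n / 2) = sqrt n" using n by (simp add: ln_sqrt[symmetric])
        then show ?thesis by (metis exp_minus inverse_eq_divide minus_divide_left)
      qed
      finally have "sqrt n / n = exp (- ln n / 2)" .
      then show ?thesis by (simp only: times_divide_eq_right[symmetric])
    qed
    also have "\<dots> \<le> 2 * M * exp (- ln n / 4)" using L by (intro mult_mono) auto
    finally show ?thesis using P_bounds by (simp add: abs_mult)
  qed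
  moreover have "\<bar>P_mid * (?h - G \<mu> \<beta>)\<bar> \<le> exp (- l\<^sup>2 / 16) + (2 * M + 2) * exp (- ln n / 4)"
    using hsum_bias P_bounds by (simp add: abs_mult)
  moreover have "(4 * M + 2) * exp (- ln n / 4) \<le> (4 * M + 2) * exp (- l\<^sup>2 / 16)"
    using ln l L by (intro mult_left_mono) auto
  ultimately have "\<bar>(\<integral>p. \<integral>q. T p q \<partial>N \<partial>N) - G \<mu> \<beta>\<bar> \<le> (7 + 4 * M) * exp (- l\<^sup>2 / 16)"
    by (simp add: distrib_right)
  also have "\<dots> \<le> 11 * M * exp (- l\<^sup>2 / 16)" using M by (intro mult_right_mono) auto
  finally show ?thesis .
qed

end

text \<open>\<open>T_hat\<close> averages over the auxiliary noise, a conditional expectation given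
  the datum, and this does not increase second moments about a fixed m. Sections of an integrable
  function are integrable only almost everywhere, hence the detour through
  \<open>AE\<close>.\<close>

lemma NN_jensen:
  fixes f :: "real \<times> real \<Rightarrow> real"
  assumes f: "integrable (N \<Otimes>\<^sub>M N) f" and f2: "integrable (N \<Otimes>\<^sub>M N) (\<lambda>w. (f w - m)\<^sup>2)"
  shows "integrable N (\<lambda>x. \<integral>z. f (x, z) \<partial>N)"
    and "integrable N (\<lambda>x. ((\<integral>z. f (x, z) \<partial>N) - m)\<^sup>2)"
    and "(\<integral>x. ((\<integral>z. f (x, z) \<partial>N) - m)\<^sup>2 \<partial>N) \<le> (\<integral>x. \<integral>z. (f (x, z) - m)\<^sup>2 \<partial>N \<partial>N)"
proof -
  show I: "integrable N (\<lambda>x. \<integral>z. f (x, z) \<partial>N)" by (rule NN.integrable_fst'[OF f])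
  have I2: "integrable N (\<lambda>x. \<integral>z. (f (x, z) - m)\<^sup>2 \<partial>N)" by (rule NN.integrable_fst'[OF f2])
  have le: "AE x in N. ((\<integral>z. f (x, z) \<partial>N) - m)\<^sup>2 \<le> (\<integral>z. (f (x, z) - m)\<^sup>2 \<partial>N)"
    using NN.AE_integrable_fst'[OF f] NN.AE_integrable_fst'[OF f2]
  proof eventually_elim
    case (elim x)
    have J: "integrable N (\<lambda>z. f (x, z) - m)" using elim by simp
    have "0 \<le> N.variance (\<lambda>z. f (x, z) - m)" by (rule N.variance_positive)
    then have "(\<integral>z. f (x, z) - m \<partial>N)\<^sup>2 \<le> (\<integral>z. (f (x, z) - m)\<^sup>2 \<partial>N)"
      using N.variance_eq[OF J elim(2)] by simp
    then show ?case using elim by simp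
  qed
  show I3: "integrable N (\<lambda>x. ((\<integral>z. f (x, z) \<partial>N) - m)\<^sup>2)"
  proof (rule Bochner_Integration.integrable_bound[OF I2])
    show "(\<lambda>x. ((\<integral>z. f (x, z) \<partial>N) - m)\<^sup>2) \<in> borel_measurable N"
      using borel_measurable_integrable[OF I] by measurable
    show "AE x in N. norm (((\<integral>z. f (x, z) \<partial>N) - m)\<^sup>2) \<le> norm (\<integral>z. (f (x, z) - m)\<^sup>2 \<partial>N)"
      using le by eventually_elim simp
  qed
  show "(\<integral>x. ((\<integral>z. f (x, z) \<partial>N) - m)\<^sup>2 \<partial>N) \<le> (\<integral>x. \<integral>z. (f (x, z) - m)\<^sup>2 \<partial>N \<partial>N)"
    by (rule integral_mono_AE[OF I3 I2 le])
qed

section \<open>One coordinate of the model in standardised form\<close>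

lemma alpha_bounds:
  assumes "0 < vp" shows "0 \<le> alpha vp t" "alpha vp t \<le> 1" "t \<noteq> \<infinity> \<Longrightarrow> alpha vp t < 1"
proof -
  have "enn2real t / (enn2real t + vp) < 1" "0 \<le> enn2real t / (enn2real t + vp)"
    using assms enn2real_nonneg[of t] add_nonneg_pos[of "enn2real t" vp] by (auto simp: divide_simps)
  then show "0 \<le> alpha vp t" "alpha vp t \<le> 1" "t \<noteq> \<infinity> \<Longrightarrow> alpha vp t < 1" by (auto simp: alpha_def)
qed

text \<open>Gives 1/(4 e) <= 1/10, the source of the bounds 1/10 for r^2 and g^2 and of 1/5 for
  s^2.\<close>

lemma exp_1_ge: "5 / 2 \<le> exp (1::real)"
  using exp_lower_Taylor_quadratic[of 1] by simp

locale coordinate =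
  fixes vp vf g \<beta> :: real and n :: nat
  assumes vp: "0 < vp" and vf: "0 < vf" and g: "0 < g" "g + sqrt (vp / vf) < 1 / sqrt (4 * exp 1)"
    and \<beta>: "0 \<le> \<beta>" "\<beta> \<le> 1" and n: "3 \<le> n"
begin

definition "r = sqrt (vp / vf)"
definition "M = Suc (trunc_order n g vp vf)"

lemma r: "0 < r" "r\<^sup>2 = vp / vf" "r\<^sup>2 \<le> 1 / 10" "g\<^sup>2 \<le> 1 / 10" "(g + r)\<^sup>2 \<le> 1 / (4 * exp 1)"
proof -
  show r0: "0 < r" "r\<^sup>2 = vp / vf" using vp vf by (auto simp: r_def)
  have gr: "g + r < 1 / sqrt (4 * exp 1)" using g by (simp add: r_def)
  then have "(g + r)\<^sup>2 \<le> (1 / sqrt (4 * exp 1))\<^sup>2" using r0 g by (intro power_mono) auto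
  then show *: "(g + r)\<^sup>2 \<le> 1 / (4 * exp 1)" by (simp add: power_divide)
  have "1 / (4 * exp 1) \<le> (1 / 10 :: real)" using exp_1_ge by (simp add: field_simps)
  moreover have "r\<^sup>2 \<le> (g + r)\<^sup>2" "g\<^sup>2 \<le> (g + r)\<^sup>2" by (intro power_mono; use r0 g in simp)+
  ultimately show "r\<^sup>2 \<le> 1 / 10" "g\<^sup>2 \<le> 1 / 10" using * by linarith+
qed

lemma ln_n: "1 \<le> ln (real n)"
proof -
  have "exp 1 \<le> (3::real)" by (rule exp_le)
  also have "\<dots> \<le> real n" using n by simp
  finally have "ln (exp 1) \<le> ln (real n)" by (subst ln_le_cancel_iff) (use n in auto)
  then show ?thesis by simp
qed

lemma lam_sq: "(lam n g)\<^sup>2 = 2 * g\<^sup>2 * ln (real n)" and lam_nonneg: "0 \<le> lam n g"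
  using ln_n g by (auto simp: lam_def power_mult_distrib)

text \<open>By (g + r)^2 <= 1/(4 e) the argument of the ceiling is at most e ln n <= 3 ln n.
  Rounding and the two extra terms add at most 3, and n >= 3 makes ln n >= 1.\<close>

lemma M_le: "real M \<le> 6 * ln (real n)"
proof -
  let ?x = "(exp 1)\<^sup>2 * (g + sqrt (2 * vp / vf))\<^sup>2 * (2 * ln (real n))"
  have x0: "0 \<le> ?x" using ln_n by simp
  have sq: "sqrt (2 * vp / vf) = sqrt 2 * r" by (simp add: r_def real_sqrt_mult[symmetric])
  have "(g + sqrt (2 * vp / vf))\<^sup>2 \<le> (sqrt 2 * (g + r))\<^sup>2"
  proof (rule power_mono)
    have "1 * g \<le> sqrt 2 * g" using g by (intro mult_right_mono) auto
    then show "g + sqrt (2 * vp / vf) \<le> sqrt 2 * (g + r)" by (simp add: sq distrib_left)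
    show "0 \<le> g + sqrt (2 * vp / vf)" using g r by (simp add: sq)
  qed
  also have "\<dots> = 2 * (g + r)\<^sup>2" by (simp add: power_mult_distrib)
  also have "\<dots> \<le> 2 * (1 / (4 * exp 1))" using r(5) by (rule mult_left_mono) simp
  finally have "?x \<le> (exp 1)\<^sup>2 * (2 * (1 / (4 * exp 1))) * (2 * ln (real n))"
    using ln_n by (intro mult_right_mono mult_left_mono) auto
  also have "\<dots> = exp 1 * ln (real n)" by (simp add: power2_eq_square)
  also have "\<dots> \<le> 3 * ln (real n)" using ln_n exp_le by (intro mult_right_mono) auto
  finally have "?x \<le> 3 * ln (real n)" .
  moreover have "real (nat \<lceil>?x\<rceil>) \<le> ?x + 1" using x0 by linarith
  moreover have "real M = 2 + real (nat \<lceil>?x\<rceil>)" unfolding M_def trunc_order_def by simp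
  ultimately show ?thesis using ln_n by linarith
qed

end

locale coordinate_at = coordinate +
  fixes \<tau> \<eta> \<theta> :: real
  assumes \<tau>: "0 \<le> \<tau>"
begin

text \<open>\<open>\<sigma> * \<mu>\<close> is the mean of the prediction error
  \<open>coord_predictor\<close> - \<theta>, and \<sigma>^2 is the future variance plus the variance
  of the predictor, so \<sigma> G(\<mu>) is the coordinate risk per unit of b + h. The risk estimate
  standardises in the same way, with the datum in place of \<theta>.\<close>

definition "a = alpha vp (ennreal \<tau>)"
definition "\<sigma> = sqrt (vf + a\<^sup>2 * vp)"
definition "\<mu> = c_coef \<beta> vp vf \<tau> + d_coef vp vf \<tau> * (\<theta> - \<eta>)"
definition "s = s_coef vp vf \<tau>"

lemma a: "0 \<le> a" "a < 1" using alpha_bounds[OF vp, of "ennreal \<tau>"] by (auto simp: a_def)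

lemma \<sigma>: "0 < \<sigma>" "vf \<le> \<sigma>\<^sup>2" "\<sigma>\<^sup>2 = vf + a\<^sup>2 * vp"
proof -
  have "0 < vf + a\<^sup>2 * vp" "0 \<le> a\<^sup>2 * vp" using vf vp by (auto intro: add_pos_nonneg)
  then show "0 < \<sigma>" "vf \<le> \<sigma>\<^sup>2" "\<sigma>\<^sup>2 = vf + a\<^sup>2 * vp" by (auto simp: \<sigma>_def)
qed

lemma d_eq: "d_coef vp vf \<tau> = - (1 - a) / \<sigma>" by (simp add: d_coef_def a_def \<sigma>_def)

lemma s_pos: "0 < s" using a \<sigma> vp by (simp add: s_def s_coef_def d_eq)

lemma s_eq: "s = sqrt 2 * sqrt vp * ((1 - a) / \<sigma>)"
  using a \<sigma> by (simp add: s_def s_coef_def d_eq real_sqrt_mult)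

lemma s_sq: "s\<^sup>2 \<le> 2 * r\<^sup>2"
proof -
  have "s\<^sup>2 = 2 * vp * (1 - a)\<^sup>2 / \<sigma>\<^sup>2" using vp by (simp add: s_eq power_mult_distrib power_divide)
  also have "\<dots> \<le> 2 * vp * 1 / vf"
    using \<sigma> a vp vf by (intro frac_le mult_left_mono) (auto simp: power_le_one)
  finally show ?thesis by (simp add: r)
qed

sublocale coord_taylor s "lam n g" \<mu> \<beta> M "real n" r "nat \<lceil>(exp 1)\<^sup>2 * (g + sqrt (2 * vp / vf))\<^sup>2 * (2 * ln (real n))\<rceil>"
proof
  let ?L = "ln (real n)"
  show "0 < s" by (rule s_pos)
  show "s\<^sup>2 \<le> 2 * r\<^sup>2" by (rule s_sq)
  then show "s\<^sup>2 \<le> 1 / 5" using r(3) by linarith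
  show "0 \<le> lam n g" by (rule lam_nonneg)
  show "0 \<le> \<beta>" "\<beta> \<le> 1" by (fact \<beta>)+
  show "1 \<le> real n" using n by simp
  show "1 \<le> M" by (simp add: M_def)
  have "2 * g\<^sup>2 * ?L \<le> 2 * (1 / 10) * ?L" using r(4) ln_n by (intro mult_right_mono mult_left_mono) auto
  then show "5 * (lam n g)\<^sup>2 \<le> ?L" by (simp add: lam_sq)
  show "0 < r" "r\<^sup>2 \<le> 1 / 10" by (fact r)+
  show "M = nat \<lceil>(exp 1)\<^sup>2 * (g + sqrt (2 * vp / vf))\<^sup>2 * (2 * ?L)\<rceil> + 2"
    by (simp add: M_def trunc_order_def)
  \<comment> \<open>The reason for the truncation order: since 2 = sqrt 2 sqrt 2, the threshold l'
    of the bias estimate is (g + sqrt(2 vp/vf)) sqrt(2 ln n), and e^2 times its square stands under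
    the ceiling.\<close>
  have "lam n g + 2 * r * sqrt ?L = (g + sqrt (2 * vp / vf)) * sqrt (2 * ?L)"
  proof -
    have "sqrt (2 * vp / vf) = sqrt 2 * r" by (simp add: r_def real_sqrt_mult[symmetric])
    moreover have "sqrt (2 * ?L) = sqrt 2 * sqrt ?L" by (rule real_sqrt_mult)
    ultimately have "(g + sqrt (2 * vp / vf)) * sqrt (2 * ?L) = g * sqrt (2 * ?L) + (sqrt 2 * sqrt 2) * (r * sqrt ?L)"
      by (simp only:) (simp add: algebra_simps)
    then show ?thesis by (simp add: lam_def)
  qed
  then have "(exp 1)\<^sup>2 * (lam n g + 2 * r * sqrt ?L)\<^sup>2 = (exp 1)\<^sup>2 * (g + sqrt (2 * vp / vf))\<^sup>2 * (2 * ?L)"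
    using ln_n by (simp add: power_mult_distrib)
  also have "\<dots> \<le> real (nat \<lceil>(exp 1)\<^sup>2 * (g + sqrt (2 * vp / vf))\<^sup>2 * (2 * ?L)\<rceil>)"
    by (rule real_nat_ceiling_ge)
  finally show "(exp 1)\<^sup>2 * (lam n g + 2 * r * sqrt ?L)\<^sup>2 \<le> real (nat \<lceil>(exp 1)\<^sup>2 * (g + sqrt (2 * vp / vf))\<^sup>2 * (2 * ?L)\<rceil>)" .
qed

text \<open>Negative because \<open>d_coef\<close> is: s times - 1/sqrt 2 equals
  \<open>d_coef\<close> times sqrt vp.\<close>

abbreviation "rot \<equiv> - 1 / sqrt 2 :: real"

text \<open>With standard normal x for the datum and z for the added noise, U and V are affine in x
  + z and x - z. Divided by sqrt 2 these are independent standard normals, which separates the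
  choice of the branch from the value.\<close>

lemma T_rand_eq:
  "T_rand n \<beta> vp vf g (\<theta> + sqrt vp * x - \<eta>) z \<tau> = T (rot * x + rot * z) (rot * x - rot * z)"
proof -
  have "S_poly n \<beta> vp vf g \<tau> u = hsum \<beta> M s u" for u
    using s_pos by (simp add: S_poly_eq_hsum M_def s_def)
  then have S: "S_trunc n \<beta> vp vf g \<tau> u = S u" for u
    by (simp only: S_trunc_def S_def clip_def)
  have sr: "s * rot = d_coef vp vf \<tau> * sqrt vp" using \<sigma> by (simp add: s_eq d_eq field_simps)
  have U: "c_coef \<beta> vp vf \<tau> + d_coef vp vf \<tau> * (\<theta> + sqrt vp * x - \<eta> + sqrt vp * z) = \<mu> + s * (rot * x + rot * z)"
    unfolding distrib_left mult.assoc[symmetric] sr by (simp add: \<mu>_def algebra_simps)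
  have V: "c_coef \<beta> vp vf \<tau> + d_coef vp vf \<tau> * (\<theta> + sqrt vp * x - \<eta> - sqrt vp * z) = \<mu> + s * (rot * x - rot * z)"
    unfolding right_diff_distrib mult.assoc[symmetric] sr by (simp add: \<mu>_def algebra_simps)
  show ?thesis unfolding T_rand_def Let_def T_split_def U V S ..
qed

lemma rot: "rot\<^sup>2 + rot\<^sup>2 = 1" "rot \<noteq> 0" by (auto simp: power_divide)

abbreviation "That p \<equiv> T_hat n \<beta> vp vf g (\<theta> + sqrt vp * p - \<eta>) \<tau>"

lemma That_eq: "That p = (\<integral>z. (\<lambda>(x, z). T (rot * x + rot * z) (rot * x - rot * z)) (p, z) \<partial>N)"
  by (simp add: T_hat_def T_rand_eq)

lemma That_integrable: "integrable N That"
  and That_bias: "\<bar>(\<integral>p. That p \<partial>N) - G \<mu> \<beta>\<bar> \<le> 11 * real M * exp (- (g\<^sup>2 * ln (real n)) / 8)"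
proof -
  note I = integral_rotate[OF rot T_integrable, simplified fst_conv snd_conv]
  show "integrable N That" unfolding That_eq by (rule NN.integrable_fst'[OF I(1)])
  have "(\<integral>p. That p \<partial>N) = (\<integral>p. \<integral>q. T p q \<partial>N \<partial>N)"
    unfolding That_eq using I(2) by simp
  moreover have e: "exp (- (lam n g)\<^sup>2 / 16) = exp (- (g\<^sup>2 * ln (real n)) / 8)" by (simp add: lam_sq)
  ultimately show "\<bar>(\<integral>p. That p \<partial>N) - G \<mu> \<beta>\<bar> \<le> 11 * real M * exp (- (g\<^sup>2 * ln (real n)) / 8)"
    using T_bias by (simp only: e of_nat_mult of_nat_numeral)
qed

lemma That_variance:
  "\<exists>m. integrable N (\<lambda>p. (That p - m)\<^sup>2) \<and> (\<integral>p. (That p - m)\<^sup>2 \<partial>N) \<le> 8 * (real M * sqrt (real n))"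
proof -
  define m where "m = (if 0 \<le> \<mu> then (1 - \<beta>) * \<mu> else - \<beta> * \<mu>)"
  let ?f = "\<lambda>(x, z). T (rot * x + rot * z) (rot * x - rot * z)"
  note I = integral_rotate[OF rot T_integrable, simplified fst_conv snd_conv]
  note I2 = integral_rotate[OF rot T_sq_integrable[of m], simplified fst_conv snd_conv]
  have J2: "integrable (N \<Otimes>\<^sub>M N) (\<lambda>w. (?f w - m)\<^sup>2)" using I2(1) by (simp add: case_prod_beta')
  note J = NN_jensen[OF I(1) J2]
  have "(\<integral>p. (That p - m)\<^sup>2 \<partial>N) \<le> (\<integral>x. \<integral>z. (?f (x, z) - m)\<^sup>2 \<partial>N \<partial>N)"
    unfolding That_eq by (rule J(3))
  also have "\<dots> = (\<integral>p. \<integral>q. (T p q - m)\<^sup>2 \<partial>N \<partial>N)" using I2(2) by simp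
  also have "\<dots> \<le> 8 * (real M * sqrt (real n))" unfolding m_def by (rule T_variance)
  finally show ?thesis using J(2) unfolding That_eq[symmetric] by blast
qed

lemma loss_eq:
  "sqrt vf * G ((a * (\<theta> + sqrt vp * p) + (1 - a) * \<eta> + sqrt (vf + a * vp) * Phi_inv \<beta> - \<theta>) / sqrt vf) \<beta>
    = sqrt vf * G ((\<sigma> * \<mu> + a * sqrt vp * p) / sqrt vf) \<beta>"
proof -
  have "\<sigma> * c_coef \<beta> vp vf \<tau> = sqrt (vf + a * vp) * Phi_inv \<beta>"
    using \<sigma> by (simp add: c_coef_def a_def[symmetric] real_sqrt_divide \<sigma>_def)
  moreover have "\<sigma> * (d_coef vp vf \<tau> * (\<theta> - \<eta>)) = (1 - a) * (\<eta> - \<theta>)"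
  proof -
    have "\<sigma> * d_coef vp vf \<tau> = - (1 - a)" using \<sigma> by (simp add: d_eq)
    then show ?thesis by (simp only: mult.assoc[symmetric]) (simp add: algebra_simps)
  qed
  ultimately have "\<sigma> * \<mu> = sqrt (vf + a * vp) * Phi_inv \<beta> + (1 - a) * (\<eta> - \<theta>)" by (simp add: \<mu>_def distrib_left)
  then have "a * (\<theta> + sqrt vp * p) + (1 - a) * \<eta> + sqrt (vf + a * vp) * Phi_inv \<beta> - \<theta> = \<sigma> * \<mu> + a * sqrt vp * p"
    by (simp add: algebra_simps)
  then show ?thesis by (simp only:)
qed

definition "loss p = sqrt vf * G ((\<sigma> * \<mu> + a * sqrt vp * p) / sqrt vf) \<beta>"

text \<open>The noise enters the predictor with weight a <= 1 and G is 1-Lipschitz. The loss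
  therefore fluctuates by at most order sqrt vp, whatever \<mu> is.\<close>

lemma loss_lipschitz: "\<bar>loss p - loss q\<bar> \<le> sqrt vp * \<bar>p - q\<bar>"
proof -
  have "\<bar>loss p - loss q\<bar> = sqrt vf * \<bar>G ((\<sigma> * \<mu> + a * sqrt vp * p) / sqrt vf) \<beta> - G ((\<sigma> * \<mu> + a * sqrt vp * q) / sqrt vf) \<beta>\<bar>"
    using vf by (simp add: loss_def abs_mult flip: right_diff_distrib)
  also have "\<dots> \<le> sqrt vf * \<bar>(\<sigma> * \<mu> + a * sqrt vp * p) / sqrt vf - (\<sigma> * \<mu> + a * sqrt vp * q) / sqrt vf\<bar>"
    using vf by (intro mult_left_mono G_lipschitz \<beta>) auto
  also have "\<dots> = \<bar>a * sqrt vp * (p - q)\<bar>"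
    using vf by (simp add: algebra_simps flip: diff_divide_distrib)
  also have "\<dots> = a * (sqrt vp * \<bar>p - q\<bar>)" using vp a by (simp add: abs_mult)
  also have "\<dots> \<le> 1 * (sqrt vp * \<bar>p - q\<bar>)" using a vp by (intro mult_right_mono) auto
  finally show ?thesis by simp
qed

lemma measurable_loss[measurable]: "loss \<in> borel_measurable borel"
proof (rule borel_measurable_continuous_onI)
  have "continuous_on UNIV (\<lambda>w. G w \<beta>)"
    by (auto intro!: DERIV_continuous_on has_field_derivative_at_within[OF DERIV_G])
  then show "continuous_on UNIV loss" unfolding loss_def[abs_def]
    by (auto intro!: continuous_intros continuous_on_compose2[of UNIV "\<lambda>w. G w \<beta>"] simp: vf[THEN less_imp_neq, symmetric])
qed

lemma loss_integrable: "integrable N loss" "integrable N (\<lambda>p. (loss p - loss 0)\<^sup>2)"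
proof -
  have "integrable N (\<lambda>p. loss p - loss 0)"
    by (rule Bochner_Integration.integrable_bound[where f="\<lambda>p. sqrt vp * \<bar>p\<bar>"])
       (use loss_lipschitz[of _ 0] vp in \<open>auto simp: abs_mult\<close>)
  then have "integrable N (\<lambda>p. (loss p - loss 0) + loss 0)" by (rule Bochner_Integration.integrable_add) simp
  then show "integrable N loss" by simp
  show "integrable N (\<lambda>p. (loss p - loss 0)\<^sup>2)"
  proof (rule Bochner_Integration.integrable_bound[where f="\<lambda>p. vp * p\<^sup>2"])
    have "(loss p - loss 0)\<^sup>2 \<le> (sqrt vp * \<bar>p\<bar>)\<^sup>2" for p
      using power_mono[OF loss_lipschitz[of p 0] abs_ge_zero, of 2] by simp
    then show "AE p in N. norm ((loss p - loss 0)\<^sup>2) \<le> norm (vp * p\<^sup>2)" using vp by (auto simp: power_mult_distrib)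
  qed auto
qed

lemma loss_variance: "(\<integral>p. (loss p - loss 0)\<^sup>2 \<partial>N) \<le> vp"
proof -
  have "(\<integral>p. (loss p - loss 0)\<^sup>2 \<partial>N) \<le> (\<integral>p. vp * p\<^sup>2 \<partial>N)"
  proof (rule integral_mono[OF loss_integrable(2)])
    fix p
    have "(loss p - loss 0)\<^sup>2 \<le> (sqrt vp * \<bar>p\<bar>)\<^sup>2"
      using power_mono[OF loss_lipschitz[of p 0] abs_ge_zero, of 2] by simp
    then show "(loss p - loss 0)\<^sup>2 \<le> vp * p\<^sup>2" using vp by (auto simp: power_mult_distrib)
  qed auto
  then show ?thesis by simp
qed

lemma loss_mean: "(\<integral>p. loss p \<partial>N) = \<sigma> * G \<mu> \<beta>"
proof -
  have "sqrt (vf + (a * sqrt vp)\<^sup>2) = \<sigma>" using vp by (simp add: \<sigma>_def power_mult_distrib)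
  then show ?thesis
    unfolding loss_def using G_convolution[OF vf \<beta>, of "\<sigma> * \<mu>" "a * sqrt vp"] \<sigma> by simp
qed

definition "err p = \<sigma> * That p - loss p"

text \<open>The mean of \<open>loss\<close> is \<sigma> G(\<mu>), so only the bias of
  \<open>T_hat\<close> is left in the mean of the error. With M <= 6 ln n the constants are 66 = 11
  * 6 and 96 = 2 * 8 * 6.\<close>

lemma err_estimates:
  "integrable N err" "\<bar>\<integral>p. err p \<partial>N\<bar> \<le> \<sigma> * (66 * ln (real n) * exp (- (g\<^sup>2 * ln (real n)) / 8))"
  "\<exists>m. integrable N (\<lambda>p. (err p - m)\<^sup>2) \<and> (\<integral>p. (err p - m)\<^sup>2 \<partial>N) \<le> (96 * \<sigma>\<^sup>2 + 2 * vp) * (ln (real n) * sqrt (real n))"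
proof -
  show I: "integrable N err" unfolding err_def[abs_def] using That_integrable loss_integrable by auto
  have "(\<integral>p. err p \<partial>N) = \<sigma> * ((\<integral>p. That p \<partial>N) - G \<mu> \<beta>)"
    unfolding err_def using That_integrable loss_integrable by (simp add: loss_mean right_diff_distrib)
  then have "\<bar>\<integral>p. err p \<partial>N\<bar> = \<sigma> * \<bar>(\<integral>p. That p \<partial>N) - G \<mu> \<beta>\<bar>" using \<sigma> by (simp add: abs_mult)
  also have "\<dots> \<le> \<sigma> * (11 * real M * exp (- (g\<^sup>2 * ln (real n)) / 8))"
    using \<sigma> by (intro mult_left_mono That_bias) auto
  also have "\<dots> \<le> \<sigma> * (11 * (6 * ln (real n)) * exp (- (g\<^sup>2 * ln (real n)) / 8))"
    using \<sigma> by (intro mult_left_mono mult_right_mono M_le) auto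
  finally show "\<bar>\<integral>p. err p \<partial>N\<bar> \<le> \<sigma> * (66 * ln (real n) * exp (- (g\<^sup>2 * ln (real n)) / 8))" by simp
  obtain m where m: "integrable N (\<lambda>p. (That p - m)\<^sup>2)" "(\<integral>p. (That p - m)\<^sup>2 \<partial>N) \<le> 8 * (real M * sqrt (real n))"
    using That_variance by blast
  let ?m = "\<sigma> * m - loss 0"
  let ?f = "\<lambda>p. 2 * \<sigma>\<^sup>2 * (That p - m)\<^sup>2 + 2 * (loss p - loss 0)\<^sup>2"
  have F: "integrable N ?f" using m loss_integrable by auto
  have le: "(err p - ?m)\<^sup>2 \<le> ?f p" for p
  proof -
    have eq: "err p - ?m = \<sigma> * (That p - m) - (loss p - loss 0)" by (simp add: err_def algebra_simps)
    have "(x - y)\<^sup>2 \<le> 2 * x\<^sup>2 + 2 * y\<^sup>2" for x y :: real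
      using zero_le_power2[of "x + y"] by (simp add: power2_eq_square algebra_simps)
    then have "(err p - ?m)\<^sup>2 \<le> 2 * (\<sigma> * (That p - m))\<^sup>2 + 2 * (loss p - loss 0)\<^sup>2" unfolding eq by blast
    then show ?thesis by (simp add: power_mult_distrib)
  qed
  have J: "integrable N (\<lambda>p. (err p - ?m)\<^sup>2)"
  proof (rule Bochner_Integration.integrable_bound[OF F])
    show "(\<lambda>p. (err p - ?m)\<^sup>2) \<in> borel_measurable N" using borel_measurable_integrable[OF I] by measurable
    show "AE p in N. norm ((err p - ?m)\<^sup>2) \<le> norm (?f p)" using le by (auto intro!: AE_I2 order_trans[OF _ abs_ge_self])
  qed
  have "(\<integral>p. (err p - ?m)\<^sup>2 \<partial>N) \<le> (\<integral>p. ?f p \<partial>N)" by (rule integral_mono[OF J F le])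
  also have "\<dots> = 2 * \<sigma>\<^sup>2 * (\<integral>p. (That p - m)\<^sup>2 \<partial>N) + 2 * (\<integral>p. (loss p - loss 0)\<^sup>2 \<partial>N)"
    using m loss_integrable by simp
  also have "\<dots> \<le> 2 * \<sigma>\<^sup>2 * (8 * (6 * ln (real n) * sqrt (real n))) + 2 * vp"
  proof (intro add_mono mult_left_mono loss_variance)
    have "real M * sqrt (real n) \<le> 6 * ln (real n) * sqrt (real n)" by (intro mult_right_mono M_le) auto
    then show "(\<integral>p. (That p - m)\<^sup>2 \<partial>N) \<le> 8 * (6 * ln (real n) * sqrt (real n))" using m(2) by linarith
  qed auto
  also have "\<dots> \<le> (96 * \<sigma>\<^sup>2 + 2 * vp) * (ln (real n) * sqrt (real n))"
  proof -
    have "1 * 1 \<le> ln (real n) * sqrt (real n)" using ln_n n by (intro mult_mono) auto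
    then have "2 * vp * 1 \<le> 2 * vp * (ln (real n) * sqrt (real n))" using vp by (intro mult_left_mono) auto
    then show ?thesis by (simp add: algebra_simps)
  qed
  finally show "\<exists>m. integrable N (\<lambda>p. (err p - m)\<^sup>2) \<and> (\<integral>p. (err p - m)\<^sup>2 \<partial>N) \<le> (96 * \<sigma>\<^sup>2 + 2 * vp) * (ln (real n) * sqrt (real n))"
    using J by blast
qed

end

section \<open>Sums over independent coordinates\<close>

lemma (in product_prob_space) PiM_component_integral:
  fixes f :: "'a \<Rightarrow> real"
  assumes i: "i \<in> I" and f: "integrable (M i) f"
  shows "integrable (PiM I M) (\<lambda>x. f (x i))" "(\<integral>x. f (x i) \<partial>PiM I M) = (\<integral>y. f y \<partial>M i)"
proof -
  have [measurable]: "(\<lambda>x. x i) \<in> PiM I M \<rightarrow>\<^sub>M M i" using i by measurable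
  have [measurable]: "f \<in> borel_measurable (M i)" using f by auto
  have d: "distr (PiM I M) (M i) (\<lambda>x. x i) = M i" by (rule PiM_component[OF i])
  show "integrable (PiM I M) (\<lambda>x. f (x i))"
    by (rule integrable_distr[where M'="M i" and f=f and T="\<lambda>x. x i"]) (use f in \<open>auto simp: d\<close>)
  show "(\<integral>x. f (x i) \<partial>PiM I M) = (\<integral>y. f y \<partial>M i)"
    using integral_distr[of "\<lambda>x. x i" "PiM I M" "M i" f] by (simp add: d)
qed

lemma (in product_prob_space) PiM_product_integral:
  fixes f g :: "'a \<Rightarrow> real"
  assumes I: "finite I" "i \<in> I" "j \<in> I" "i \<noteq> j" and f: "integrable (M i) f" and g: "integrable (M j) g"
  shows "integrable (PiM I M) (\<lambda>x. f (x i) * g (x j))"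
    and "(\<integral>x. f (x i) * g (x j) \<partial>PiM I M) = (\<integral>y. f y \<partial>M i) * (\<integral>y. g y \<partial>M j)"
proof -
  define F where "F k = (if k = i then f else if k = j then g else (\<lambda>_. 1))" for k
  have split: "(\<Prod>k\<in>I. h k) = h i * h j" if "\<And>k. k \<in> I - {i, j} \<Longrightarrow> h k = 1" for h :: "'i \<Rightarrow> real"
  proof -
    have "(\<Prod>k\<in>I. h k) = h i * (h j * (\<Prod>k\<in>I - {i} - {j}. h k))"
      using I by (subst prod.remove[of I i], simp, simp, subst prod.remove[of "I - {i}" j]) auto
    also have "(\<Prod>k\<in>I - {i} - {j}. h k) = 1" using that by (intro prod.neutral) auto
    finally show ?thesis by simp
  qed
  have 1: "(\<Prod>k\<in>I. F k (x k)) = f (x i) * g (x j)" for x using I by (subst split) (auto simp: F_def)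
  have J: "integrable (M k) (F k)" if "k \<in> I" for k using f g by (auto simp: F_def)
  show "integrable (PiM I M) (\<lambda>x. f (x i) * g (x j))"
    using product_integrable_prod[OF I(1) J] unfolding 1 .
  have "(\<integral>x. f (x i) * g (x j) \<partial>PiM I M) = (\<Prod>k\<in>I. integral\<^sup>L (M k) (F k))"
    using product_integral_prod[OF I(1) J] unfolding 1 .
  also have "\<dots> = integral\<^sup>L (M i) f * integral\<^sup>L (M j) g"
    using I by (subst split) (auto simp: F_def M.prob_space)
  finally show "(\<integral>x. f (x i) * g (x j) \<partial>PiM I M) = (\<integral>y. f y \<partial>M i) * (\<integral>y. g y \<partial>M j)" .
qed

lemma (in product_prob_space) PiM_sum_second_moment:
  fixes f :: "'i \<Rightarrow> 'a \<Rightarrow> real"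
  assumes I: "finite I"
    and f: "\<And>i. i \<in> I \<Longrightarrow> integrable (M i) (f i)" "\<And>i. i \<in> I \<Longrightarrow> integrable (M i) (\<lambda>y. (f i y)\<^sup>2)"
      "\<And>i. i \<in> I \<Longrightarrow> (\<integral>y. f i y \<partial>M i) = 0"
  shows "integrable (PiM I M) (\<lambda>x. (\<Sum>i\<in>I. f i (x i))\<^sup>2)"
    and "(\<integral>x. (\<Sum>i\<in>I. f i (x i))\<^sup>2 \<partial>PiM I M) = (\<Sum>i\<in>I. \<integral>y. (f i y)\<^sup>2 \<partial>M i)"
proof -
  have ij: "integrable (PiM I M) (\<lambda>x. f i (x i) * f j (x j))
      \<and> (\<integral>x. f i (x i) * f j (x j) \<partial>PiM I M) = (if j = i then \<integral>y. (f i y)\<^sup>2 \<partial>M i else 0)"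
    if "i \<in> I" "j \<in> I" for i j
  proof (cases "j = i")
    case True
    then show ?thesis using PiM_component_integral[OF that(1) f(2)[OF that(1)]] by (simp add: power2_eq_square)
  next
    case False
    then show ?thesis using PiM_product_integral[OF I that(1,2) _ f(1)[OF that(1)] f(1)[OF that(2)]] f(3) that by auto
  qed
  have sq: "(\<Sum>i\<in>I. f i (x i))\<^sup>2 = (\<Sum>i\<in>I. \<Sum>j\<in>I. f i (x i) * f j (x j))" for x
    by (simp add: power2_eq_square sum_product)
  show "integrable (PiM I M) (\<lambda>x. (\<Sum>i\<in>I. f i (x i))\<^sup>2)"
    unfolding sq using ij by (intro Bochner_Integration.integrable_sum) auto
  have "(\<integral>x. (\<Sum>i\<in>I. f i (x i))\<^sup>2 \<partial>PiM I M) = (\<Sum>i\<in>I. \<integral>x. (\<Sum>j\<in>I. f i (x i) * f j (x j)) \<partial>PiM I M)"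
    unfolding sq using ij by (intro Bochner_Integration.integral_sum Bochner_Integration.integrable_sum) auto
  also have "\<dots> = (\<Sum>i\<in>I. \<Sum>j\<in>I. \<integral>x. f i (x i) * f j (x j) \<partial>PiM I M)"
    using ij by (intro sum.cong refl Bochner_Integration.integral_sum) auto
  also have "\<dots> = (\<Sum>i\<in>I. \<Sum>j\<in>I. if j = i then \<integral>y. (f i y)\<^sup>2 \<partial>M i else 0)"
    using ij by (intro sum.cong refl) blast
  also have "\<dots> = (\<Sum>i\<in>I. \<integral>y. (f i y)\<^sup>2 \<partial>M i)" using I by simp
  finally show "(\<integral>x. (\<Sum>i\<in>I. f i (x i))\<^sup>2 \<partial>PiM I M) = (\<Sum>i\<in>I. \<integral>y. (f i y)\<^sup>2 \<partial>M i)" .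
qed

lemma (in prob_space) variance_le_second_moment_about:
  fixes X :: "'a \<Rightarrow> real"
  assumes X: "integrable M X" and m: "integrable M (\<lambda>x. (X x - m)\<^sup>2)"
  shows "integrable M (\<lambda>x. (X x - expectation X)\<^sup>2)" "variance X \<le> expectation (\<lambda>x. (X x - m)\<^sup>2)"
proof -
  have eq: "(X x - expectation X)\<^sup>2 = (X x - m)\<^sup>2 + 2 * (m - expectation X) * X x + ((expectation X)\<^sup>2 - m\<^sup>2)" for x
    by (simp add: power2_eq_square algebra_simps)
  show "integrable M (\<lambda>x. (X x - expectation X)\<^sup>2)" unfolding eq using X m by simp
  have "variance X = expectation (\<lambda>x. (X x - m)\<^sup>2) + 2 * (m - expectation X) * expectation X + ((expectation X)\<^sup>2 - m\<^sup>2)"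
    unfolding eq using X m by (simp add: prob_space)
  also have "\<dots> = expectation (\<lambda>x. (X x - m)\<^sup>2) - (m - expectation X)\<^sup>2"
    by (simp add: power2_eq_square algebra_simps)
  finally show "variance X \<le> expectation (\<lambda>x. (X x - m)\<^sup>2)" by simp
qed

lemma (in prob_space) abs_mean_le_sqrt:
  fixes X :: "'a \<Rightarrow> real"
  assumes X: "integrable M X" and X2: "integrable M (\<lambda>x. (X x)\<^sup>2)"
  shows "expectation (\<lambda>x. \<bar>X x\<bar>) \<le> sqrt (expectation (\<lambda>x. (X x)\<^sup>2))"
proof (rule real_le_rsqrt)
  have "0 \<le> variance (\<lambda>x. \<bar>X x\<bar>)" by (rule variance_positive)
  then show "(expectation (\<lambda>x. \<bar>X x\<bar>))\<^sup>2 \<le> expectation (\<lambda>x. (X x)\<^sup>2)"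
    using variance_eq[of "\<lambda>x. \<bar>X x\<bar>"] X X2 by simp
qed

text \<open>The centred sum is controlled in mean square, where independence lets the variances add;
  the means are added in absolute value. The centre m of each second moment is arbitrary, since it
  bounds the variance in any case.\<close>

lemma (in product_prob_space) PiM_sum_abs_mean_le:
  fixes f :: "'i \<Rightarrow> 'a \<Rightarrow> real"
  assumes I: "finite I" and f: "\<And>i. i \<in> I \<Longrightarrow> integrable (M i) (f i)"
    and V: "\<And>i. i \<in> I \<Longrightarrow> \<exists>m. integrable (M i) (\<lambda>y. (f i y - m)\<^sup>2) \<and> (\<integral>y. (f i y - m)\<^sup>2 \<partial>M i) \<le> V"
    and B: "\<And>i. i \<in> I \<Longrightarrow> \<bar>\<integral>y. f i y \<partial>M i\<bar> \<le> B"
  shows "integrable (PiM I M) (\<lambda>x. \<Sum>i\<in>I. f i (x i))"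
    and "(\<integral>x. \<bar>\<Sum>i\<in>I. f i (x i)\<bar> \<partial>PiM I M) \<le> sqrt (real (card I) * V) + real (card I) * B"
proof -
  define g where "g i y = f i y - (\<integral>y. f i y \<partial>M i)" for i y
  have g: "integrable (M i) (g i)" "integrable (M i) (\<lambda>y. (g i y)\<^sup>2)" "(\<integral>y. g i y \<partial>M i) = 0"
    "(\<integral>y. (g i y)\<^sup>2 \<partial>M i) \<le> V" if i: "i \<in> I" for i
  proof -
    obtain m where m: "integrable (M i) (\<lambda>y. (f i y - m)\<^sup>2)" "(\<integral>y. (f i y - m)\<^sup>2 \<partial>M i) \<le> V" using V[OF i] by blast
    note v = M.variance_le_second_moment_about[OF f[OF i] m(1)]
    show "integrable (M i) (g i)" "integrable (M i) (\<lambda>y. (g i y)\<^sup>2)" "(\<integral>y. g i y \<partial>M i) = 0" "(\<integral>y. (g i y)\<^sup>2 \<partial>M i) \<le> V"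
      using f[OF i] v m(2) by (auto simp: g_def[abs_def] M.prob_space)
  qed
  have Ig: "integrable (PiM I M) (\<lambda>x. \<Sum>i\<in>I. g i (x i))"
    using PiM_component_integral(1) g(1) by (intro Bochner_Integration.integrable_sum) auto
  show If: "integrable (PiM I M) (\<lambda>x. \<Sum>i\<in>I. f i (x i))"
    using PiM_component_integral(1) f by (intro Bochner_Integration.integrable_sum) auto
  have le: "\<bar>\<Sum>i\<in>I. f i (x i)\<bar> \<le> \<bar>\<Sum>i\<in>I. g i (x i)\<bar> + real (card I) * B" for x
  proof -
    have "(\<Sum>i\<in>I. f i (x i)) = (\<Sum>i\<in>I. g i (x i)) + (\<Sum>i\<in>I. \<integral>y. f i y \<partial>M i)"
      by (simp add: g_def sum_subtractf)
    moreover have "\<bar>\<Sum>i\<in>I. \<integral>y. f i y \<partial>M i\<bar> \<le> real (card I) * B"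
      by (rule order_trans[OF sum_abs sum_bounded_above]) (rule B)
    ultimately show ?thesis by linarith
  qed
  have "(\<integral>x. \<bar>\<Sum>i\<in>I. f i (x i)\<bar> \<partial>PiM I M) \<le> (\<integral>x. \<bar>\<Sum>i\<in>I. g i (x i)\<bar> + real (card I) * B \<partial>PiM I M)"
    using If Ig le by (intro integral_mono) auto
  also have "\<dots> = (\<integral>x. \<bar>\<Sum>i\<in>I. g i (x i)\<bar> \<partial>PiM I M) + real (card I) * B"
    using Ig by (simp add: P.prob_space)
  also have "(\<integral>x. \<bar>\<Sum>i\<in>I. g i (x i)\<bar> \<partial>PiM I M) \<le> sqrt (\<integral>x. (\<Sum>i\<in>I. g i (x i))\<^sup>2 \<partial>PiM I M)"
    by (intro P.abs_mean_le_sqrt Ig PiM_sum_second_moment(1) I g)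
  also have "(\<integral>x. (\<Sum>i\<in>I. g i (x i))\<^sup>2 \<partial>PiM I M) = (\<Sum>i\<in>I. \<integral>y. (g i y)\<^sup>2 \<partial>M i)"
    by (intro PiM_sum_second_moment(2) I g)
  also have "sqrt (\<Sum>i\<in>I. \<integral>y. (g i y)\<^sup>2 \<partial>M i) \<le> sqrt (real (card I) * V)"
    using sum_bounded_above[of I "\<lambda>i. \<integral>y. (g i y)\<^sup>2 \<partial>M i" V] g(4) by simp
  finally show "(\<integral>x. \<bar>\<Sum>i\<in>I. f i (x i)\<bar> \<partial>PiM I M) \<le> sqrt (real (card I) * V) + real (card I) * B"
    by simp
qed

section \<open>The error of one coordinate under its own normal law\<close>

lemma normal_law_eq_distr:
  assumes "0 < \<sigma>" shows "density lborel (normal_density m \<sigma>) = distr N borel (\<lambda>p. m + \<sigma> * p)"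
proof -
  have "distributed N lborel (\<lambda>x. x) phi" by (simp add: distributed_def distr_id2)
  from N.normal_density_affine[OF this, of \<sigma> m]
  have "distributed N lborel (\<lambda>x. m + \<sigma> * x) (normal_density m \<sigma>)" using assms by simp
  then have "distr N lborel (\<lambda>x. m + \<sigma> * x) = density lborel (normal_density m \<sigma>)" by (simp add: distributed_def)
  moreover have "distr N lborel (\<lambda>x. m + \<sigma> * x) = distr N borel (\<lambda>x. m + \<sigma> * x)" by (intro distr_cong) auto
  ultimately show ?thesis by simp
qed

lemma normal_law_integral:
  fixes f :: "real \<Rightarrow> real"
  assumes \<sigma>: "0 < \<sigma>" and f: "integrable N (\<lambda>p. f (m + \<sigma> * p))"
  shows "integrable (density lborel (normal_density m \<sigma>)) f"
    and "(\<integral>y. f y \<partial>density lborel (normal_density m \<sigma>)) = (\<integral>p. f (m + \<sigma> * p) \<partial>N)"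
proof -
  \<comment> \<open>Measurability of f is recovered from that of p -> f(m + \<sigma> p) by composing
    with the inverse affine map.\<close>
  have "(\<lambda>y. f (m + \<sigma> * ((y - m) / \<sigma>))) \<in> borel_measurable borel"
    using borel_measurable_integrable[OF f] by measurable
  then have [measurable]: "f \<in> borel_measurable borel" using \<sigma> by simp
  show "integrable (density lborel (normal_density m \<sigma>)) f"
    unfolding normal_law_eq_distr[OF \<sigma>] using f by (subst integrable_distr_eq) auto
  show "(\<integral>y. f y \<partial>density lborel (normal_density m \<sigma>)) = (\<integral>p. f (m + \<sigma> * p) \<partial>N)"
    unfolding normal_law_eq_distr[OF \<sigma>] by (subst integral_distr) auto
qed

text \<open>Passes to the uniform constants B, v and g0; \<theta>, \<eta> and \<tau> do not occur in
  the bounds. From \<sigma>^2 <= 2 v and vp <= v comes 194 = 2 * 96 + 2.\<close>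

lemma (in coordinate_at) coordinate_error:
  fixes b h B v g0 :: real
  assumes bh: "\<beta> = btilde b h" "0 < b + h" "b + h \<le> B" and v: "vp \<le> v" "vf \<le> v" and g0: "0 < g0" "g0 \<le> g"
  defines "Q \<equiv> density lborel (normal_density \<theta> (sqrt vp))"
    and "D \<equiv> \<lambda>y. (b + h) * sqrt (vf + vp * (alpha vp (ennreal \<tau>))\<^sup>2) * T_hat n (btilde b h) vp vf g (y - \<eta>) \<tau>
        - coord_loss b h vf \<theta> (coord_predictor b h vp vf \<eta> (ennreal \<tau>) y)"
  shows "integrable Q D"
    and "\<bar>\<integral>y. D y \<partial>Q\<bar> \<le> B * sqrt (2 * v) * (66 * ln (real n) * exp (- (g0\<^sup>2 * ln (real n)) / 8))"
    and "\<exists>m. integrable Q (\<lambda>y. (D y - m)\<^sup>2) \<and> (\<integral>y. (D y - m)\<^sup>2 \<partial>Q) \<le> 194 * B\<^sup>2 * v * (ln (real n) * sqrt (real n))"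
proof -
  have svp: "0 < sqrt vp" using vp by simp
  have D: "D (\<theta> + sqrt vp * p) = (b + h) * err p" for p
  proof -
    have "sqrt (vf + vp * (alpha vp (ennreal \<tau>))\<^sup>2) = \<sigma>" by (simp add: \<sigma>_def a_def mult.commute)
    moreover have "coord_loss b h vf \<theta> (coord_predictor b h vp vf \<eta> (ennreal \<tau>) (\<theta> + sqrt vp * p)) = (b + h) * loss p"
      using loss_eq[of p] by (auto simp: coord_loss_def coord_predictor_def loss_def a_def[symmetric] bh(1)[symmetric])
    ultimately show ?thesis by (simp add: D_def err_def bh(1)[symmetric] algebra_simps)
  qed
  have \<sigma>2: "\<sigma>\<^sup>2 \<le> 2 * v"
  proof -
    have "a\<^sup>2 * vp \<le> 1 * vp" using a vp by (intro mult_right_mono) (auto simp: power_le_one)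
    then show ?thesis using \<sigma>(3) v by simp
  qed
  have \<sigma>v: "\<sigma> \<le> sqrt (2 * v)" using \<sigma>2 by (simp add: real_le_rsqrt)
  have L: "1 \<le> ln (real n)" by (rule ln_n)
  have I: "integrable N (\<lambda>p. D (\<theta> + sqrt vp * p))" unfolding D using err_estimates(1) by simp
  show "integrable Q D" unfolding Q_def by (rule normal_law_integral(1)[OF svp I])
  have "(\<integral>y. D y \<partial>Q) = (b + h) * (\<integral>p. err p \<partial>N)"
    unfolding Q_def normal_law_integral(2)[OF svp I] D by simp
  then have "\<bar>\<integral>y. D y \<partial>Q\<bar> = (b + h) * \<bar>\<integral>p. err p \<partial>N\<bar>" using bh by (simp add: abs_mult)
  also have "\<dots> \<le> B * (\<sigma> * (66 * ln (real n) * exp (- (g\<^sup>2 * ln (real n)) / 8)))"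
    using bh by (intro mult_mono err_estimates(2)) auto
  also have "\<dots> \<le> B * (sqrt (2 * v) * (66 * ln (real n) * exp (- (g0\<^sup>2 * ln (real n)) / 8)))"
  proof -
    have "g0\<^sup>2 \<le> g\<^sup>2" using g0 by (intro power_mono) auto
    then have "g0\<^sup>2 * ln (real n) \<le> g\<^sup>2 * ln (real n)" using L by (intro mult_right_mono) auto
    then have "exp (- (g\<^sup>2 * ln (real n)) / 8) \<le> exp (- (g0\<^sup>2 * ln (real n)) / 8)" by simp
    then show ?thesis using \<sigma>v bh L \<sigma>(1) v vp by (intro mult_left_mono mult_mono) auto
  qed
  finally show "\<bar>\<integral>y. D y \<partial>Q\<bar> \<le> B * sqrt (2 * v) * (66 * ln (real n) * exp (- (g0\<^sup>2 * ln (real n)) / 8))"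
    by (simp only: mult.assoc)
  obtain m where m: "integrable N (\<lambda>p. (err p - m)\<^sup>2)"
    "(\<integral>p. (err p - m)\<^sup>2 \<partial>N) \<le> (96 * \<sigma>\<^sup>2 + 2 * vp) * (ln (real n) * sqrt (real n))" using err_estimates(3) by blast
  let ?m = "(b + h) * m"
  have Dm: "(D (\<theta> + sqrt vp * p) - ?m)\<^sup>2 = (b + h)\<^sup>2 * (err p - m)\<^sup>2" for p
    unfolding D by (simp add: power_mult_distrib flip: right_diff_distrib)
  have J: "integrable N (\<lambda>p. (D (\<theta> + sqrt vp * p) - ?m)\<^sup>2)" unfolding Dm using m by simp
  have "(\<integral>y. (D y - ?m)\<^sup>2 \<partial>Q) = (b + h)\<^sup>2 * (\<integral>p. (err p - m)\<^sup>2 \<partial>N)"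
    unfolding Q_def normal_law_integral(2)[OF svp J] Dm by simp
  also have "\<dots> \<le> B\<^sup>2 * ((96 * \<sigma>\<^sup>2 + 2 * vp) * (ln (real n) * sqrt (real n)))"
    using bh by (intro mult_mono m(2) power_mono) auto
  also have "\<dots> \<le> B\<^sup>2 * ((194 * v) * (ln (real n) * sqrt (real n)))"
    using \<sigma>2 v L by (intro mult_left_mono mult_right_mono) auto
  also have "\<dots> = 194 * B\<^sup>2 * v * (ln (real n) * sqrt (real n))" by simp
  finally show "\<exists>m. integrable Q (\<lambda>y. (D y - m)\<^sup>2) \<and> (\<integral>y. (D y - m)\<^sup>2 \<partial>Q) \<le> 194 * B\<^sup>2 * v * (ln (real n) * sqrt (real n))"
    using normal_law_integral(1)[OF svp J] unfolding Q_def by blast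
qed

text \<open>The suprema and infima of the assumptions as real constants valid for all i >= 1. The
  size of \<theta> enters only later, through a bound M0 on its mean absolute value.\<close>

locale bounded_model =
  fixes b h \<nu>p \<nu>f \<gamma> \<theta> :: "nat \<Rightarrow> real" and B v0 v g0 q0 bl bu :: real
  assumes pos: "\<And>i. 1 \<le> i \<Longrightarrow> 0 < b i \<and> 0 < h i \<and> 0 < \<nu>p i \<and> 0 < \<nu>f i"
    and B: "\<And>i. 1 \<le> i \<Longrightarrow> b i + h i \<le> B"
    and v0: "0 < v0" "\<And>i. 1 \<le> i \<Longrightarrow> v0 \<le> \<nu>p i"
    and v: "\<And>i. 1 \<le> i \<Longrightarrow> \<nu>p i \<le> v" "\<And>i. 1 \<le> i \<Longrightarrow> \<nu>f i \<le> v"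
    and ratio: "\<And>i. 1 \<le> i \<Longrightarrow> \<nu>p i \<le> \<nu>f i"
    and g0: "0 < g0" "\<And>i. 1 \<le> i \<Longrightarrow> g0 \<le> \<gamma> i" "\<And>i. 1 \<le> i \<Longrightarrow> \<gamma> i + sqrt (\<nu>p i / \<nu>f i) < 1 / sqrt (4 * exp 1)"
    and q0: "\<And>i. 1 \<le> i \<Longrightarrow> \<bar>Phi_inv (btilde (b i) (h i))\<bar> \<le> q0"
    and bl: "0 < bl" "\<And>i. 1 \<le> i \<Longrightarrow> bl \<le> btilde (b i) (h i)"
    and bu: "bu < 1" "\<And>i. 1 \<le> i \<Longrightarrow> btilde (b i) (h i) \<le> bu"
begin

abbreviation "P n \<equiv> data_law n \<nu>p \<theta>"
abbreviation "L n \<eta> \<tau> x \<equiv> avg_loss n b h \<nu>f \<theta> (predictor b h \<nu>p \<nu>f \<eta> \<tau> x)"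
abbreviation "A n \<eta> \<tau> x \<equiv> ARE_D n b h \<nu>p \<nu>f \<gamma> x \<eta> \<tau>"

text \<open>Standard deviation plus bias of an average of n independent coordinate errors, of orders
  n^(-1/4) (ln n)^(1/2) and n^(- g0^2/8) ln n.\<close>

definition rate :: "nat \<Rightarrow> real" where
  "rate n = sqrt (real n * (194 * B\<^sup>2 * v * (ln (real n) * sqrt (real n)))) / real n
     + B * sqrt (2 * v) * (66 * ln (real n) * exp (- (g0\<^sup>2 * ln (real n)) / 8))"

text \<open>\<open>data_law\<close> as a product of probability measures over all indices; the coordinates outside
  \<open>{1..n}\<close> do not matter.\<close>

definition law :: "nat \<Rightarrow> nat \<Rightarrow> real measure" where
  "law n i = density lborel (normal_density (\<theta> i) (if i \<in> {1..n} then sqrt (\<nu>p i) else 1))"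

lemma product_law: "product_prob_space (law n)"
proof -
  have *: "prob_space (law n i)" for i
    unfolding law_def using pos by (intro prob_space_normal_density) auto
  then show ?thesis
    by (intro product_prob_space.intro product_prob_space_axioms.intro product_sigma_finite.intro)
       (auto intro: prob_space_imp_sigma_finite)
qed

lemma P_eq: "P n = PiM {1..n} (law n)"
  unfolding data_law_def law_def by (intro PiM_cong) auto

text \<open>Here \<eta> and \<tau> are fixed numbers, so each summand is a function of a single
  coordinate and the summands are independent.\<close>

lemma ARE_error:
  assumes n: "3 \<le> n" and \<tau>: "0 \<le> \<tau>"
  shows "integrable (P n) (\<lambda>x. A n \<eta> \<tau> x - L n \<eta> (ennreal \<tau>) x)"
    and "(\<integral>x. \<bar>A n \<eta> \<tau> x - L n \<eta> (ennreal \<tau>) x\<bar> \<partial>P n) \<le> rate n"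
proof -
  interpret product_prob_space "law n" "{1..n}" by (rule product_law)
  define D where "D i y = (b i + h i) * sqrt (\<nu>f i + \<nu>p i * (alpha (\<nu>p i) (ennreal \<tau>))\<^sup>2) * T_hat n (btilde (b i) (h i)) (\<nu>p i) (\<nu>f i) (\<gamma> i) (y - \<eta>) \<tau>
        - coord_loss (b i) (h i) (\<nu>f i) (\<theta> i) (coord_predictor (b i) (h i) (\<nu>p i) (\<nu>f i) \<eta> (ennreal \<tau>) y)" for i y
  let ?V = "194 * B\<^sup>2 * v * (ln (real n) * sqrt (real n))"
  let ?b = "B * sqrt (2 * v) * (66 * ln (real n) * exp (- (g0\<^sup>2 * ln (real n)) / 8))"
  have D: "integrable (law n i) (D i)" "\<bar>\<integral>y. D i y \<partial>law n i\<bar> \<le> ?b"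
    "\<exists>m. integrable (law n i) (\<lambda>y. (D i y - m)\<^sup>2) \<and> (\<integral>y. (D i y - m)\<^sup>2 \<partial>law n i) \<le> ?V" if i: "i \<in> {1..n}" for i
  proof -
    have i1: "1 \<le> i" using i by simp
    have "0 < bl" "bl \<le> btilde (b i) (h i)" "btilde (b i) (h i) \<le> bu" "bu < 1" using bl bu i1 by auto
    moreover have "0 < \<gamma> i" using g0(1,2) i1 by (meson less_le_trans)
    ultimately interpret coordinate_at "\<nu>p i" "\<nu>f i" "\<gamma> i" "btilde (b i) (h i)" n \<tau> \<eta> "\<theta> i"
      using pos[OF i1] g0(3)[OF i1] n \<tau> by unfold_locales auto
    have law: "law n i = density lborel (normal_density (\<theta> i) (sqrt (\<nu>p i)))" using i by (simp add: law_def)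
    have "0 < b i + h i" using pos[OF i1] by simp
    note e = coordinate_error[OF refl this B[OF i1] v(1)[OF i1] v(2)[OF i1] g0(1) g0(2)[OF i1]]
    show "integrable (law n i) (D i)" "\<bar>\<integral>y. D i y \<partial>law n i\<bar> \<le> ?b"
      "\<exists>m. integrable (law n i) (\<lambda>y. (D i y - m)\<^sup>2) \<and> (\<integral>y. (D i y - m)\<^sup>2 \<partial>law n i) \<le> ?V"
      unfolding law D_def[abs_def] by (rule e)+
  qed
  have eq: "A n \<eta> \<tau> x - L n \<eta> (ennreal \<tau>) x = (\<Sum>i\<in>{1..n}. D i (x i)) / real n" for x
    by (simp add: ARE_D_def avg_loss_def predictor_def D_def sum_subtractf diff_divide_distrib)
  note S = PiM_sum_abs_mean_le[of D, OF _ D(1) D(3) D(2), simplified card_atLeastAtMost]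
  show "integrable (P n) (\<lambda>x. A n \<eta> \<tau> x - L n \<eta> (ennreal \<tau>) x)"
    unfolding eq P_eq using S(1) by simp
  have "(\<integral>x. \<bar>A n \<eta> \<tau> x - L n \<eta> (ennreal \<tau>) x\<bar> \<partial>P n) = (\<integral>x. \<bar>\<Sum>i\<in>{1..n}. D i (x i)\<bar> \<partial>PiM {1..n} (law n)) / real n"
    unfolding eq P_eq by (simp add: abs_divide)
  also have "\<dots> \<le> (sqrt (real n * ?V) + real n * ?b) / real n"
    using S(2) by (intro divide_right_mono) auto
  also have "\<dots> = rate n" using n by (simp add: rate_def add_divide_distrib)
  finally show "(\<integral>x. \<bar>A n \<eta> \<tau> x - L n \<eta> (ennreal \<tau>) x\<bar> \<partial>P n) \<le> rate n" .
qed

end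

section \<open>Empirical quantiles and grids\<close>

text \<open>The empirical distribution function is right-continuous, so the infimum is attained and
  the quantile is its lower adjoint. Monotonicity, bounds and measurability of the quantiles are all
  drawn from this equivalence.\<close>

lemma emp_quantile_le_iff:
  assumes n: "1 \<le> n" and \<beta>: "0 < \<beta>" "\<beta> \<le> 1"
  shows "emp_quantile n x \<beta> \<le> t \<longleftrightarrow> \<beta> \<le> real (card {i\<in>{1..n}. x i \<le> t}) / real n"
proof -
  let ?F = "\<lambda>t. real (card {i\<in>{1..n}. x i \<le> t}) / real n"
  let ?A = "{t. \<beta> \<le> ?F t}"
  define lo where "lo = Min (x ` {1..n})"
  define hi where "hi = Max (x ` {1..n})"
  have lohi: "lo \<le> x i" "x i \<le> hi" if "i \<in> {1..n}" for i using that by (auto simp: lo_def hi_def)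
  have bdd: "bdd_below ?A"
  proof (rule bdd_belowI[of _ lo])
    fix t assume "t \<in> ?A"
    have "{i\<in>{1..n}. x i \<le> t} \<noteq> {}"
    proof
      assume "{i\<in>{1..n}. x i \<le> t} = {}"
      then have "?F t = 0" by (simp only: card.empty)
      moreover have "\<beta> \<le> ?F t" using \<open>t \<in> ?A\<close> by (rule CollectD)
      ultimately show False using \<beta> by linarith
    qed
    then show "lo \<le> t" using lohi(1) by force
  qed
  have "{i\<in>{1..n}. x i \<le> hi} = {1..n}" using lohi(2) by auto
  then have "hi \<in> ?A" using \<beta> n by simp
  then have ne: "?A \<noteq> {}" by blast
  show ?thesis
  proof
    assume "\<beta> \<le> ?F t"
    then show "emp_quantile n x \<beta> \<le> t" unfolding emp_quantile_def using bdd by (intro cInf_lower) auto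
  next
    assume le: "emp_quantile n x \<beta> \<le> t"
    show "\<beta> \<le> ?F t"
    proof (rule ccontr)
      assume not: "\<not> \<beta> \<le> ?F t"
      let ?U = "{x i | i. i \<in> {1..n} \<and> t < x i}"
      \<comment> \<open>The next data point above t, or t + 1 if there is none. The empirical
        distribution function is constant on [t, e), so e is a lower bound of the set when t is not
        in it.\<close>
      define e where "e = (if ?U = {} then t + 1 else Min ?U)"
      have fin: "finite ?U" by simp
      have e: "t < e" "\<And>i. i \<in> {1..n} \<Longrightarrow> x i < e \<Longrightarrow> x i \<le> t"
      proof -
        show "t < e" using Min_in[OF fin] by (auto simp: e_def)
        fix i assume i: "i \<in> {1..n}" "x i < e"
        show "x i \<le> t"
        proof (rule ccontr)
          assume "\<not> x i \<le> t"
          then have "x i \<in> ?U" using i by auto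
          then have "e \<le> x i" using fin by (auto simp: e_def)
          then show False using i by simp
        qed
      qed
      have "e \<le> s" if "s \<in> ?A" for s
      proof (rule ccontr)
        assume "\<not> e \<le> s"
        then have "{i\<in>{1..n}. x i \<le> s} \<subseteq> {i\<in>{1..n}. x i \<le> t}" using e(2) by force
        then have "?F s \<le> ?F t" by (intro divide_right_mono of_nat_mono card_mono) auto
        then show False using that not by simp
      qed
      then have "e \<le> emp_quantile n x \<beta>" unfolding emp_quantile_def by (intro cInf_greatest ne) auto
      then show False using le e(1) by simp
    qed
  qed
qed

lemma emp_quantile_mono:
  assumes "1 \<le> n" "0 < \<beta>" "\<beta> \<le> \<beta>'" "\<beta>' \<le> 1"
  shows "emp_quantile n x \<beta> \<le> emp_quantile n x \<beta>'"
proof -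
  have "\<beta>' \<le> real (card {i\<in>{1..n}. x i \<le> emp_quantile n x \<beta>'}) / real n"
    using emp_quantile_le_iff[of n \<beta>' x "emp_quantile n x \<beta>'"] assms by auto
  then show ?thesis using emp_quantile_le_iff[of n \<beta> x "emp_quantile n x \<beta>'"] assms by auto
qed

text \<open>Markov's inequality for the empirical distribution.\<close>

lemma card_large_le:
  fixes x :: "nat \<Rightarrow> real" assumes "0 \<le> t"
  shows "real (card {i\<in>{1..n}. t \<le> \<bar>x i\<bar>}) * t \<le> (\<Sum>i=1..n. \<bar>x i\<bar>)"
proof -
  have "real (card {i\<in>{1..n}. t \<le> \<bar>x i\<bar>}) * t = (\<Sum>i\<in>{i\<in>{1..n}. t \<le> \<bar>x i\<bar>}. t)" by simp
  also have "\<dots> \<le> (\<Sum>i\<in>{i\<in>{1..n}. t \<le> \<bar>x i\<bar>}. \<bar>x i\<bar>)" by (intro sum_mono) auto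
  also have "\<dots> \<le> (\<Sum>i=1..n. \<bar>x i\<bar>)" by (intro sum_mono2) auto
  finally show ?thesis .
qed

definition abs_mean :: "nat \<Rightarrow> (nat \<Rightarrow> real) \<Rightarrow> real" where
  "abs_mean n x = (\<Sum>i=1..n. \<bar>x i\<bar>) / real n"

lemma abs_mean_nonneg: "0 \<le> abs_mean n x"
  by (auto simp: abs_mean_def intro!: divide_nonneg_nonneg sum_nonneg)

text \<open>Markov's inequality limits the fraction of large |x_i|. The summand 1 makes it strict,
  as the lower bound requires, also when all x_i vanish.\<close>

lemma emp_quantile_bounds:
  assumes n: "1 \<le> n" and \<beta>: "0 < \<beta>" "\<beta> < 1"
  shows "emp_quantile n x \<beta> \<le> (1 + abs_mean n x) / (1 - \<beta>)" "- ((1 + abs_mean n x) / \<beta>) \<le> emp_quantile n x \<beta>"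
proof -
  have Y: "0 \<le> abs_mean n x" by (rule abs_mean_nonneg)
  have frac: "real (card {i\<in>{1..n}. (1 + abs_mean n x) / c \<le> \<bar>x i\<bar>}) / real n < c" if c: "0 < c" for c
  proof -
    let ?k = "real (card {i\<in>{1..n}. (1 + abs_mean n x) / c \<le> \<bar>x i\<bar>})"
    have "?k * ((1 + abs_mean n x) / c) \<le> real n * abs_mean n x"
      using card_large_le[of "(1 + abs_mean n x) / c" n x] c Y n by (simp add: abs_mean_def)
    then have "?k / real n * (1 + abs_mean n x) \<le> c * abs_mean n x" using c n by (simp add: field_simps)
    also have "\<dots> < c * (1 + abs_mean n x)" using c by simp
    finally show ?thesis by (rule mult_right_less_imp_less) (use Y in simp)
  qed
  let ?t = "(1 + abs_mean n x) / (1 - \<beta>)"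
  have "real (card {i\<in>{1..n}. \<not> x i \<le> ?t}) / real n \<le> real (card {i\<in>{1..n}. ?t \<le> \<bar>x i\<bar>}) / real n"
    by (intro divide_right_mono of_nat_mono card_mono) auto
  then have 1: "real (card {i\<in>{1..n}. \<not> x i \<le> ?t}) / real n \<le> 1 - \<beta>" using frac[of "1 - \<beta>"] \<beta> by simp
  have "{1..n} = {i\<in>{1..n}. x i \<le> ?t} \<union> {i\<in>{1..n}. \<not> x i \<le> ?t}" by blast
  then have "card {1..n} = card ({i\<in>{1..n}. x i \<le> ?t} \<union> {i\<in>{1..n}. \<not> x i \<le> ?t})" by (rule arg_cong)
  also have "\<dots> = card {i\<in>{1..n}. x i \<le> ?t} + card {i\<in>{1..n}. \<not> x i \<le> ?t}"
    by (rule card_Un_disjoint) auto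
  finally have "card {1..n} = card {i\<in>{1..n}. x i \<le> ?t} + card {i\<in>{1..n}. \<not> x i \<le> ?t}" .
  then have "real n = real (card {i\<in>{1..n}. x i \<le> ?t}) + real (card {i\<in>{1..n}. \<not> x i \<le> ?t})" by simp
  then have "1 = real (card {i\<in>{1..n}. x i \<le> ?t}) / real n + real (card {i\<in>{1..n}. \<not> x i \<le> ?t}) / real n"
    using n by (simp flip: add_divide_distrib)
  with 1 have "\<beta> \<le> real (card {i\<in>{1..n}. x i \<le> ?t}) / real n" by linarith
  then show "emp_quantile n x \<beta> \<le> ?t" using emp_quantile_le_iff[of n \<beta> x ?t] n \<beta> by simp
  let ?u = "- ((1 + abs_mean n x) / \<beta>)"
  show "?u \<le> emp_quantile n x \<beta>"
  proof (rule ccontr)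
    assume "\<not> ?u \<le> emp_quantile n x \<beta>"
    then have "\<beta> \<le> real (card {i\<in>{1..n}. x i \<le> ?u}) / real n"
      using emp_quantile_le_iff[of n \<beta> x ?u] n \<beta> by simp
    also have "\<dots> \<le> real (card {i\<in>{1..n}. (1 + abs_mean n x) / \<beta> \<le> \<bar>x i\<bar>}) / real n"
      by (intro divide_right_mono of_nat_mono card_mono) auto
    also have "\<dots> < \<beta>" by (rule frac[OF \<beta>(1)])
    finally show False by simp
  qed
qed

section \<open>Lipschitz dependence on the hyperparameters\<close>

lemma alpha_via_unit:
  assumes vp: "0 < vp"
  shows "alpha vp \<tau> = alpha 1 \<tau> / (alpha 1 \<tau> + vp * (1 - alpha 1 \<tau>))"
proof (cases "\<tau> = \<infinity>")
  case False
  let ?r = "enn2real \<tau>"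
  have r: "0 \<le> ?r" "0 < ?r + 1" "0 < ?r + vp" using enn2real_nonneg[of \<tau>] vp by (auto intro: add_nonneg_pos)
  have "1 - ?r / (?r + 1) = 1 / (?r + 1)" using r by (simp add: field_simps)
  then have "?r / (?r + 1) + vp * (1 - ?r / (?r + 1)) = (?r + vp) / (?r + 1)" by (simp add: add_divide_distrib)
  then show ?thesis using False r by (simp add: alpha_def)
qed (use vp in \<open>simp add: alpha_def\<close>)

text \<open>All shrinkage weights are functions of t = \<tau>/(\<tau> + 1), the coordinate in which
  the scale grid is equispaced and \<tau> = \<infinity> is the point t = 1. The denominator t + vp
  (1 - t) is a convex combination of 1 and vp, hence at least min(1, v0).\<close>

lemma alpha_lipschitz:
  assumes vp: "0 < v0" "v0 \<le> vp" "vp \<le> v"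
  shows "\<bar>alpha vp \<tau> - alpha vp \<tau>'\<bar> \<le> v / (min 1 v0)\<^sup>2 * \<bar>alpha 1 \<tau> - alpha 1 \<tau>'\<bar>"
proof -
  define D where "D t = t + vp * (1 - t)" for t
  let ?m = "min 1 v0" and ?t = "alpha 1 \<tau>" and ?u = "alpha 1 \<tau>'"
  have D: "?m \<le> D t" if "0 \<le> t" "t \<le> 1" for t
  proof -
    have "?m * t + ?m * (1 - t) \<le> 1 * t + vp * (1 - t)"
      using that vp by (intro add_mono mult_right_mono) auto
    then show ?thesis by (simp add: D_def algebra_simps)
  qed
  have t: "0 \<le> ?t" "?t \<le> 1" "0 \<le> ?u" "?u \<le> 1" using alpha_bounds[of 1] by auto
  have m: "0 < ?m" using vp by simp
  have Dt: "?m \<le> D ?t" "?m \<le> D ?u" using D t by auto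
  then have pos: "0 < D ?t" "0 < D ?u" using m by linarith+
  have "alpha vp \<tau> - alpha vp \<tau>' = vp * (?t - ?u) / (D ?t * D ?u)"
    using vp pos by (simp add: alpha_via_unit[of vp] D_def[symmetric] diff_frac_eq) (simp add: D_def algebra_simps)
  then have "\<bar>alpha vp \<tau> - alpha vp \<tau>'\<bar> = vp * \<bar>?t - ?u\<bar> / (D ?t * D ?u)"
    using vp pos by (simp add: abs_mult)
  also have "\<dots> \<le> v * \<bar>?t - ?u\<bar> / ?m\<^sup>2"
    using vp Dt m unfolding power2_eq_square by (intro frac_le mult_mono) auto
  finally show ?thesis by simp
qed

lemma sqrt_lipschitz:
  assumes "0 < c" "c \<le> x" "c \<le> y"
  shows "\<bar>sqrt x - sqrt y\<bar> \<le> \<bar>x - y\<bar> / sqrt c"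
proof -
  have "(sqrt x - sqrt y) * (sqrt x + sqrt y) = x - y" using assms by (simp add: algebra_simps)
  then have "\<bar>sqrt x - sqrt y\<bar> * (sqrt x + sqrt y) = \<bar>x - y\<bar>"
    using assms by (metis abs_mult abs_of_nonneg add_nonneg_nonneg real_sqrt_ge_zero less_imp_le order_trans)
  moreover have "sqrt c \<le> sqrt x + sqrt y" using assms by (simp add: add_increasing2)
  ultimately have "\<bar>sqrt x - sqrt y\<bar> * sqrt c \<le> \<bar>x - y\<bar>"
    by (metis abs_ge_zero mult_left_mono)
  then show ?thesis using assms by (simp add: pos_le_divide_eq)
qed

lemma coord_loss_lipschitz:
  assumes "0 < b" "0 < h" "0 < vf"
  shows "\<bar>coord_loss b h vf t q - coord_loss b h vf t q'\<bar> \<le> (b + h) * \<bar>q - q'\<bar>"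
proof -
  have \<beta>: "0 \<le> btilde b h" "btilde b h \<le> 1" using assms by (auto simp: btilde_def divide_simps)
  have "\<bar>coord_loss b h vf t q - coord_loss b h vf t q'\<bar>
    = sqrt vf * (b + h) * \<bar>G ((q - t) / sqrt vf) (btilde b h) - G ((q' - t) / sqrt vf) (btilde b h)\<bar>"
    using assms by (simp add: coord_loss_def abs_mult flip: right_diff_distrib)
  also have "\<dots> \<le> sqrt vf * (b + h) * \<bar>(q - t) / sqrt vf - (q' - t) / sqrt vf\<bar>"
    using assms by (intro mult_left_mono G_lipschitz \<beta>) auto
  also have "\<dots> = (b + h) * \<bar>q - q'\<bar>" using assms by (simp flip: diff_divide_distrib)
  finally show ?thesis .
qed

lemma coord_loss_le:
  assumes "0 < b" "0 < h" "0 < vf"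
  shows "\<bar>coord_loss b h vf t q\<bar> \<le> (b + h) * (sqrt vf + \<bar>q - t\<bar>)"
proof -
  have \<beta>: "0 \<le> btilde b h" "btilde b h \<le> 1" using assms by (auto simp: btilde_def divide_simps)
  have "\<bar>coord_loss b h vf t q\<bar> = sqrt vf * (b + h) * \<bar>G ((q - t) / sqrt vf) (btilde b h)\<bar>"
    using assms by (simp add: coord_loss_def abs_mult)
  also have "\<dots> \<le> sqrt vf * (b + h) * (1 + \<bar>(q - t) / sqrt vf\<bar>)"
    using assms by (intro mult_left_mono abs_G_le \<beta>) auto
  also have "\<dots> = (b + h) * (sqrt vf + \<bar>q - t\<bar>)" using assms by (simp add: algebra_simps)
  finally show ?thesis .
qed

text \<open>If \<open>{m1..m2}\<close> contains a grid point, then the grid neighbour of \<open>\<eta>\<close> on the side of that point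
  lies in \<open>{m1..m2}\<close> too; otherwise \<open>{m1..m2}\<close> is shorter than one step.\<close>

lemma location_near:
  fixes a p \<delta> m1 m2 \<eta> :: real
  defines "\<Lambda> \<equiv> {\<eta>\<in>{- a .. a}. \<exists>j::int. \<eta> = p + real_of_int j * \<delta>}"
  assumes \<delta>: "0 < \<delta>" "\<delta> \<le> a" and M: "{m1..m2} \<subseteq> {- a .. a}" "m1 \<le> m2"
  shows "\<And>\<eta>. \<eta> \<in> {m1..m2} \<Longrightarrow> \<exists>\<eta>'\<in>location_candidates \<Lambda> {m1..m2}. \<bar>\<eta>' - \<eta>\<bar> \<le> 2 * \<delta>"
    and "\<And>\<eta>'. \<eta>' \<in> location_candidates \<Lambda> {m1..m2} \<Longrightarrow> \<exists>\<eta>\<in>{m1..m2}. \<bar>\<eta>' - \<eta>\<bar> \<le> \<delta>"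
    and "finite \<Lambda>" "real (card \<Lambda>) \<le> 2 * a / \<delta> + 1"
proof -
  let ?g = "\<lambda>j::int. p + real_of_int j * \<delta>"
  define fl where "fl y = \<lfloor>(y - p) / \<delta>\<rfloor>" for y
  define cl where "cl y = \<lceil>(y - p) / \<delta>\<rceil>" for y
  have fl: "?g (fl y) \<le> y" "y < ?g (fl y) + \<delta>" for y
  proof -
    have "real_of_int (fl y) \<le> (y - p) / \<delta>" "(y - p) / \<delta> < real_of_int (fl y) + 1" by (auto simp: fl_def)
    then show "?g (fl y) \<le> y" "y < ?g (fl y) + \<delta>" using \<delta> by (auto simp: field_simps)
  qed
  have cl: "y \<le> ?g (cl y)" "?g (cl y) < y + \<delta>" for y
  proof -
    have "(y - p) / \<delta> \<le> real_of_int (cl y)" "real_of_int (cl y) < (y - p) / \<delta> + 1" unfolding cl_def by linarith+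
    then show "y \<le> ?g (cl y)" "?g (cl y) < y + \<delta>" using \<delta> by (auto simp: field_simps)
  qed
  have fl_max: "?g j \<le> ?g (fl y)" if "?g j \<le> y" for j y
  proof -
    have "real_of_int j \<le> (y - p) / \<delta>" using that \<delta> by (simp add: field_simps)
    then have "j \<le> fl y" by (simp add: fl_def le_floor_iff)
    then show ?thesis using \<delta> by simp
  qed
  have cl_min: "?g (cl y) \<le> ?g j" if "y \<le> ?g j" for j y
  proof -
    have "(y - p) / \<delta> \<le> real_of_int j" using that \<delta> by (simp add: field_simps)
    then have "cl y \<le> j" by (simp add: cl_def ceiling_le_iff)
    then show ?thesis using \<delta> by simp
  qed
  have near: "\<exists>g\<in>\<Lambda>. \<bar>g - y\<bar> \<le> \<delta>" if "y \<in> {- a .. a}" for y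
  proof (cases "- a \<le> ?g (fl y)")
    case True
    then have "?g (fl y) \<in> \<Lambda>" using fl[of y] that by (auto simp: \<Lambda>_def)
    then show ?thesis using fl[of y] by (intro bexI[of _ "?g (fl y)"]) auto
  next
    \<comment> \<open>The grid point below y lies left of - a. The next one is in [- a, a], because
      y >= - a and \<delta> <= a.\<close>
    case False
    have "?g (fl y + 1) = ?g (fl y) + \<delta>" by (simp add: algebra_simps)
    moreover have "- a \<le> ?g (fl y) + \<delta>" "?g (fl y) + \<delta> \<le> a" using False fl[of y] that \<delta> by auto
    ultimately have "?g (fl y) + \<delta> \<in> \<Lambda>" unfolding \<Lambda>_def by (auto intro: exI[of _ "fl y + 1"])
    then show ?thesis using fl[of y] by (intro bexI[of _ "?g (fl y) + \<delta>"]) auto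
  qed
  have sub: "\<Lambda> \<subseteq> ?g ` {cl (- a)..fl a}"
  proof
    fix g assume "g \<in> \<Lambda>"
    then obtain j where j: "g = ?g j" "- a \<le> ?g j" "?g j \<le> a" by (auto simp: \<Lambda>_def)
    have "(- a - p) / \<delta> \<le> real_of_int j" "real_of_int j \<le> (a - p) / \<delta>" using j \<delta> by (auto simp: field_simps)
    then have "cl (- a) \<le> j" "j \<le> fl a" by (auto simp: cl_def fl_def ceiling_le_iff le_floor_iff)
    then show "g \<in> ?g ` {cl (- a)..fl a}" using j by auto
  qed
  show fin: "finite \<Lambda>" by (rule finite_subset[OF sub]) simp
  have "card \<Lambda> \<le> card {cl (- a)..fl a}" by (rule surj_card_le[OF _ sub]) simp
  also have "real \<dots> \<le> 2 * a / \<delta> + 1"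
  proof -
    have "real_of_int (fl a) \<le> (a - p) / \<delta>" "(- a - p) / \<delta> \<le> real_of_int (cl (- a))" by (auto simp: cl_def fl_def)
    moreover have "(a - p) / \<delta> - (- a - p) / \<delta> = 2 * a / \<delta>" using \<delta> by (simp add: field_simps)
    moreover have "0 \<le> 2 * a / \<delta>" using \<delta> by simp
    ultimately show ?thesis by simp
  qed
  finally show "real (card \<Lambda>) \<le> 2 * a / \<delta> + 1" by simp
  have closeM: "\<exists>y\<in>{m1..m2}. \<bar>\<eta>' - y\<bar> \<le> \<delta>" if c: "\<eta>' \<in> location_candidates \<Lambda> {m1..m2}" for \<eta>'
  proof (cases "\<Lambda> \<inter> {m1..m2} = {}")
    case True
    obtain g where g: "g \<in> \<Lambda>" "\<bar>g - m1\<bar> \<le> \<delta>" using near[of m1] M by auto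
    have "infdist \<eta>' {m1..m2} \<le> infdist g {m1..m2}" using c g(1) True by (auto simp: location_candidates_def)
    also have "\<dots> \<le> dist g m1" using M by (intro infdist_le) auto
    finally have "infdist \<eta>' {m1..m2} \<le> \<delta>" using g by (simp add: dist_real_def)
    moreover obtain y where "y \<in> {m1..m2}" "infdist \<eta>' {m1..m2} = dist \<eta>' y"
      using infdist_attains_inf[of "{m1..m2}" \<eta>'] M by auto
    ultimately show ?thesis by (auto simp: dist_real_def)
  next
    case False
    then have "\<eta>' \<in> {m1..m2}" using c by (auto simp: location_candidates_def)
    then show ?thesis using \<delta> by (intro bexI[of _ \<eta>']) auto
  qed
  then show "\<And>\<eta>'. \<eta>' \<in> location_candidates \<Lambda> {m1..m2} \<Longrightarrow> \<exists>\<eta>\<in>{m1..m2}. \<bar>\<eta>' - \<eta>\<bar> \<le> \<delta>" .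
  fix \<eta> assume \<eta>: "\<eta> \<in> {m1..m2}"
  show "\<exists>\<eta>'\<in>location_candidates \<Lambda> {m1..m2}. \<bar>\<eta>' - \<eta>\<bar> \<le> 2 * \<delta>"
  proof (cases "\<Lambda> \<inter> {m1..m2} = {}")
    case True
    have short: "m2 < m1 + \<delta>"
    proof (rule ccontr)
      assume "\<not> m2 < m1 + \<delta>"
      then have "?g (cl m1) \<in> {m1..m2}" using cl[of m1] by auto
      moreover then have "?g (cl m1) \<in> \<Lambda>" using M unfolding \<Lambda>_def by blast
      ultimately show False using True by blast
    qed
    have "\<Lambda> \<noteq> {}" using near[of m1] M by auto
    then obtain c where c: "c \<in> \<Lambda>" "\<forall>\<eta>'\<in>\<Lambda>. infdist c {m1..m2} \<le> infdist \<eta>' {m1..m2}"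
      using ex_is_arg_min_if_finite[OF fin, of "\<lambda>x. infdist x {m1..m2}"] by (auto simp: is_arg_min_linorder)
    then have cand: "c \<in> location_candidates \<Lambda> {m1..m2}" using True by (auto simp: location_candidates_def)
    obtain y where "y \<in> {m1..m2}" "\<bar>c - y\<bar> \<le> \<delta>" using closeM[OF cand] by blast
    \<comment> \<open>One \<delta> to reach the range and one for its length.\<close>
    then have "\<bar>c - \<eta>\<bar> \<le> 2 * \<delta>" using short \<eta> by auto
    then show ?thesis using cand by blast
  next
    case False
    then obtain g where "g \<in> \<Lambda>" and g: "g \<in> {m1..m2}" by blast
    then obtain j where "g = ?g j" unfolding \<Lambda>_def by blast
    with g have j: "?g j \<in> {m1..m2}" by simp
    have mem: "g \<in> location_candidates \<Lambda> {m1..m2}" if "g \<in> {m1..m2}" "g = ?g k" for g k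
      using that False M by (auto simp: location_candidates_def \<Lambda>_def)
    show ?thesis
    proof (cases "?g j \<le> \<eta>")
      case True
      have "?g (fl \<eta>) \<in> {m1..m2}" using fl_max[OF True] fl(1)[of \<eta>] j \<eta> unfolding atLeastAtMost_iff by linarith
      then show ?thesis using mem[OF _ refl] fl[of \<eta>] \<delta> by (intro bexI[of _ "?g (fl \<eta>)"]) auto
    next
      case False
      then have "?g (cl \<eta>) \<in> {m1..m2}"
        using cl_min[of \<eta> j] cl(1)[of \<eta>] j \<eta> unfolding atLeastAtMost_iff by linarith
      then show ?thesis using mem[OF _ refl] cl[of \<eta>] \<delta> by (intro bexI[of _ "?g (cl \<eta>)"]) auto
    qed
  qed
qed

lemma alpha_one_ennreal: "0 \<le> \<tau> \<Longrightarrow> alpha 1 (ennreal \<tau>) = \<tau> / (\<tau> + 1)"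
  by (simp add: alpha_def)

text \<open>In the coordinate \<tau>/(\<tau> + 1) the grid consists of the multiples of \<delta> in
  [0, 1). The last of them is within \<delta> of 1, so even \<tau> = \<infinity> is approximated by
  a finite grid point.\<close>

lemma scale_near:
  fixes \<delta> :: real
  defines "\<Lambda> \<equiv> {\<tau>::real. 0 \<le> \<tau> \<and> (\<exists>j\<in>{1..nat \<lceil>1 / \<delta>\<rceil>}. \<tau> / (\<tau> + 1) = (real j - 1) * \<delta>)}"
  assumes \<delta>: "0 < \<delta>"
  shows "\<exists>\<tau>'\<in>\<Lambda>. \<bar>alpha 1 \<tau> - alpha 1 (ennreal \<tau>')\<bar> \<le> \<delta>"
    and "finite \<Lambda>" "real (card \<Lambda>) \<le> 1 / \<delta> + 1"
proof -
  let ?K = "nat \<lceil>1 / \<delta>\<rceil>"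
  have pos: "0 < 1 / \<delta>" using \<delta> by simp
  have K: "1 \<le> ?K" "real ?K < 1 / \<delta> + 1" "1 / \<delta> \<le> real ?K" using pos by linarith+
  define t where "t = alpha 1 \<tau>"
  have t: "0 \<le> t" "t \<le> 1" using alpha_bounds[of 1] by (auto simp: t_def)
  \<comment> \<open>The cap takes effect only for t = 1 with 1/\<delta> an integer, where the floor
    is one too large.\<close>
  define k where "k = min (nat \<lfloor>t / \<delta>\<rfloor>) (?K - 1)"
  have td: "0 \<le> t / \<delta>" using t \<delta> by simp
  have "real k \<le> real (nat \<lfloor>t / \<delta>\<rfloor>)" by (simp add: k_def)
  also have "\<dots> \<le> t / \<delta>" using td by linarith
  finally have "real k \<le> t / \<delta>" .
  moreover have "t / \<delta> \<le> real k + 1"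
  proof (cases "nat \<lfloor>t / \<delta>\<rfloor> \<le> ?K - 1")
    case True
    then have "k = nat \<lfloor>t / \<delta>\<rfloor>" by (simp add: k_def)
    then show ?thesis using td by linarith
  next
    case False
    then have "real k + 1 = real ?K" using K by (simp add: k_def)
    moreover have "t / \<delta> \<le> 1 / \<delta>" using t \<delta> by (intro divide_right_mono) auto
    ultimately show ?thesis using K by linarith
  qed
  ultimately have k: "\<bar>t - real k * \<delta>\<bar> \<le> \<delta>" using \<delta> by (simp add: field_simps abs_le_iff)
  define u where "u = real k * \<delta>"
  have "k \<le> ?K - 1" by (simp add: k_def)
  then have "real k \<le> real ?K - 1" using K(1) by (metis of_nat_1 of_nat_diff of_nat_le_iff)
  then have "real k < 1 / \<delta>" using K(2) by linarith
  then have u: "0 \<le> u" "u < 1" using \<delta> by (auto simp: u_def field_simps)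
  define \<tau>' where "\<tau>' = u / (1 - u)"
  have "\<tau>' + 1 = 1 / (1 - u)" using u by (simp add: \<tau>'_def field_simps)
  then have \<tau>': "0 \<le> \<tau>'" "\<tau>' / (\<tau>' + 1) = u" using u by (auto simp: \<tau>'_def)
  have "Suc k \<in> {1..?K}" using K unfolding k_def by auto
  then have "\<tau>' \<in> \<Lambda>" unfolding \<Lambda>_def using \<tau>' by (auto intro!: bexI[of _ "Suc k"] simp: u_def)
  then show "\<exists>\<tau>'\<in>\<Lambda>. \<bar>alpha 1 \<tau> - alpha 1 (ennreal \<tau>')\<bar> \<le> \<delta>"
    using k \<tau>' by (intro bexI[of _ \<tau>']) (auto simp: alpha_one_ennreal t_def[symmetric] u_def)
  have sub: "\<Lambda> \<subseteq> (\<lambda>j. ((real j - 1) * \<delta>) / (1 - (real j - 1) * \<delta>)) ` {1..?K}"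
  proof
    fix \<tau> assume "\<tau> \<in> \<Lambda>"
    then obtain j where j: "j \<in> {1..?K}" "0 \<le> \<tau>" "\<tau> / (\<tau> + 1) = (real j - 1) * \<delta>" unfolding \<Lambda>_def by blast
    have *: "1 - \<tau> / (\<tau> + 1) = 1 / (\<tau> + 1)" using j by (simp add: field_simps)
    have "\<tau> = (\<tau> / (\<tau> + 1)) / (1 - \<tau> / (\<tau> + 1))" unfolding * using j(2) by simp
    then show "\<tau> \<in> (\<lambda>j. ((real j - 1) * \<delta>) / (1 - (real j - 1) * \<delta>)) ` {1..?K}" unfolding j(3) using j(1) by blast
  qed
  show "finite \<Lambda>" by (rule finite_subset[OF sub]) simp
  have "card \<Lambda> \<le> card {1..?K}" by (rule surj_card_le[OF _ sub]) simp
  then show "real (card \<Lambda>) \<le> 1 / \<delta> + 1" using K by simp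
qed

section \<open>Regret\<close>

lemma mean_le_of_abs_bound:
  fixes f x :: "nat \<Rightarrow> real"
  assumes n: "1 \<le> n" and f: "\<And>i. i \<in> {1..n} \<Longrightarrow> f i \<le> B * (c + d * \<bar>x i\<bar>)"
  shows "(1 / real n) * (\<Sum>i=1..n. f i) \<le> B * (c + d * abs_mean n x)"
proof -
  have "(\<Sum>i=1..n. f i) \<le> (\<Sum>i=1..n. B * (c + d * \<bar>x i\<bar>))" by (rule sum_mono[OF f])
  also have "\<dots> = B * (real n * c + d * (\<Sum>i=1..n. \<bar>x i\<bar>))"
    by (simp add: sum_distrib_left[symmetric] sum.distrib)
  finally have "(1 / real n) * (\<Sum>i=1..n. f i) \<le> (1 / real n) * (B * (real n * c + d * (\<Sum>i=1..n. \<bar>x i\<bar>)))"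
    by (intro mult_left_mono) auto
  also have "\<dots> = B * (c + d * abs_mean n x)" using n by (simp add: abs_mean_def field_simps)
  finally show ?thesis .
qed

context bounded_model
begin

text \<open>\<open>kap\<close> adds the two factors with which \<open>emp_quantile_bounds\<close>
  limits the location range from either side; \<open>ca\<close> is the constant of
  \<open>alpha_lipschitz\<close>.\<close>

definition "kap = 1 / bl + 1 / (1 - bu)"
definition "ca = v / (min 1 v0)\<^sup>2"

lemma const_pos: "0 \<le> q0" "0 < v" "0 < B" "0 \<le> ca" "1 \<le> kap"
proof -
  show "0 \<le> q0" using q0[of 1] by simp
  show v': "0 < v" using v0 v(1)[of 1] by fastforce
  show "0 < B" using B[of 1] pos[of 1] by fastforce
  show "0 \<le> ca" using v' by (simp add: ca_def)
  have "bl < 1" "0 < bu" using bl bu by (meson le_less_trans less_le_trans order_refl)+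
  then show "1 \<le> kap" using bl bu by (simp add: kap_def add_increasing2)
qed

text \<open>The difference is (1 - a)(\<eta> - \<eta>') + (a - a')(y - \<eta>') plus the change of
  the square root times the quantile. The middle term makes the bound grow with |y| and |\<eta>'|;
  the last is Lipschitz in a with constant sqrt v, up to the quantile, because \<open>\<nu>p\<close>
  <= \<open>\<nu>f\<close> <= v.\<close>

lemma predictor_diff:
  assumes i: "1 \<le> i"
  shows "\<bar>coord_predictor (b i) (h i) (\<nu>p i) (\<nu>f i) \<eta> \<tau> y - coord_predictor (b i) (h i) (\<nu>p i) (\<nu>f i) \<eta>' \<tau>' y\<bar>
    \<le> \<bar>\<eta> - \<eta>'\<bar> + ca * \<bar>alpha 1 \<tau> - alpha 1 \<tau>'\<bar> * (\<bar>y\<bar> + \<bar>\<eta>'\<bar> + q0 * sqrt v)"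
proof -
  let ?a = "alpha (\<nu>p i) \<tau>" and ?a' = "alpha (\<nu>p i) \<tau>'" and ?Q = "Phi_inv (btilde (b i) (h i))"
  let ?s = "sqrt (\<nu>f i + ?a * \<nu>p i)" and ?s' = "sqrt (\<nu>f i + ?a' * \<nu>p i)"
  have p: "0 < \<nu>p i" "0 < \<nu>f i" using pos[OF i] by auto
  have a: "0 \<le> ?a" "?a \<le> 1" "0 \<le> ?a'" "?a' \<le> 1" using alpha_bounds[OF p(1)] by auto
  have da: "\<bar>?a - ?a'\<bar> \<le> ca * \<bar>alpha 1 \<tau> - alpha 1 \<tau>'\<bar>"
    unfolding ca_def using v0 v i by (intro alpha_lipschitz) auto
  have "\<bar>?s - ?s'\<bar> \<le> \<bar>(\<nu>f i + ?a * \<nu>p i) - (\<nu>f i + ?a' * \<nu>p i)\<bar> / sqrt (\<nu>f i)"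
    using p a by (intro sqrt_lipschitz) auto
  also have "\<dots> = \<bar>?a - ?a'\<bar> * (\<nu>p i / sqrt (\<nu>f i))"
    using p by (simp add: abs_mult flip: left_diff_distrib)
  also have "\<dots> \<le> \<bar>?a - ?a'\<bar> * sqrt v"
  proof (intro mult_left_mono)
    have "\<nu>p i / sqrt (\<nu>f i) \<le> \<nu>f i / sqrt (\<nu>f i)" using ratio[OF i] p by (intro divide_right_mono) auto
    also have "\<dots> = sqrt (\<nu>f i)" using p by (simp add: real_div_sqrt)
    also have "\<dots> \<le> sqrt v" using v(2)[OF i] by simp
    finally show "\<nu>p i / sqrt (\<nu>f i) \<le> sqrt v" .
  qed auto
  finally have s: "\<bar>?s - ?s'\<bar> * \<bar>?Q\<bar> \<le> \<bar>?a - ?a'\<bar> * sqrt v * q0"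
    using q0[OF i] const_pos by (intro mult_mono) auto
  have eq: "coord_predictor (b i) (h i) (\<nu>p i) (\<nu>f i) \<eta> \<tau> y - coord_predictor (b i) (h i) (\<nu>p i) (\<nu>f i) \<eta>' \<tau>' y
    = (1 - ?a) * (\<eta> - \<eta>') + (?a - ?a') * (y - \<eta>') + (?s - ?s') * ?Q"
    by (simp add: coord_predictor_def algebra_simps)
  have "\<bar>coord_predictor (b i) (h i) (\<nu>p i) (\<nu>f i) \<eta> \<tau> y - coord_predictor (b i) (h i) (\<nu>p i) (\<nu>f i) \<eta>' \<tau>' y\<bar>
    \<le> \<bar>(1 - ?a) * (\<eta> - \<eta>')\<bar> + \<bar>(?a - ?a') * (y - \<eta>')\<bar> + \<bar>(?s - ?s') * ?Q\<bar>"
    unfolding eq by (rule order_trans[OF abs_triangle_ineq add_right_mono[OF abs_triangle_ineq]])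
  also have "\<dots> \<le> \<bar>\<eta> - \<eta>'\<bar> + \<bar>?a - ?a'\<bar> * (\<bar>y\<bar> + \<bar>\<eta>'\<bar>) + \<bar>?a - ?a'\<bar> * sqrt v * q0"
  proof (intro add_mono)
    show "\<bar>(1 - ?a) * (\<eta> - \<eta>')\<bar> \<le> \<bar>\<eta> - \<eta>'\<bar>" using a by (auto simp: abs_mult intro: mult_left_le_one_le)
    show "\<bar>(?a - ?a') * (y - \<eta>')\<bar> \<le> \<bar>?a - ?a'\<bar> * (\<bar>y\<bar> + \<bar>\<eta>'\<bar>)"
      unfolding abs_mult by (intro mult_left_mono) auto
    show "\<bar>(?s - ?s') * ?Q\<bar> \<le> \<bar>?a - ?a'\<bar> * sqrt v * q0" using s by (simp add: abs_mult)
  qed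
  also have "\<dots> = \<bar>\<eta> - \<eta>'\<bar> + \<bar>?a - ?a'\<bar> * (\<bar>y\<bar> + \<bar>\<eta>'\<bar> + q0 * sqrt v)" by (simp add: algebra_simps)
  also have "\<dots> \<le> \<bar>\<eta> - \<eta>'\<bar> + ca * \<bar>alpha 1 \<tau> - alpha 1 \<tau>'\<bar> * (\<bar>y\<bar> + \<bar>\<eta>'\<bar> + q0 * sqrt v)"
    using da const_pos by (intro add_left_mono mult_right_mono) auto
  finally show ?thesis .
qed

lemma L_diff:
  assumes n: "1 \<le> n"
  shows "\<bar>L n \<eta> \<tau> x - L n \<eta>' \<tau>' x\<bar> \<le> B * (\<bar>\<eta> - \<eta>'\<bar> + ca * \<bar>alpha 1 \<tau> - alpha 1 \<tau>'\<bar> * (abs_mean n x + \<bar>\<eta>'\<bar> + q0 * sqrt v))"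
proof -
  let ?l = "\<lambda>\<eta> \<tau> i. coord_loss (b i) (h i) (\<nu>f i) (\<theta> i) (coord_predictor (b i) (h i) (\<nu>p i) (\<nu>f i) \<eta> \<tau> (x i))"
  let ?d = "ca * \<bar>alpha 1 \<tau> - alpha 1 \<tau>'\<bar>"
  have d: "0 \<le> ?d" using const_pos by simp
  have "\<bar>L n \<eta> \<tau> x - L n \<eta>' \<tau>' x\<bar> = \<bar>(1 / real n) * (\<Sum>i=1..n. ?l \<eta> \<tau> i - ?l \<eta>' \<tau>' i)\<bar>"
    by (simp add: avg_loss_def predictor_def sum_subtractf diff_divide_distrib)
  also have "\<dots> \<le> (1 / real n) * (\<Sum>i=1..n. \<bar>?l \<eta> \<tau> i - ?l \<eta>' \<tau>' i\<bar>)"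
    by (simp add: abs_mult divide_right_mono)
  also have "\<dots> \<le> B * ((\<bar>\<eta> - \<eta>'\<bar> + ?d * (\<bar>\<eta>'\<bar> + q0 * sqrt v)) + ?d * abs_mean n x)"
  proof (rule mean_le_of_abs_bound[OF n])
    fix i assume "i \<in> {1..n}"
    then have i: "1 \<le> i" by simp
    have "\<bar>?l \<eta> \<tau> i - ?l \<eta>' \<tau>' i\<bar> \<le> (b i + h i) * \<bar>coord_predictor (b i) (h i) (\<nu>p i) (\<nu>f i) \<eta> \<tau> (x i) - coord_predictor (b i) (h i) (\<nu>p i) (\<nu>f i) \<eta>' \<tau>' (x i)\<bar>"
      using pos[OF i] by (intro coord_loss_lipschitz) auto
    also have "\<dots> \<le> B * (\<bar>\<eta> - \<eta>'\<bar> + ?d * (\<bar>x i\<bar> + \<bar>\<eta>'\<bar> + q0 * sqrt v))"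
      using const_pos B[OF i] predictor_diff[OF i] by (intro mult_mono) auto
    also have "\<dots> = B * ((\<bar>\<eta> - \<eta>'\<bar> + ?d * (\<bar>\<eta>'\<bar> + q0 * sqrt v)) + ?d * \<bar>x i\<bar>)" by (simp add: algebra_simps)
    finally show "\<bar>?l \<eta> \<tau> i - ?l \<eta>' \<tau>' i\<bar> \<le> B * ((\<bar>\<eta> - \<eta>'\<bar> + ?d * (\<bar>\<eta>'\<bar> + q0 * sqrt v)) + ?d * \<bar>x i\<bar>)" .
  qed
  also have "\<dots> = B * (\<bar>\<eta> - \<eta>'\<bar> + ?d * (abs_mean n x + \<bar>\<eta>'\<bar> + q0 * sqrt v))" by (simp add: algebra_simps)
  finally show ?thesis .
qed

text \<open>A crude bound, for integrability and for the samples whose location range may leave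
  [- a, a].\<close>

lemma L_le:
  assumes n: "1 \<le> n"
  shows "\<bar>L n \<eta> \<tau> x\<bar> \<le> B * (sqrt v + \<bar>\<eta>\<bar> + q0 * sqrt (2 * v) + abs_mean n \<theta> + abs_mean n x)"
proof -
  let ?l = "\<lambda>i. coord_loss (b i) (h i) (\<nu>f i) (\<theta> i) (coord_predictor (b i) (h i) (\<nu>p i) (\<nu>f i) \<eta> \<tau> (x i))"
  let ?w = "\<lambda>i. \<bar>x i\<bar> + \<bar>\<theta> i\<bar>"
  have "\<bar>L n \<eta> \<tau> x\<bar> \<le> (1 / real n) * (\<Sum>i=1..n. \<bar>?l i\<bar>)"
    by (simp add: avg_loss_def predictor_def abs_mult divide_right_mono)
  also have "\<dots> \<le> B * ((sqrt v + \<bar>\<eta>\<bar> + q0 * sqrt (2 * v)) + 1 * abs_mean n ?w)"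
  proof (rule mean_le_of_abs_bound[OF n])
    fix i assume "i \<in> {1..n}"
    then have i: "1 \<le> i" by simp
    let ?a = "alpha (\<nu>p i) \<tau>" and ?Q = "Phi_inv (btilde (b i) (h i))"
    let ?s = "sqrt (\<nu>f i + ?a * \<nu>p i)"
    have p: "0 < \<nu>p i" "0 < \<nu>f i" using pos[OF i] by auto
    have a: "0 \<le> ?a" "?a \<le> 1" using alpha_bounds[OF p(1)] by auto
    have "?a * \<nu>p i \<le> 1 * \<nu>p i" using a p by (intro mult_right_mono) auto
    then have "?s \<le> sqrt (2 * v)" using v[OF i] by simp
    then have "\<bar>?s * ?Q\<bar> \<le> sqrt (2 * v) * q0"
      unfolding abs_mult using q0[OF i] p a const_pos by (intro mult_mono) auto
    then have "\<bar>?s * ?Q\<bar> \<le> q0 * sqrt (2 * v)" by (simp only: mult.commute)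
    moreover have "\<bar>?a * x i\<bar> \<le> \<bar>x i\<bar>" "\<bar>(1 - ?a) * \<eta>\<bar> \<le> \<bar>\<eta>\<bar>" using a by (auto simp: abs_mult intro: mult_left_le_one_le)
    ultimately have "\<bar>coord_predictor (b i) (h i) (\<nu>p i) (\<nu>f i) \<eta> \<tau> (x i) - \<theta> i\<bar> \<le> \<bar>x i\<bar> + \<bar>\<eta>\<bar> + q0 * sqrt (2 * v) + \<bar>\<theta> i\<bar>"
      unfolding coord_predictor_def by linarith
    moreover have "sqrt (\<nu>f i) \<le> sqrt v" using v(2)[OF i] by simp
    moreover have "\<bar>?w i\<bar> = \<bar>x i\<bar> + \<bar>\<theta> i\<bar>" by simp
    ultimately have *: "sqrt (\<nu>f i) + \<bar>coord_predictor (b i) (h i) (\<nu>p i) (\<nu>f i) \<eta> \<tau> (x i) - \<theta> i\<bar> \<le> (sqrt v + \<bar>\<eta>\<bar> + q0 * sqrt (2 * v)) + 1 * \<bar>?w i\<bar>"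
      by linarith
    have "\<bar>?l i\<bar> \<le> (b i + h i) * (sqrt (\<nu>f i) + \<bar>coord_predictor (b i) (h i) (\<nu>p i) (\<nu>f i) \<eta> \<tau> (x i) - \<theta> i\<bar>)"
      using pos[OF i] by (intro coord_loss_le) auto
    also have "\<dots> \<le> B * ((sqrt v + \<bar>\<eta>\<bar> + q0 * sqrt (2 * v)) + 1 * \<bar>?w i\<bar>)"
      using const_pos B[OF i] p by (intro mult_mono *) (auto intro: add_nonneg_nonneg)
    finally show "\<bar>?l i\<bar> \<le> B * ((sqrt v + \<bar>\<eta>\<bar> + q0 * sqrt (2 * v)) + 1 * \<bar>?w i\<bar>)" .
  qed
  also have "abs_mean n ?w = abs_mean n \<theta> + abs_mean n x"
    by (simp add: abs_mean_def sum.distrib add_divide_distrib)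
  finally show ?thesis by (simp add: algebra_simps)
qed

definition "bmin n = (INF i\<in>{1..n}. btilde (b i) (h i))"
definition "bmax n = (SUP i\<in>{1..n}. btilde (b i) (h i))"

lemma location_range_eq: "location_range n b h x = {emp_quantile n x (bmin n)..emp_quantile n x (bmax n)}"
  by (simp add: location_range_def bmin_def bmax_def)

lemma bmin_bmax:
  assumes n: "1 \<le> n"
  shows "bl \<le> bmin n" "bmin n \<le> bmax n" "bmax n \<le> bu"
proof -
  have ne: "{1..n} \<noteq> {}" using n by simp
  have bdd: "bdd_below ((\<lambda>i. btilde (b i) (h i)) ` {1..n})" "bdd_above ((\<lambda>i. btilde (b i) (h i)) ` {1..n})" by auto
  show "bl \<le> bmin n" unfolding bmin_def using bl ne by (intro cINF_greatest) auto
  show "bmax n \<le> bu" unfolding bmax_def using bu ne by (intro cSUP_least) auto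
  have "bmin n \<le> btilde (b 1) (h 1)" unfolding bmin_def using n by (intro cINF_lower bdd) auto
  also have "\<dots> \<le> bmax n" unfolding bmax_def using n by (intro cSUP_upper bdd) auto
  finally show "bmin n \<le> bmax n" .
qed

lemma range_bounds:
  assumes n: "1 \<le> n"
  shows "emp_quantile n x (bmin n) \<le> emp_quantile n x (bmax n)"
    and "\<eta> \<in> location_range n b h x \<Longrightarrow> \<bar>\<eta>\<bar> \<le> kap * (1 + abs_mean n x)"
proof -
  note b = bmin_bmax[OF n]
  have bb: "0 < bmin n" "bmin n < 1" "0 < bmax n" "bmax n < 1" using b bl bu by linarith+
  show "emp_quantile n x (bmin n) \<le> emp_quantile n x (bmax n)" using b bb n by (intro emp_quantile_mono) auto
  assume \<eta>: "\<eta> \<in> location_range n b h x"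
  have Y: "0 \<le> 1 + abs_mean n x" using abs_mean_nonneg[of n x] by simp
  have "\<eta> \<le> (1 + abs_mean n x) / (1 - bmax n)"
    using \<eta> emp_quantile_bounds(1)[OF n bb(3,4), of x] by (simp add: location_range_eq)
  also have "\<dots> \<le> (1 + abs_mean n x) * (1 / (1 - bu))" using Y b bu by (simp add: frac_le)
  also have "\<dots> \<le> (1 + abs_mean n x) * kap" using Y bl by (intro mult_left_mono) (auto simp: kap_def)
  finally have 1: "\<eta> \<le> kap * (1 + abs_mean n x)" by (simp add: mult.commute)
  have "- \<eta> \<le> (1 + abs_mean n x) / bmin n"
    using \<eta> emp_quantile_bounds(2)[OF n bb(1,2), of x] by (simp add: location_range_eq)
  also have "\<dots> \<le> (1 + abs_mean n x) * (1 / bl)" using Y b bl by (simp add: frac_le)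
  also have "\<dots> \<le> (1 + abs_mean n x) * kap" using Y bu by (intro mult_left_mono) (auto simp: kap_def)
  finally show "\<bar>\<eta>\<bar> \<le> kap * (1 + abs_mean n x)" using 1 by (simp add: mult.commute abs_le_iff)
qed

text \<open>Both are constants per unit of W = 1 + \<open>abs_mean\<close>: \<open>Cgood\<close> for
  the change of the loss under a displacement by the grid steps, \<open>Cbad\<close> for twice the
  size of the loss.\<close>

definition "Cgood = B * (2 + ca * (1 + kap + q0 * sqrt v))"
definition "Cbad M0 = B * (2 * sqrt v + 2 + 2 * kap + 2 * (q0 * sqrt (2 * v)) + 2 * M0)"

text \<open>If \<open>kap * W\<close> <= a, the location range lies in [- a, a] and the usual chain
  applies: the estimate at the selected point is at most that at a grid neighbour of the oracle, and
  passing between estimate and loss costs the grid sum twice. Otherwise W > a/\<open>kap\<close>;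
  both losses are of order W, and W <= \<open>kap\<close> W^2/a makes them part of the error term.
  Both signs need an argument, because a selected point outside the range may beat the
  oracle.\<close>

lemma pathwise:
  fixes a \<delta>1 \<delta>2 p M0 :: real and n :: nat and x :: "nat \<Rightarrow> real"
  defines "\<Lambda>1 \<equiv> {\<eta>\<in>{- a .. a}. \<exists>j::int. \<eta> = p + real_of_int j * \<delta>1}"
    and "\<Lambda>2 \<equiv> {\<tau>::real. 0 \<le> \<tau> \<and> (\<exists>j\<in>{1..nat \<lceil>1 / \<delta>2\<rceil>}. \<tau> / (\<tau> + 1) = (real j - 1) * \<delta>2)}"
    and "W \<equiv> 1 + abs_mean n x"
  assumes n: "1 \<le> n" and \<delta>: "0 < \<delta>1" "\<delta>1 \<le> a" "0 < \<delta>2" and M0: "abs_mean n \<theta> \<le> M0"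
    and D: "is_arg_min (\<lambda>(\<eta>, \<tau>). A n \<eta> \<tau> x)
          (\<lambda>(\<eta>, \<tau>). \<eta> \<in> location_candidates \<Lambda>1 (location_range n b h x) \<and> \<tau> \<in> \<Lambda>2) (\<eta>D, \<tau>D)"
    and O: "is_arg_min (\<lambda>(\<eta>, \<tau>). L n \<eta> \<tau> x) (\<lambda>(\<eta>, \<tau>). \<eta> \<in> location_range n b h x) (\<eta>O, \<tau>O)"
  shows "\<bar>L n \<eta>D (ennreal \<tau>D) x - L n \<eta>O \<tau>O x\<bar>
    \<le> 2 * (\<Sum>\<eta>\<in>\<Lambda>1. \<Sum>\<tau>\<in>\<Lambda>2. \<bar>A n \<eta> \<tau> x - L n \<eta> (ennreal \<tau>) x\<bar>) + (Cgood + Cbad M0 * kap) * W\<^sup>2 * (\<delta>1 + \<delta>2 + 1 / a)"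
proof -
  define R where "R = location_range n b h x"
  define E where "E = (\<Sum>\<eta>\<in>\<Lambda>1. \<Sum>\<tau>\<in>\<Lambda>2. \<bar>A n \<eta> \<tau> x - L n \<eta> (ennreal \<tau>) x\<bar>)"
  have W: "1 \<le> W" "abs_mean n x \<le> W" using abs_mean_nonneg[of n x] by (auto simp: W_def)
  have WW: "W \<le> W\<^sup>2" using W by (simp add: power2_eq_square)
  have a: "0 < a" using \<delta> by simp
  have M0': "0 \<le> M0" using M0 abs_mean_nonneg[of n \<theta>] by simp
  have C: "0 \<le> Cgood" "0 \<le> Cbad M0"
    using const_pos M0' by (auto simp: Cgood_def Cbad_def intro!: mult_nonneg_nonneg add_nonneg_nonneg)
  have D1: "\<eta>D \<in> location_candidates \<Lambda>1 R" "\<tau>D \<in> \<Lambda>2"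
    and D2: "\<And>\<eta> \<tau>. \<eta> \<in> location_candidates \<Lambda>1 R \<Longrightarrow> \<tau> \<in> \<Lambda>2 \<Longrightarrow> A n \<eta>D \<tau>D x \<le> A n \<eta> \<tau> x"
    using D by (auto simp: is_arg_min_linorder R_def)
  have O1: "\<eta>O \<in> R" and O2: "\<And>\<eta> \<tau>. \<eta> \<in> R \<Longrightarrow> L n \<eta>O \<tau>O x \<le> L n \<eta> \<tau> x"
    using O by (auto simp: is_arg_min_linorder R_def)
  have cand_sub: "location_candidates \<Lambda>1 M \<subseteq> \<Lambda>1" for M by (auto simp: location_candidates_def)
  have O_le: "\<bar>\<eta>O\<bar> \<le> kap * W" using range_bounds(2)[OF n] O1 by (simp add: R_def W_def)
  have R: "R = {emp_quantile n x (bmin n)..emp_quantile n x (bmax n)}" by (simp add: R_def location_range_eq)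
  have E0: "0 \<le> E" unfolding E_def by (intro sum_nonneg) auto
  have \<delta>a: "0 \<le> 1 / a" using a by simp
  have "\<bar>L n \<eta>D (ennreal \<tau>D) x - L n \<eta>O \<tau>O x\<bar> \<le> 2 * E + (Cgood + Cbad M0 * kap) * W\<^sup>2 * (\<delta>1 + \<delta>2 + 1 / a)"
  proof (cases "kap * W \<le> a")
    case True
    have sub: "{emp_quantile n x (bmin n)..emp_quantile n x (bmax n)} \<subseteq> {- a .. a}"
      using range_bounds(2)[OF n, of _ x] True unfolding location_range_eq W_def by (auto simp: abs_le_iff) (smt (verit))+
    note near = location_near[where p=p, OF \<delta>(1,2) sub range_bounds(1)[OF n], folded \<Lambda>1_def R]
    note scale = scale_near[OF \<delta>(3), folded \<Lambda>2_def]
    have E_le: "\<bar>A n \<eta> \<tau> x - L n \<eta> (ennreal \<tau>) x\<bar> \<le> E" if "\<eta> \<in> \<Lambda>1" "\<tau> \<in> \<Lambda>2" for \<eta> \<tau>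
    proof -
      have "\<bar>A n \<eta> \<tau> x - L n \<eta> (ennreal \<tau>) x\<bar> \<le> (\<Sum>\<tau>\<in>\<Lambda>2. \<bar>A n \<eta> \<tau> x - L n \<eta> (ennreal \<tau>) x\<bar>)"
        using scale(2) that by (intro member_le_sum) auto
      also have "\<dots> \<le> E" unfolding E_def using near(3) that
        by (intro member_le_sum[where f="\<lambda>\<eta>. \<Sum>\<tau>\<in>\<Lambda>2. \<bar>A n \<eta> \<tau> x - L n \<eta> (ennreal \<tau>) x\<bar>"]) (auto intro: sum_nonneg)
      finally show ?thesis .
    qed
    obtain \<eta>' where \<eta>': "\<eta>' \<in> location_candidates \<Lambda>1 R" "\<bar>\<eta>' - \<eta>O\<bar> \<le> 2 * \<delta>1" using near(1)[OF O1] by blast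
    obtain \<tau>' where \<tau>': "\<tau>' \<in> \<Lambda>2" "\<bar>alpha 1 \<tau>O - alpha 1 (ennreal \<tau>')\<bar> \<le> \<delta>2" using scale(1) by blast
    have "L n \<eta>' (ennreal \<tau>') x - L n \<eta>O \<tau>O x \<le> B * (\<bar>\<eta>' - \<eta>O\<bar> + ca * \<bar>alpha 1 (ennreal \<tau>') - alpha 1 \<tau>O\<bar> * (abs_mean n x + \<bar>\<eta>O\<bar> + q0 * sqrt v))"
      using L_diff[OF n, of \<eta>' "ennreal \<tau>'" x \<eta>O \<tau>O] by linarith
    also have "\<dots> \<le> B * (2 * \<delta>1 + ca * \<delta>2 * (W + kap * W + q0 * sqrt v * W))"
    proof -
      have "\<bar>alpha 1 (ennreal \<tau>') - alpha 1 \<tau>O\<bar> \<le> \<delta>2" using \<tau>'(2) by simp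
      moreover have "q0 * sqrt v \<le> q0 * sqrt v * W" using const_pos W mult_left_mono[of 1 W "q0 * sqrt v"] by simp
      then have "abs_mean n x + \<bar>\<eta>O\<bar> + q0 * sqrt v \<le> W + kap * W + q0 * sqrt v * W"
        using W(2) O_le by linarith
      moreover have "0 \<le> abs_mean n x + \<bar>\<eta>O\<bar> + q0 * sqrt v" using const_pos abs_mean_nonneg[of n x] by simp
      ultimately have "ca * \<bar>alpha 1 (ennreal \<tau>') - alpha 1 \<tau>O\<bar> * (abs_mean n x + \<bar>\<eta>O\<bar> + q0 * sqrt v)
        \<le> ca * \<delta>2 * (W + kap * W + q0 * sqrt v * W)"
        using const_pos(4) \<delta>(3) by (intro mult_mono[of "ca * _" "ca * _"] mult_left_mono) auto
      then show ?thesis using \<eta>'(2) const_pos by (intro mult_left_mono add_mono) auto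
    qed
    also have "\<dots> \<le> B * (2 * (\<delta>1 * W) + ca * (1 + kap + q0 * sqrt v) * (\<delta>2 * W))"
    proof -
      have "\<delta>1 \<le> \<delta>1 * W" using \<delta> W by simp
      then show ?thesis using const_pos by (intro mult_left_mono) (auto simp: algebra_simps)
    qed
    also have "\<dots> \<le> B * ((2 + ca * (1 + kap + q0 * sqrt v)) * (W * (\<delta>1 + \<delta>2)))"
    proof -
      have "0 \<le> 2 * (\<delta>2 * W) + ca * (1 + kap + q0 * sqrt v) * (\<delta>1 * W)"
        using const_pos \<delta> W by (intro add_nonneg_nonneg mult_nonneg_nonneg) auto
      then show ?thesis using const_pos by (intro mult_left_mono) (auto simp: algebra_simps)
    qed
    also have "\<dots> = Cgood * (W * (\<delta>1 + \<delta>2))" by (simp add: Cgood_def)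
    finally have up: "L n \<eta>' (ennreal \<tau>') x - L n \<eta>O \<tau>O x \<le> Cgood * (W * (\<delta>1 + \<delta>2))" .
    have "L n \<eta>D (ennreal \<tau>D) x \<le> A n \<eta>D \<tau>D x + E" using E_le[of \<eta>D \<tau>D] D1 cand_sub by fastforce
    also have "A n \<eta>D \<tau>D x \<le> A n \<eta>' \<tau>' x" by (rule D2[OF \<eta>'(1) \<tau>'(1)])
    also have "A n \<eta>' \<tau>' x \<le> L n \<eta>' (ennreal \<tau>') x + E" using E_le[of \<eta>' \<tau>'] \<eta>' \<tau>' cand_sub by fastforce
    finally have 1: "L n \<eta>D (ennreal \<tau>D) x - L n \<eta>O \<tau>O x \<le> 2 * E + Cgood * (W * (\<delta>1 + \<delta>2))" using up by linarith
    \<comment> \<open>The oracle is optimal only within the range, so it is compared with a point of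
      the range within \<open>\<delta>1\<close> of the selected location.\<close>
    obtain y where y: "y \<in> R" "\<bar>\<eta>D - y\<bar> \<le> \<delta>1" using near(2)[OF D1(1)] by blast
    have "L n y (ennreal \<tau>D) x - L n \<eta>D (ennreal \<tau>D) x \<le> B * \<bar>y - \<eta>D\<bar>"
      using L_diff[OF n, of y "ennreal \<tau>D" x \<eta>D "ennreal \<tau>D"] by simp
    also have "\<dots> \<le> Cgood * (W * (\<delta>1 + \<delta>2))"
    proof -
      have "B * \<bar>y - \<eta>D\<bar> \<le> B * (\<delta>1 + \<delta>2)" using y \<delta> const_pos by (intro mult_left_mono) auto
      also have "\<dots> \<le> Cgood * (W * (\<delta>1 + \<delta>2))"
      proof (rule mult_mono)
        have "B * 1 \<le> Cgood" unfolding Cgood_def using const_pos by (intro mult_left_mono) (auto intro!: add_increasing2)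
        then show "B \<le> Cgood" by simp
        show "\<delta>1 + \<delta>2 \<le> W * (\<delta>1 + \<delta>2)" using W \<delta> by simp
      qed (use C \<delta> in auto)
      finally show ?thesis .
    qed
    finally have 2: "L n \<eta>O \<tau>O x - L n \<eta>D (ennreal \<tau>D) x \<le> Cgood * (W * (\<delta>1 + \<delta>2))" using O2[OF y(1), of "ennreal \<tau>D"] by linarith
    have "Cgood * (W * (\<delta>1 + \<delta>2)) \<le> (Cgood + Cbad M0 * kap) * (W\<^sup>2 * (\<delta>1 + \<delta>2 + 1 / a))"
    proof (rule mult_mono)
      show "Cgood \<le> Cgood + Cbad M0 * kap" using C const_pos by simp
      show "W * (\<delta>1 + \<delta>2) \<le> W\<^sup>2 * (\<delta>1 + \<delta>2 + 1 / a)"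
        by (rule mult_mono[OF WW]) (use \<delta> \<delta>a in auto)
    qed (use C const_pos W \<delta> in auto)
    then show ?thesis using 1 2 E0 by (simp add: abs_le_iff mult.assoc)
  next
    case False
    have "\<bar>\<eta>D\<bar> \<le> a" using D1(1) cand_sub unfolding \<Lambda>1_def by (fastforce simp: abs_le_iff)
    then have \<eta>D: "\<bar>\<eta>D\<bar> \<le> kap * W" using False by simp
    have aux: "\<bar>L n \<eta> \<tau> x\<bar> \<le> B * (sqrt v + kap * W + q0 * sqrt (2 * v) + M0 + W)" if "\<bar>\<eta>\<bar> \<le> kap * W" for \<eta> \<tau>
      by (rule order_trans[OF L_le[OF n]]) (use that const_pos M0 W in \<open>intro mult_left_mono add_mono, auto\<close>)
    have "\<bar>L n \<eta>D (ennreal \<tau>D) x - L n \<eta>O \<tau>O x\<bar> \<le> 2 * (B * (sqrt v + kap * W + q0 * sqrt (2 * v) + M0 + W))"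
      using aux[OF \<eta>D, of "ennreal \<tau>D"] aux[OF O_le, of \<tau>O] by linarith
    also have "\<dots> \<le> 2 * (B * (sqrt v * W + kap * W + q0 * sqrt (2 * v) * W + M0 * W + W))"
    proof -
      have "1 \<le> W \<Longrightarrow> 0 \<le> c \<Longrightarrow> c \<le> c * W" for c using mult_left_mono[of 1 W c] by simp
      note m = this[OF W(1)]
      have "0 \<le> q0 * sqrt (2 * v)" using const_pos by simp
      then show ?thesis using const_pos M0' by (intro mult_left_mono add_mono m order_refl) auto
    qed
    also have "\<dots> = Cbad M0 * W" by (simp add: Cbad_def algebra_simps)
    also have "\<dots> \<le> Cbad M0 * (kap * W\<^sup>2 * (1 / a))"
    proof (intro mult_left_mono C)
      have "W * a \<le> W * (kap * W)" using False W by (intro mult_left_mono) auto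
      then show "W \<le> kap * W\<^sup>2 * (1 / a)" using a by (simp add: field_simps power2_eq_square)
    qed
    also have "\<dots> = (Cbad M0 * kap) * (W\<^sup>2 * (1 / a))" by simp
    also have "\<dots> \<le> (Cgood + Cbad M0 * kap) * (W\<^sup>2 * (\<delta>1 + \<delta>2 + 1 / a))"
      using C const_pos \<delta> \<delta>a by (intro mult_mono mult_left_mono) auto
    finally show ?thesis using E0 by (simp add: mult.assoc)
  qed
  then show ?thesis by (simp add: E_def)
qed

end

section \<open>Measurability and moments over the sample\<close>

lemma measurable_G[measurable]: "(\<lambda>w. G w \<beta>) \<in> borel_measurable borel"
  by (rule borel_measurable_continuous_onI)
     (auto intro!: DERIV_continuous_on has_field_derivative_at_within[OF DERIV_G])

lemma unit_grid_near:
  fixes t :: real assumes "0 \<le> t" "t \<le> 1"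
  shows "\<exists>i\<le>k + 1. \<bar>real i / real (k + 1) - t\<bar> \<le> 1 / real (k + 1)"
proof -
  define i where "i = nat \<lfloor>t * real (k + 1)\<rfloor>"
  have t0: "0 \<le> t * real (k + 1)" "t * real (k + 1) \<le> 1 * real (k + 1)" using assms by (auto intro!: mult_right_mono)
  have i: "real i \<le> t * real (k + 1)" "t * real (k + 1) < real i + 1" using t0 unfolding i_def by linarith+
  have "real i \<le> real (k + 1)" using order_trans[OF i(1) t0(2)] by simp
  then have "i \<le> k + 1" unfolding of_nat_le_iff .
  moreover have "real i / real (k + 1) \<le> t" using i by (simp add: divide_le_eq)
  moreover have "t \<le> (real i + 1) / real (k + 1)" using i by (simp add: le_divide_eq)
  ultimately show ?thesis by (intro exI[of _ i]) (auto simp: add_divide_distrib abs_le_iff)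
qed

context bounded_model
begin

lemma component_measurable: "i \<in> {1..n} \<Longrightarrow> (\<lambda>x. x i) \<in> borel_measurable (P n)"
proof -
  assume i: "i \<in> {1..n}"
  have "(\<lambda>x. x i) \<in> PiM {1..n} (law n) \<rightarrow>\<^sub>M law n i" by (rule measurable_component_singleton[OF i])
  then show ?thesis unfolding P_eq by (simp add: law_def cong: measurable_cong_sets)
qed

lemma prob_space_P: "prob_space (P n)"
proof -
  interpret product_prob_space "law n" "{1..n}" by (rule product_law)
  show ?thesis unfolding P_eq by (rule P.prob_space_axioms)
qed

lemma abs_mean_measurable: "(\<lambda>x. abs_mean n x) \<in> borel_measurable (P n)"
  unfolding abs_mean_def using component_measurable
  by (intro borel_measurable_divide borel_measurable_sum borel_measurable_abs) auto

text \<open>The mean absolute value of the sample is at most that of \<theta> plus that of the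
  noise, and the square of the latter is at most the mean squared noise. The square is needed
  because bad samples cost W^2/a.\<close>

lemma second_moment:
  assumes n: "1 \<le> n" and M0: "abs_mean n \<theta> \<le> M0"
  shows "integrable (P n) (\<lambda>x. (1 + abs_mean n x)\<^sup>2)"
    and "(\<integral>x. (1 + abs_mean n x)\<^sup>2 \<partial>P n) \<le> 2 * (1 + M0)\<^sup>2 + 2 * v"
proof -
  interpret product_prob_space "law n" "{1..n}" by (rule product_law)
  define H where "H x = 2 * (1 + M0)\<^sup>2 + 2 * ((\<Sum>i=1..n. (x i - \<theta> i)\<^sup>2) / real n)" for x
  have comp: "integrable (PiM {1..n} (law n)) (\<lambda>x. (x i - \<theta> i)\<^sup>2)"
    "(\<integral>x. (x i - \<theta> i)\<^sup>2 \<partial>PiM {1..n} (law n)) = \<nu>p i" if i: "i \<in> {1..n}" for i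
  proof -
    have s: "0 < sqrt (\<nu>p i)" using pos[of i] i by simp
    have I: "integrable N (\<lambda>p. (\<theta> i + sqrt (\<nu>p i) * p - \<theta> i)\<^sup>2)" by (simp add: power_mult_distrib)
    have law: "law n i = density lborel (normal_density (\<theta> i) (sqrt (\<nu>p i)))" using i by (simp add: law_def)
    note c = normal_law_integral[where f="\<lambda>y. (y - \<theta> i)\<^sup>2", OF s I, folded law]
    show "integrable (PiM {1..n} (law n)) (\<lambda>x. (x i - \<theta> i)\<^sup>2)" by (rule PiM_component_integral(1)[OF i c(1)])
    have "(\<integral>x. (x i - \<theta> i)\<^sup>2 \<partial>PiM {1..n} (law n)) = (\<integral>p. (\<theta> i + sqrt (\<nu>p i) * p - \<theta> i)\<^sup>2 \<partial>N)"
      by (rule trans[OF PiM_component_integral(2)[OF i c(1)] c(2)])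
    also have "\<dots> = \<nu>p i" using pos[of i] i by (simp add: power_mult_distrib)
    finally show "(\<integral>x. (x i - \<theta> i)\<^sup>2 \<partial>PiM {1..n} (law n)) = \<nu>p i" .
  qed
  have SI: "integrable (PiM {1..n} (law n)) (\<lambda>x. \<Sum>i=1..n. (x i - \<theta> i)\<^sup>2)"
    by (intro Bochner_Integration.integrable_sum comp)
  have SE: "(\<integral>x. (\<Sum>i=1..n. (x i - \<theta> i)\<^sup>2) \<partial>PiM {1..n} (law n)) = (\<Sum>i=1..n. \<nu>p i)"
    using comp by (subst Bochner_Integration.integral_sum) (auto intro!: sum.cong)
  have HI: "integrable (P n) H" unfolding H_def[abs_def] P_eq using SI by (simp del: One_nat_def)
  have le: "(1 + abs_mean n x)\<^sup>2 \<le> H x" for x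
  proof -
    define y where "y i = x i - \<theta> i" for i
    have "abs_mean n x \<le> abs_mean n \<theta> + abs_mean n y"
      unfolding abs_mean_def add_divide_distrib[symmetric] sum.distrib[symmetric]
      by (intro divide_right_mono sum_mono) (auto simp: y_def)
    then have "1 + abs_mean n x \<le> (1 + M0) + abs_mean n y" using M0 by simp
    then have "(1 + abs_mean n x)\<^sup>2 \<le> ((1 + M0) + abs_mean n y)\<^sup>2"
      using abs_mean_nonneg[of n x] by (intro power_mono) auto
    also have "\<dots> \<le> 2 * (1 + M0)\<^sup>2 + 2 * (abs_mean n y)\<^sup>2"
      using zero_le_power2[of "(1 + M0) - abs_mean n y"] by (simp add: power2_eq_square algebra_simps)
    also have "(abs_mean n y)\<^sup>2 \<le> (\<Sum>i=1..n. (y i)\<^sup>2) / real n"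
    proof -
      have "(\<Sum>i=1..n. \<bar>y i\<bar>)\<^sup>2 \<le> (\<Sum>i=1..n. \<bar>y i\<bar>\<^sup>2) * real (card {1..n})" by (rule sum_squared_le_sum_of_squares)
      then show ?thesis using n by (simp add: abs_mean_def power_divide power2_eq_square[of "real n"] divide_simps mult_ac)
    qed
    finally show ?thesis by (simp add: H_def y_def)
  qed
  show I: "integrable (P n) (\<lambda>x. (1 + abs_mean n x)\<^sup>2)"
  proof (rule Bochner_Integration.integrable_bound[OF HI])
    show "(\<lambda>x. (1 + abs_mean n x)\<^sup>2) \<in> borel_measurable (P n)" using abs_mean_measurable by measurable
    have "norm ((1 + abs_mean n x)\<^sup>2) \<le> norm (H x)" for x using le[of x] by simp
    then show "AE x in P n. norm ((1 + abs_mean n x)\<^sup>2) \<le> norm (H x)" by (intro AE_I2)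
  qed
  have "(\<integral>x. (1 + abs_mean n x)\<^sup>2 \<partial>P n) \<le> (\<integral>x. H x \<partial>P n)" by (rule integral_mono[OF I HI le])
  also have "\<dots> = 2 * (1 + M0)\<^sup>2 + 2 * ((\<Sum>i=1..n. \<nu>p i) / real n)"
    unfolding H_def P_eq using SI SE by (simp add: P.prob_space del: One_nat_def)
  also have "(\<Sum>i=1..n. \<nu>p i) / real n \<le> v"
    using sum_bounded_above[of "{1..n}" \<nu>p v] v n by (simp add: divide_le_eq mult.commute)
  finally show "(\<integral>x. (1 + abs_mean n x)\<^sup>2 \<partial>P n) \<le> 2 * (1 + M0)\<^sup>2 + 2 * v" by simp
qed

text \<open>The scale enters the loss only through the weights \<open>alpha\<close>, so it is their
  measurability that is asked for.\<close>

lemma L_measurable: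
  assumes "\<eta> \<in> borel_measurable (P n)" "\<And>i. (\<lambda>x. alpha (\<nu>p i) (\<tau> x)) \<in> borel_measurable (P n)"
  shows "(\<lambda>x. L n (\<eta> x) (\<tau> x) x) \<in> borel_measurable (P n)"
  unfolding avg_loss_def predictor_def coord_loss_def coord_predictor_def
proof (intro borel_measurable_times borel_measurable_const borel_measurable_sum)
  fix i assume i: "i \<in> {1..n}"
  note [measurable] = assms component_measurable[OF i]
  show "(\<lambda>x. G ((alpha (\<nu>p i) (\<tau> x) * x i + (1 - alpha (\<nu>p i) (\<tau> x)) * \<eta> x +
      sqrt (\<nu>f i + alpha (\<nu>p i) (\<tau> x) * \<nu>p i) * Phi_inv (btilde (b i) (h i)) - \<theta> i) / sqrt (\<nu>f i)) (btilde (b i) (h i)))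
    \<in> borel_measurable (P n)"
    by (rule measurable_compose[OF _ measurable_G]) measurable
qed

lemma emp_quantile_measurable:
  assumes n: "1 \<le> n" and \<beta>: "0 < \<beta>" "\<beta> \<le> 1"
  shows "(\<lambda>x. emp_quantile n x \<beta>) \<in> borel_measurable (P n)"
proof (subst borel_measurable_iff_le, intro allI)
  fix t
  have card: "real (card {i\<in>{1..n}. x i \<le> t}) = (\<Sum>i=1..n. indicator {..t} (x i))" for x :: "nat \<Rightarrow> real"
  proof -
    have "(\<Sum>i=1..n. indicator {..t} (x i)) = (\<Sum>i=1..n. if x i \<le> t then 1 else 0 :: real)"
      by (intro sum.cong) (auto simp: indicator_def)
    also have "\<dots> = real (card {i\<in>{1..n}. x i \<le> t})" by (simp add: sum.If_cases Int_def)
    finally show ?thesis ..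
  qed
  have [measurable]: "(\<lambda>x. \<Sum>i=1..n. indicator {..t} (x i) :: real) \<in> borel_measurable (P n)"
    using component_measurable by (intro borel_measurable_sum measurable_compose[OF _ borel_measurable_indicator]) auto
  have "{x \<in> space (P n). \<beta> \<le> (\<Sum>i=1..n. indicator {..t} (x i)) / real n} \<in> sets (P n)" by measurable
  then show "{x \<in> space (P n). emp_quantile n x \<beta> \<le> t} \<in> sets (P n)"
    by (simp only: emp_quantile_le_iff[OF n \<beta>] card)
qed

text \<open>The \<tau> with \<tau>/(\<tau> + 1) = j/(k + 1), where j = k + 1 gives \<tau> =
  \<infinity>.\<close>

definition "scale_pt j k = (if j = k + 1 then \<infinity> else ennreal ((real j / real (k + 1)) / (1 - real j / real (k + 1))))"

lemma alpha_scale_pt: "j \<le> k + 1 \<Longrightarrow> alpha 1 (scale_pt j k) = real j / real (k + 1)"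
proof (cases "j = k + 1")
  case False
  assume "j \<le> k + 1"
  then have "real j < real (k + 1)" using False by simp
  define u where "u = real j / real (k + 1)"
  have u: "0 \<le> u" "u < 1" using \<open>real j < real (k + 1)\<close> by (auto simp: u_def)
  have "u / (1 - u) + 1 = 1 / (1 - u)" using u by (simp add: field_simps)
  then have "alpha 1 (ennreal (u / (1 - u))) = u" using u by (simp add: alpha_one_ennreal)
  moreover have "scale_pt j k = ennreal (u / (1 - u))" using False by (simp only: scale_pt_def u_def if_False)
  ultimately show ?thesis by (simp only: u_def)
qed (simp add: scale_pt_def alpha_def)

text \<open>The oracle predictor need not be measurable, but its loss is a limit of minima over finite
  grids.\<close>

lemma oracle_loss_measurable:
  assumes n: "1 \<le> n"
    and O: "\<And>x. x \<in> space (P n) \<Longrightarrow> is_arg_min (\<lambda>(\<eta>, \<tau>). L n \<eta> \<tau> x) (\<lambda>(\<eta>, \<tau>). \<eta> \<in> location_range n b h x) (\<eta>O x, \<tau>O x)"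
  shows "(\<lambda>x. L n (\<eta>O x) (\<tau>O x) x) \<in> borel_measurable (P n)"
proof -
  define m1 where "m1 x = emp_quantile n x (bmin n)" for x
  define m2 where "m2 x = emp_quantile n x (bmax n)" for x
  \<comment> \<open>Equispaced points of the random range; its end points are quantiles and hence
    measurable.\<close>
  define e where "e i k x = m1 x + real i / real (k + 1) * (m2 x - m1 x)" for i k :: nat and x
  define F where "F k x = Min ((\<lambda>w. L n (e (fst w) k x) (scale_pt (snd w) k) x) ` ({0..k + 1} \<times> {0..k + 1}))" for k x
  define c where "c x = B * ((m2 x - m1 x) + ca * (abs_mean n x + \<bar>\<eta>O x\<bar> + q0 * sqrt v))" for x
  have bb: "0 < bmin n" "bmin n \<le> 1" "0 < bmax n" "bmax n \<le> 1" using bmin_bmax[OF n] bl bu by linarith+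
  have m[measurable]: "m1 \<in> borel_measurable (P n)" "m2 \<in> borel_measurable (P n)"
    unfolding m1_def[abs_def] m2_def[abs_def] using bb by (intro emp_quantile_measurable n; simp)+
  have m12: "m1 x \<le> m2 x" for x using range_bounds(1)[OF n] by (simp add: m1_def m2_def)
  have range: "location_range n b h x = {m1 x..m2 x}" for x by (simp add: location_range_eq m1_def m2_def)
  have FM: "F k \<in> borel_measurable (P n)" for k
    unfolding F_def[abs_def] by (intro borel_measurable_Min L_measurable) (auto simp: e_def)
  have lim: "(\<lambda>k. F k x) \<longlonglongrightarrow> L n (\<eta>O x) (\<tau>O x) x" if x: "x \<in> space (P n)" for x
  proof -
    have O1: "\<eta>O x \<in> {m1 x..m2 x}" and O2: "\<And>\<eta> \<tau>. \<eta> \<in> {m1 x..m2 x} \<Longrightarrow> L n (\<eta>O x) (\<tau>O x) x \<le> L n \<eta> \<tau> x"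
      using O[OF x] by (auto simp: is_arg_min_linorder range)
    have lower: "L n (\<eta>O x) (\<tau>O x) x \<le> F k x" for k
      unfolding F_def
    proof (rule Min.boundedI)
      fix y assume "y \<in> (\<lambda>w. L n (e (fst w) k x) (scale_pt (snd w) k) x) ` ({0..k + 1} \<times> {0..k + 1})"
      then obtain i j where y: "y = L n (e i k x) (scale_pt j k) x" "i \<le> k + 1" by auto
      have "real i / real (k + 1) * (m2 x - m1 x) \<le> 1 * (m2 x - m1 x)"
        using y(2) m12[of x] by (intro mult_right_mono) auto
      then have "e i k x \<in> {m1 x..m2 x}" using m12[of x] by (auto simp: e_def)
      then show "L n (\<eta>O x) (\<tau>O x) x \<le> y" unfolding y(1) by (rule O2)
    qed auto
    have upper: "F k x \<le> L n (\<eta>O x) (\<tau>O x) x + c x / real (k + 1)" for k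
    proof -
      define u where "u = (if m1 x = m2 x then 0 else (\<eta>O x - m1 x) / (m2 x - m1 x))"
      have u: "0 \<le> u" "u \<le> 1" "\<eta>O x = m1 x + u * (m2 x - m1 x)" using O1 m12[of x] by (auto simp: u_def)
      obtain i where i: "i \<le> k + 1" "\<bar>real i / real (k + 1) - u\<bar> \<le> 1 / real (k + 1)"
        using unit_grid_near[OF u(1,2)] by blast
      obtain j where j: "j \<le> k + 1" "\<bar>real j / real (k + 1) - alpha 1 (\<tau>O x)\<bar> \<le> 1 / real (k + 1)"
        using unit_grid_near[where t="alpha 1 (\<tau>O x)" and k=k, OF alpha_bounds(1)[OF zero_less_one] alpha_bounds(2)[OF zero_less_one]] by blast
      have ei: "\<bar>e i k x - \<eta>O x\<bar> \<le> 1 / real (k + 1) * (m2 x - m1 x)"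
      proof -
        have "e i k x - \<eta>O x = (real i / real (k + 1) - u) * (m2 x - m1 x)" by (simp add: e_def u(3) algebra_simps)
        then have "\<bar>e i k x - \<eta>O x\<bar> = \<bar>real i / real (k + 1) - u\<bar> * (m2 x - m1 x)" using m12[of x] by (simp add: abs_mult)
        also have "\<dots> \<le> 1 / real (k + 1) * (m2 x - m1 x)" using i(2) m12[of x] by (intro mult_right_mono) auto
        finally show ?thesis .
      qed
      let ?K = "abs_mean n x + \<bar>\<eta>O x\<bar> + q0 * sqrt v"
      have K: "0 \<le> ?K" using const_pos abs_mean_nonneg[of n x] by simp
      have "F k x \<le> L n (e i k x) (scale_pt j k) x"
        unfolding F_def using i j by (intro Min.coboundedI) (auto intro!: image_eqI[of _ _ "(i, j)"])
      also have "\<dots> \<le> L n (\<eta>O x) (\<tau>O x) x + B * (\<bar>e i k x - \<eta>O x\<bar> + ca * \<bar>alpha 1 (scale_pt j k) - alpha 1 (\<tau>O x)\<bar> * ?K)"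
        using L_diff[OF n, of "e i k x" "scale_pt j k" x "\<eta>O x" "\<tau>O x"] by linarith
      also have "\<dots> \<le> L n (\<eta>O x) (\<tau>O x) x + B * (1 / real (k + 1) * (m2 x - m1 x) + ca * (1 / real (k + 1)) * ?K)"
        unfolding alpha_scale_pt[OF j(1)] using ei j(2) const_pos K
        by (intro add_left_mono mult_left_mono add_mono mult_right_mono) auto
      also have "\<dots> = L n (\<eta>O x) (\<tau>O x) x + c x / real (k + 1)" by (simp add: c_def algebra_simps add_divide_distrib diff_divide_distrib)
      finally show ?thesis .
    qed
    have "(\<lambda>k. L n (\<eta>O x) (\<tau>O x) x + c x / real (k + 1)) \<longlonglongrightarrow> L n (\<eta>O x) (\<tau>O x) x + 0"
    proof (intro tendsto_add tendsto_const)
      have "(\<lambda>k. c x * (1 / real (k + 1))) \<longlonglongrightarrow> c x * 0" by (intro tendsto_mult_left) real_asymp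
      then show "(\<lambda>k. c x / real (k + 1)) \<longlonglongrightarrow> 0" by simp
    qed
    then have up: "(\<lambda>k. L n (\<eta>O x) (\<tau>O x) x + c x / real (k + 1)) \<longlonglongrightarrow> L n (\<eta>O x) (\<tau>O x) x" by simp
    show ?thesis
    proof (rule tendsto_sandwich[OF _ _ tendsto_const up])
      show "\<forall>\<^sub>F k in sequentially. L n (\<eta>O x) (\<tau>O x) x \<le> F k x" by (intro always_eventually allI lower)
      show "\<forall>\<^sub>F k in sequentially. F k x \<le> L n (\<eta>O x) (\<tau>O x) x + c x / real (k + 1)" by (intro always_eventually allI upper)
    qed
  qed
  show ?thesis by (rule borel_measurable_LIMSEQ_real[OF lim FM])
qed

definition "Ctot M0 = (Cgood + Cbad M0 * kap) * (2 * (1 + M0)\<^sup>2 + 2 * v)"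

text \<open>Expectation of \<open>pathwise\<close>: each grid point contributes one
  \<open>rate n\<close>, and W^2 has bounded mean. Both losses must be shown integrable, for the
  difference of the integrals to be the integral of the difference.\<close>

lemma regret_bound:
  fixes a \<delta>1 \<delta>2 p M0 :: real and n :: nat
  defines "\<Lambda>1 \<equiv> {\<eta>\<in>{- a .. a}. \<exists>j::int. \<eta> = p + real_of_int j * \<delta>1}"
    and "\<Lambda>2 \<equiv> {\<tau>::real. 0 \<le> \<tau> \<and> (\<exists>j\<in>{1..nat \<lceil>1 / \<delta>2\<rceil>}. \<tau> / (\<tau> + 1) = (real j - 1) * \<delta>2)}"
  assumes n: "3 \<le> n" and \<delta>: "0 < \<delta>1" "\<delta>1 \<le> a" "0 < \<delta>2" and M0: "abs_mean n \<theta> \<le> M0"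
    and meas: "\<eta>D \<in> borel_measurable (P n)" "\<tau>D \<in> borel_measurable (P n)"
    and D: "\<And>x. x \<in> space (P n) \<Longrightarrow> is_arg_min (\<lambda>(\<eta>, \<tau>). A n \<eta> \<tau> x)
          (\<lambda>(\<eta>, \<tau>). \<eta> \<in> location_candidates \<Lambda>1 (location_range n b h x) \<and> \<tau> \<in> \<Lambda>2) (\<eta>D x, \<tau>D x)"
    and O: "\<And>x. x \<in> space (P n) \<Longrightarrow> is_arg_min (\<lambda>(\<eta>, \<tau>). L n \<eta> \<tau> x) (\<lambda>(\<eta>, \<tau>). \<eta> \<in> location_range n b h x) (\<eta>O x, \<tau>O x)"
  shows "\<bar>(\<integral>x. L n (\<eta>D x) (ennreal (\<tau>D x)) x \<partial>P n) - (\<integral>x. L n (\<eta>O x) (\<tau>O x) x \<partial>P n)\<bar>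
    \<le> 2 * ((2 * a / \<delta>1 + 1) * (1 / \<delta>2 + 1) * rate n) + Ctot M0 * (\<delta>1 + \<delta>2 + 1 / a)"
proof -
  interpret P: prob_space "P n" by (rule prob_space_P)
  have n1: "1 \<le> n" using n by simp
  have a: "0 < a" using \<delta> by simp
  have M0': "0 \<le> M0" using M0 abs_mean_nonneg[of n \<theta>] by simp
  define W where "W x = 1 + abs_mean n x" for x
  have W: "1 \<le> W x" "W x \<le> (W x)\<^sup>2" for x
    using abs_mean_nonneg[of n x] by (auto simp: W_def power2_eq_square)
  note W2 = second_moment[OF n1 M0, folded W_def]
  define E where "E x = (\<Sum>\<eta>\<in>\<Lambda>1. \<Sum>\<tau>\<in>\<Lambda>2. \<bar>A n \<eta> \<tau> x - L n \<eta> (ennreal \<tau>) x\<bar>)" for x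
  define C where "C = Cgood + Cbad M0 * kap"
  have C: "0 \<le> C" using const_pos M0'
    by (auto simp: C_def Cgood_def Cbad_def intro!: mult_nonneg_nonneg add_nonneg_nonneg)
  let ?e = "\<delta>1 + \<delta>2 + 1 / a"
  have e: "0 \<le> ?e" using \<delta> a by simp
  have pw: "\<bar>L n (\<eta>D x) (ennreal (\<tau>D x)) x - L n (\<eta>O x) (\<tau>O x) x\<bar> \<le> 2 * E x + C * (W x)\<^sup>2 * ?e"
    if x: "x \<in> space (P n)" for x
    unfolding E_def C_def W_def
    using pathwise[OF n1 \<delta> M0 D[OF x, unfolded \<Lambda>1_def \<Lambda>2_def] O[OF x]] unfolding \<Lambda>1_def \<Lambda>2_def .
  have fin: "finite \<Lambda>1" "finite \<Lambda>2" "real (card \<Lambda>1) \<le> 2 * a / \<delta>1 + 1" "real (card \<Lambda>2) \<le> 1 / \<delta>2 + 1"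
  proof -
    \<comment> \<open>A dummy range: only the finiteness and the cardinality of the grid are taken
      from \<open>location_near\<close>.\<close>
    have "{0..0} \<subseteq> {- a..a}" using a by simp
    note location = location_near(3,4)[where p=p, OF \<delta>(1,2) this order_refl]
    show "finite \<Lambda>1" "finite \<Lambda>2" "real (card \<Lambda>1) \<le> 2 * a / \<delta>1 + 1" "real (card \<Lambda>2) \<le> 1 / \<delta>2 + 1"
      unfolding \<Lambda>1_def \<Lambda>2_def by (rule location scale_near(2,3)[OF \<delta>(3)])+
  qed
  have \<Lambda>2_pos: "0 \<le> \<tau>" if "\<tau> \<in> \<Lambda>2" for \<tau> using that by (simp add: \<Lambda>2_def)
  have EI: "integrable (P n) E"
    unfolding E_def[abs_def] using ARE_error(1)[OF n \<Lambda>2_pos]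
    by (intro Bochner_Integration.integrable_sum integrable_abs) auto
  \<comment> \<open>The rate dominates the mean of an absolute value, here at \<tau> = 0.\<close>
  have rate0: "0 \<le> rate n"
    using order_trans[OF _ ARE_error(2)[OF n order_refl, of 0]] by simp
  have "(\<integral>x. E x \<partial>P n) = (\<Sum>\<eta>\<in>\<Lambda>1. \<Sum>\<tau>\<in>\<Lambda>2. \<integral>x. \<bar>A n \<eta> \<tau> x - L n \<eta> (ennreal \<tau>) x\<bar> \<partial>P n)"
    unfolding E_def using ARE_error(1)[OF n \<Lambda>2_pos]
    by (subst Bochner_Integration.integral_sum, intro Bochner_Integration.integrable_sum integrable_abs, simp,
        intro sum.cong refl Bochner_Integration.integral_sum integrable_abs) auto
  also have "\<dots> \<le> (\<Sum>\<eta>\<in>\<Lambda>1. \<Sum>\<tau>\<in>\<Lambda>2. rate n)"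
    by (intro sum_mono ARE_error(2)[OF n \<Lambda>2_pos])
  also have "\<dots> = real (card \<Lambda>1) * real (card \<Lambda>2) * rate n" by simp
  also have "\<dots> \<le> (2 * a / \<delta>1 + 1) * (1 / \<delta>2 + 1) * rate n"
    using fin rate0 \<delta> a by (intro mult_right_mono mult_mono) auto
  finally have Ele: "(\<integral>x. E x \<partial>P n) \<le> (2 * a / \<delta>1 + 1) * (1 / \<delta>2 + 1) * rate n" .
  have measD: "(\<lambda>x. L n (\<eta>D x) (ennreal (\<tau>D x)) x) \<in> borel_measurable (P n)"
  proof (rule L_measurable[OF meas(1)])
    fix i
    have "(\<lambda>x. enn2real (ennreal (\<tau>D x)) / (enn2real (ennreal (\<tau>D x)) + \<nu>p i)) \<in> borel_measurable (P n)"
      using meas(2) by measurable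
    then show "(\<lambda>x. alpha (\<nu>p i) (ennreal (\<tau>D x))) \<in> borel_measurable (P n)" by (simp add: alpha_def)
  qed
  have measO: "(\<lambda>x. L n (\<eta>O x) (\<tau>O x) x) \<in> borel_measurable (P n)" by (rule oracle_loss_measurable[OF n1 O])
  \<comment> \<open>Depends on n through a, which is harmless, as it serves only to dominate the
    losses.\<close>
  define c where "c = B * (sqrt v + a + kap + q0 * sqrt (2 * v) + M0 + 1)"
  have bnd: "\<bar>L n \<eta> \<tau> x\<bar> \<le> c * (W x)\<^sup>2" if "\<bar>\<eta>\<bar> \<le> a \<or> \<bar>\<eta>\<bar> \<le> kap * W x" for \<eta> \<tau> x
  proof -
    have W1: "1 \<le> (W x)\<^sup>2" using W[of x] by simp
    have g: "r \<le> r * (W x)\<^sup>2" if "0 \<le> r" for r using mult_left_mono[OF W1 that] by simp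
    have q: "0 \<le> q0 * sqrt (2 * v)" using const_pos by simp
    have "kap * W x \<le> kap * (W x)\<^sup>2" using W(2)[of x] const_pos by (intro mult_left_mono) auto
    moreover have "0 \<le> kap * W x" using W[of x] const_pos by simp
    ultimately have "\<bar>\<eta>\<bar> \<le> a * (W x)\<^sup>2 + kap * (W x)\<^sup>2" using that g[of a] a by linarith
    then have "sqrt v + \<bar>\<eta>\<bar> + q0 * sqrt (2 * v) + abs_mean n \<theta> + abs_mean n x
      \<le> sqrt v * (W x)\<^sup>2 + (a * (W x)\<^sup>2 + kap * (W x)\<^sup>2) + q0 * sqrt (2 * v) * (W x)\<^sup>2 + M0 * (W x)\<^sup>2 + (W x)\<^sup>2"
    proof -
      have "abs_mean n x = W x - 1" by (simp add: W_def)
      moreover have "sqrt v \<le> sqrt v * (W x)\<^sup>2" using const_pos by (intro g) simp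
      ultimately show ?thesis
        using \<open>\<bar>\<eta>\<bar> \<le> a * (W x)\<^sup>2 + kap * (W x)\<^sup>2\<close> g[OF q] g[OF M0'] M0 W[of x] by linarith
    qed
    then have "B * (sqrt v + \<bar>\<eta>\<bar> + q0 * sqrt (2 * v) + abs_mean n \<theta> + abs_mean n x)
      \<le> B * (sqrt v * (W x)\<^sup>2 + (a * (W x)\<^sup>2 + kap * (W x)\<^sup>2) + q0 * sqrt (2 * v) * (W x)\<^sup>2 + M0 * (W x)\<^sup>2 + (W x)\<^sup>2)"
      using const_pos by (intro mult_left_mono) auto
    also have "\<dots> = c * (W x)\<^sup>2" by (simp add: c_def algebra_simps)
    finally show ?thesis using L_le[OF n1, of \<eta> \<tau> x] by linarith
  qed
  have c0: "0 \<le> c" using const_pos a M0' by (auto simp: c_def intro!: mult_nonneg_nonneg add_nonneg_nonneg)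
  have cI: "integrable (P n) (\<lambda>x. c * (W x)\<^sup>2)" using W2(1) by simp
  have ID: "integrable (P n) (\<lambda>x. L n (\<eta>D x) (ennreal (\<tau>D x)) x)"
  proof (rule Bochner_Integration.integrable_bound[OF cI measD], rule AE_I2)
    fix x assume x: "x \<in> space (P n)"
    have "\<eta>D x \<in> \<Lambda>1" using D[OF x] by (auto simp: is_arg_min_def location_candidates_def split: if_splits)
    then have "\<bar>\<eta>D x\<bar> \<le> a" by (auto simp: \<Lambda>1_def abs_le_iff)
    then show "norm (L n (\<eta>D x) (ennreal (\<tau>D x)) x) \<le> norm (c * (W x)\<^sup>2)" using bnd[of "\<eta>D x"] c0 by (simp add: abs_mult)
  qed
  have IO: "integrable (P n) (\<lambda>x. L n (\<eta>O x) (\<tau>O x) x)"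
  proof (rule Bochner_Integration.integrable_bound[OF cI measO], rule AE_I2)
    fix x assume x: "x \<in> space (P n)"
    have "\<eta>O x \<in> location_range n b h x" using O[OF x] by (auto simp: is_arg_min_def)
    then have "\<bar>\<eta>O x\<bar> \<le> kap * W x" unfolding W_def by (rule range_bounds(2)[OF n1])
    then show "norm (L n (\<eta>O x) (\<tau>O x) x) \<le> norm (c * (W x)\<^sup>2)" using bnd[of "\<eta>O x"] c0 by (simp add: abs_mult)
  qed
  have RI: "integrable (P n) (\<lambda>x. 2 * E x + C * (W x)\<^sup>2 * ?e)" using EI W2(1) by simp
  have "\<bar>(\<integral>x. L n (\<eta>D x) (ennreal (\<tau>D x)) x \<partial>P n) - (\<integral>x. L n (\<eta>O x) (\<tau>O x) x \<partial>P n)\<bar>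
    = \<bar>\<integral>x. L n (\<eta>D x) (ennreal (\<tau>D x)) x - L n (\<eta>O x) (\<tau>O x) x \<partial>P n\<bar>" using ID IO by simp
  also have "\<dots> \<le> (\<integral>x. \<bar>L n (\<eta>D x) (ennreal (\<tau>D x)) x - L n (\<eta>O x) (\<tau>O x) x\<bar> \<partial>P n)" by (rule integral_abs_bound)
  also have "\<dots> \<le> (\<integral>x. 2 * E x + C * (W x)\<^sup>2 * ?e \<partial>P n)"
    using ID IO by (intro integral_mono RI pw integrable_abs Bochner_Integration.integrable_diff)
  also have "\<dots> = 2 * (\<integral>x. E x \<partial>P n) + C * ?e * (\<integral>x. (W x)\<^sup>2 \<partial>P n)"
  proof -
    have "C * (W x)\<^sup>2 * ?e = (C * ?e) * (W x)\<^sup>2" for x by simp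
    then show ?thesis using EI W2(1) by (simp only: Bochner_Integration.integral_add integrable_mult_right integral_mult_right_zero)
  qed
  also have "\<dots> \<le> 2 * ((2 * a / \<delta>1 + 1) * (1 / \<delta>2 + 1) * rate n) + C * ?e * (2 * (1 + M0)\<^sup>2 + 2 * v)"
    using Ele W2(2) C e by (intro add_mono mult_left_mono) auto
  also have "C * ?e * (2 * (1 + M0)\<^sup>2 + 2 * v) = Ctot M0 * ?e" by (simp add: Ctot_def C_def)
  finally show ?thesis .
qed

end

section \<open>Passage to the limit\<close>

lemma less_INF_ereal_real:
  assumes "ereal c < (INF i\<in>S. ereal (f i))"
  shows "\<exists>r>c. \<forall>i\<in>S. r \<le> f i"
proof -
  obtain r where r: "ereal c < ereal r" "ereal r < (INF i\<in>S. ereal (f i))" using ereal_dense2[OF assms] by blast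
  have "r \<le> f i" if "i \<in> S" for i
    using less_INF_D[OF r(2) that] by simp
  then show ?thesis using r(1) by auto
qed

lemma SUP_less_ereal_real:
  assumes "(SUP i\<in>S. ereal (f i)) < y"
  shows "\<exists>r. ereal r < y \<and> (\<forall>i\<in>S. f i \<le> r)"
proof -
  obtain r where r: "(SUP i\<in>S. ereal (f i)) < ereal r" "ereal r < y" using ereal_dense2[OF assms] by blast
  have "f i \<le> r" if "i \<in> S" for i
    using SUP_lessD[OF r(1) that] by simp
  then show ?thesis using r(2) by blast
qed

lemma filterlim_a_seq: "filterlim a_seq at_top sequentially"
  unfolding a_seq_def by real_asymp

text \<open>The factor ln n is a generous allowance for the number of grid points, which is of order
  (ln ln n)^4.\<close>

lemma (in bounded_model) ln_rate_tendsto_0: "(\<lambda>n. ln (real n) * rate n) \<longlonglongrightarrow> 0"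
proof -
  let ?r = "\<lambda>n. ln (real n) * (sqrt (real n * (ln (real n) * sqrt (real n))) / real n)"
  let ?e = "\<lambda>n. ln (real n) * (ln (real n) * exp (- (g0\<^sup>2 / 8 * ln (real n))))"
  have eq: "ln (real n) * rate n = sqrt (194 * B\<^sup>2 * v) * ?r n + 66 * B * sqrt (2 * v) * ?e n" for n
  proof -
    have "sqrt (real n * (194 * B\<^sup>2 * v * (ln (real n) * sqrt (real n)))) = sqrt (194 * B\<^sup>2 * v) * sqrt (real n * (ln (real n) * sqrt (real n)))"
      by (simp only: real_sqrt_mult mult.left_commute)
    moreover have "exp (- (g0\<^sup>2 * ln (real n)) / 8) = exp (- (g0\<^sup>2 / 8 * ln (real n)))" by simp
    ultimately show ?thesis by (simp only: rate_def) (simp add: distrib_left mult_ac)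
  qed
  have "?r \<longlonglongrightarrow> 0" by real_asymp
  moreover have e: "0 < c \<Longrightarrow> (\<lambda>n. ln (real n) * (ln (real n) * exp (- (c * ln (real n))))) \<longlonglongrightarrow> 0" for c :: real
    by real_asymp
  have "?e \<longlonglongrightarrow> 0" by (rule e) (use g0(1) in simp)
  ultimately have "(\<lambda>n. sqrt (194 * B\<^sup>2 * v) * ?r n + 66 * B * sqrt (2 * v) * ?e n) \<longlonglongrightarrow> sqrt (194 * B\<^sup>2 * v) * 0 + 66 * B * sqrt (2 * v) * 0"
    by (intro tendsto_add tendsto_mult_left)
  then show ?thesis by (simp only: eq mult_zero_right add_0_right)
qed

lemma grid_size_asymp:
  fixes p q :: real assumes "0 < p" "0 < q"
  shows "(\<lambda>n. (p * (a_seq n)\<^sup>2 + 1) * (q * (a_seq n)\<^sup>2 + 1) / ln (real n)) \<longlonglongrightarrow> 0"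
  using assms unfolding a_seq_def by real_asymp

lemma grid_spacing_asymp:
  fixes p q :: real assumes "0 < p" "0 < q"
  shows "(\<lambda>n. 1 / (p * a_seq n) + 1 / (q * (a_seq n)\<^sup>2) + 1 / a_seq n) \<longlonglongrightarrow> 0"
  using assms unfolding a_seq_def by real_asymp

theorem theorem1p7:
  fixes b h \<nu>p \<nu>f \<gamma> \<theta> :: "nat \<Rightarrow> real"
    and C1 C2 C3 C4 :: real
    and \<Theta> :: "nat \<Rightarrow> (nat \<Rightarrow> real) set"
    and p :: "nat \<Rightarrow> real"
    and \<eta>D \<tau>D \<eta>DOR :: "nat \<Rightarrow> (nat \<Rightarrow> real) \<Rightarrow> real"
    and \<tau>DOR :: "nat \<Rightarrow> (nat \<Rightarrow> real) \<Rightarrow> ennreal"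
  assumes pos: "\<And>i. i \<ge> 1 \<Longrightarrow> b i > 0 \<and> h i > 0 \<and> \<nu>p i > 0 \<and> \<nu>f i > 0"
    and A1: "assumption_A1 b h"
    and A3: "assumption_A3 \<nu>p \<nu>f"
    and \<gamma>_range: "\<And>i. i \<ge> 1 \<Longrightarrow> 0 < \<gamma> i \<and> \<gamma> i < 1 / sqrt (4 * exp 1) - sqrt (\<nu>p i / \<nu>f i)"
    and \<gamma>_uniform: "0 < (INF i\<in>{1..}. ereal (\<gamma> i))"
    and C1: "\<forall>\<^sub>F n in sequentially. (SUP i\<in>{1..n}. ereal (b i + h i)) \<le> ereal C1"
    and C2: "\<forall>\<^sub>F n in sequentially.
        max (SUP i\<in>{1..n}. ereal (\<nu>p i)) (SUP i\<in>{1..n}. ereal (inverse (\<nu>p i))) \<le> ereal C2"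
    and C3: "\<forall>\<^sub>F n in sequentially.
        (SUP i\<in>{1..n}. ereal (\<nu>p i / \<nu>f i)) *
        (SUP i\<in>{1..n}. ereal \<bar>Phi_inv (btilde (b i) (h i))\<bar>) \<le> ereal C3"
    and \<Theta>_sub: "\<And>n. \<Theta> n \<subseteq> extensional {1..n}"
    and \<Theta>_A2: "\<And>\<theta>'. assumption_A2 \<theta>' \<Longrightarrow> \<forall>\<^sub>F n in sequentially. restrict \<theta>' {1..n} \<in> \<Theta> n"
    and C4: "\<forall>\<^sub>F n in sequentially.
        (SUP \<theta>'\<in>\<Theta> n. ereal ((1 / real n) * (\<Sum>i=1..n. \<bar>\<theta>' i\<bar>))) \<le> ereal (C4 * sqrt (a_seq n))"
    and D_measurable: "\<forall>\<^sub>F n in sequentially.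
        \<eta>D n \<in> borel_measurable (data_law n \<nu>p \<theta>) \<and> \<tau>D n \<in> borel_measurable (data_law n \<nu>p \<theta>)"
    and D_argmin: "\<forall>\<^sub>F n in sequentially. \<forall>x\<in>space (data_law n \<nu>p \<theta>).
        is_arg_min (\<lambda>(\<eta>, \<tau>). ARE_D n b h \<nu>p \<nu>f \<gamma> x \<eta> \<tau>)
          (\<lambda>(\<eta>, \<tau>). \<eta> \<in> location_candidates (location_grid n C1 (p n)) (location_range n b h x)
                  \<and> \<tau> \<in> scale_grid n C1 C2 C3 C4)
          (\<eta>D n x, \<tau>D n x)"
    and DOR_argmin: "\<forall>\<^sub>F n in sequentially. \<forall>x\<in>space (data_law n \<nu>p \<theta>).
        is_arg_min (\<lambda>(\<eta>, \<tau>). avg_loss n b h \<nu>f \<theta> (predictor b h \<nu>p \<nu>f \<eta> \<tau> x))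
          (\<lambda>(\<eta>, \<tau>). \<eta> \<in> location_range n b h x)
          (\<eta>DOR n x, \<tau>DOR n x)"
    and A2: "assumption_A2 \<theta>"
  shows "(\<lambda>n. risk n b h \<nu>p \<nu>f \<theta> (\<lambda>x. predictor b h \<nu>p \<nu>f (\<eta>D n x) (ennreal (\<tau>D n x)) x)
            - (\<integral>x. avg_loss n b h \<nu>f \<theta> (predictor b h \<nu>p \<nu>f (\<eta>DOR n x) (\<tau>DOR n x) x)
                 \<partial>data_law n \<nu>p \<theta>))
         \<longlonglongrightarrow> 0"
proof -
  have A1': "ereal 0 < (INF i\<in>{1..}. ereal (btilde (b i) (h i)))" "(SUP i\<in>{1..}. ereal (btilde (b i) (h i))) < ereal 1"
    "(SUP i\<in>{1..}. ereal (b i + h i)) < \<infinity>"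
    using A1 unfolding assumption_A1_def zero_ereal_def one_ereal_def by blast+
  have A3': "(SUP i\<in>{1..}. ereal (\<nu>p i / \<nu>f i)) < ereal (1 / (4 * exp 1))" "(SUP i\<in>{1..}. ereal (\<nu>f i)) < \<infinity>"
    "ereal 0 < (INF i\<in>{1..}. ereal (\<nu>p i))"
    using A3 unfolding assumption_A3_def zero_ereal_def by blast+
  have \<gamma>': "ereal 0 < (INF i\<in>{1..}. ereal (\<gamma> i))" using \<gamma>_uniform unfolding zero_ereal_def .
  obtain bl where bl: "0 < bl" "\<And>i. 1 \<le> i \<Longrightarrow> bl \<le> btilde (b i) (h i)"
    using less_INF_ereal_real[OF A1'(1)] by auto
  obtain bu where bu: "bu < 1" "\<And>i. 1 \<le> i \<Longrightarrow> btilde (b i) (h i) \<le> bu"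
    using SUP_less_ereal_real[OF A1'(2)] by auto
  obtain B where B: "\<And>i. 1 \<le> i \<Longrightarrow> b i + h i \<le> B"
    using SUP_less_ereal_real[OF A1'(3)] by auto
  obtain ru where ru: "ru < 1 / (4 * exp 1)" "\<And>i. 1 \<le> i \<Longrightarrow> \<nu>p i / \<nu>f i \<le> ru"
    using SUP_less_ereal_real[OF A3'(1)] by auto
  obtain v where v: "\<And>i. 1 \<le> i \<Longrightarrow> \<nu>f i \<le> v"
    using SUP_less_ereal_real[OF A3'(2)] by auto
  obtain v0 where v0: "0 < v0" "\<And>i. 1 \<le> i \<Longrightarrow> v0 \<le> \<nu>p i"
    using less_INF_ereal_real[OF A3'(3)] by auto
  obtain g0 where g0: "0 < g0" "\<And>i. 1 \<le> i \<Longrightarrow> g0 \<le> \<gamma> i"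
    using less_INF_ereal_real[OF \<gamma>'] by auto
  have ratio: "\<nu>p i \<le> \<nu>f i" if i: "1 \<le> i" for i
  proof -
    have "1 / (4 * exp 1) \<le> (1 :: real)" using exp_1_ge by (simp add: field_simps)
    then have "\<nu>p i / \<nu>f i \<le> 1" using ru(1) ru(2)[OF i] by linarith
    then show ?thesis using pos[OF i] by (simp add: divide_le_eq)
  qed
  \<comment> \<open>A uniform bound on the quantiles, extracted from C3: the supremum of the ratios
    is at least the ratio at index 1, which is positive.\<close>
  define q0 where "q0 = C3 / (\<nu>p 1 / \<nu>f 1)"
  have q0: "\<bar>Phi_inv (btilde (b i) (h i))\<bar> \<le> q0" if i: "1 \<le> i" for i
  proof -
    let ?q = "\<lambda>i. \<bar>Phi_inv (btilde (b i) (h i))\<bar>"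
    obtain n0 where n0: "\<And>n. n0 \<le> n \<Longrightarrow> (SUP i\<in>{1..n}. ereal (\<nu>p i / \<nu>f i)) * (SUP i\<in>{1..n}. ereal (?q i)) \<le> ereal C3"
      using C3 unfolding eventually_sequentially by blast
    define n where "n = max i n0"
    have \<rho>: "0 < \<nu>p 1 / \<nu>f 1" using pos[of 1] by simp
    have "ereal (\<nu>p 1 / \<nu>f 1) * ereal (?q i) \<le> (SUP i\<in>{1..n}. ereal (\<nu>p i / \<nu>f i)) * (SUP i\<in>{1..n}. ereal (?q i))"
    proof (rule ereal_mult_mono)
      show "ereal (\<nu>p 1 / \<nu>f 1) \<le> (SUP i\<in>{1..n}. ereal (\<nu>p i / \<nu>f i))" using i by (intro SUP_upper) (auto simp: n_def)
      then show "0 \<le> (SUP i\<in>{1..n}. ereal (\<nu>p i / \<nu>f i))" using \<rho> by (meson ereal_less_eq(5) less_imp_le order_trans)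
      show "ereal (?q i) \<le> (SUP i\<in>{1..n}. ereal (?q i))" using i by (intro SUP_upper) (auto simp: n_def)
      show "0 \<le> ereal (?q i)" by simp
    qed
    also have "\<dots> \<le> ereal C3" by (rule n0) (simp add: n_def)
    finally have "\<nu>p 1 / \<nu>f 1 * ?q i \<le> C3" by simp
    then show ?thesis unfolding q0_def pos_le_divide_eq[OF \<rho>] by (subst mult.commute)
  qed
  interpret bounded_model b h \<nu>p \<nu>f \<gamma> \<theta> B v0 v g0 q0 bl bu
  proof
    fix i :: nat assume i: "1 \<le> i"
    show "\<nu>p i \<le> v" using ratio[OF i] v[OF i] by simp
    show "\<gamma> i + sqrt (\<nu>p i / \<nu>f i) < 1 / sqrt (4 * exp 1)" using \<gamma>_range[OF i] by simp
  qed (fact pos B v0 v ratio g0 q0 bl bu)+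
  obtain M0 where M0: "\<forall>\<^sub>F n in sequentially. abs_mean n \<theta> \<le> M0"
  proof -
    obtain M0 where "limsup (\<lambda>n. ereal ((1 / real n) * (\<Sum>i=1..n. \<bar>\<theta> i\<bar>))) < ereal M0"
      using ereal_dense2[OF A2[unfolded assumption_A2_def]] by blast
    then have "\<forall>\<^sub>F n in sequentially. ereal ((1 / real n) * (\<Sum>i=1..n. \<bar>\<theta> i\<bar>)) < ereal M0" by (rule Limsup_lessD)
    then have "\<forall>\<^sub>F n in sequentially. abs_mean n \<theta> \<le> M0" by eventually_elim (simp add: abs_mean_def)
    then show ?thesis by (rule that)
  qed
  have C1_pos: "0 < C1"
  proof -
    obtain n where "1 \<le> n" and n: "(SUP i\<in>{1..n}. ereal (b i + h i)) \<le> ereal C1"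
      using eventually_happens'[OF sequentially_bot eventually_conj[OF eventually_ge_at_top[of 1] C1]] by blast
    have "ereal (b 1 + h 1) \<le> ereal C1" using \<open>1 \<le> n\<close> by (intro order_trans[OF SUP_upper n]) auto
    then show ?thesis using pos[of 1] by simp
  qed
  have C2_pos: "0 < C2"
  proof -
    obtain n where "1 \<le> n" and n: "max (SUP i\<in>{1..n}. ereal (\<nu>p i)) (SUP i\<in>{1..n}. ereal (inverse (\<nu>p i))) \<le> ereal C2"
      using eventually_happens'[OF sequentially_bot eventually_conj[OF eventually_ge_at_top[of 1] C2]] by blast
    then have "ereal (\<nu>p 1) \<le> ereal C2" using \<open>1 \<le> n\<close> by (intro order_trans[OF SUP_upper[of 1 "{1..n}" "\<lambda>i. ereal (\<nu>p i)"]]) auto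
    then show ?thesis using pos[of 1] by simp
  qed
  \<comment> \<open>With \<delta>1 = 1/(2 C1 a) one has 2 a/\<delta>1 = 4 C1 a^2. For the scale grid
    1/\<delta>2 = 2 C1 C2 D with a^2 <= D <= 4 a^2, whence the factors 8 in the size and 2 in the
    spacing.\<close>
  define bound where "bound n = 2 * ((4 * C1 * (a_seq n)\<^sup>2 + 1) * (8 * C1 * C2 * (a_seq n)\<^sup>2 + 1) * rate n)
    + Ctot M0 * (1 / (2 * C1 * a_seq n) + 1 / (2 * C1 * C2 * (a_seq n)\<^sup>2) + 1 / a_seq n)" for n
  have a_large: "\<forall>\<^sub>F n in sequentially. c \<le> a_seq n" for c
    using filterlim_a_seq unfolding filterlim_at_top by blast
  have bound_lim: "bound \<longlonglongrightarrow> 0"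
  proof -
    let ?p = "\<lambda>n. (4 * C1 * (a_seq n)\<^sup>2 + 1) * (8 * C1 * C2 * (a_seq n)\<^sup>2 + 1)"
    have "(\<lambda>n. 2 * (?p n / ln (real n) * (ln (real n) * rate n))) \<longlonglongrightarrow> 2 * (0 * 0)"
      using C1_pos C2_pos by (intro tendsto_mult_left tendsto_mult grid_size_asymp ln_rate_tendsto_0) auto
    moreover have "\<forall>\<^sub>F n in sequentially. 2 * (?p n / ln (real n) * (ln (real n) * rate n)) = 2 * (?p n * rate n)"
      using eventually_ge_at_top[of 2]
    proof eventually_elim
      case (elim n)
      then have "ln (real n) \<noteq> 0" using ln_gt_zero[of "real n"] by simp
      then show ?case by simp
    qed
    ultimately have "(\<lambda>n. 2 * (?p n * rate n)) \<longlonglongrightarrow> 2 * (0 * 0)" by (rule Lim_transform_eventually)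
    moreover have "(\<lambda>n. Ctot M0 * (1 / (2 * C1 * a_seq n) + 1 / (2 * C1 * C2 * (a_seq n)\<^sup>2) + 1 / a_seq n)) \<longlonglongrightarrow> Ctot M0 * 0"
      using C1_pos C2_pos by (intro tendsto_mult_left grid_spacing_asymp) auto
    ultimately have "(\<lambda>n. 2 * (?p n * rate n) + Ctot M0 * (1 / (2 * C1 * a_seq n) + 1 / (2 * C1 * C2 * (a_seq n)\<^sup>2) + 1 / a_seq n))
      \<longlonglongrightarrow> 2 * (0 * 0) + Ctot M0 * 0" by (rule tendsto_add)
    then show ?thesis by (simp only: bound_def[abs_def] mult_zero_right add_0_right)
  qed
  have "\<forall>\<^sub>F n in sequentially. norm (risk n b h \<nu>p \<nu>f \<theta> (\<lambda>x. predictor b h \<nu>p \<nu>f (\<eta>D n x) (ennreal (\<tau>D n x)) x)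
            - (\<integral>x. avg_loss n b h \<nu>f \<theta> (predictor b h \<nu>p \<nu>f (\<eta>DOR n x) (\<tau>DOR n x) x) \<partial>data_law n \<nu>p \<theta>)) \<le> bound n"
    using D_measurable D_argmin DOR_argmin M0 eventually_ge_at_top[of 3] a_large[of 2] a_large[of "1 / C1"]
      a_large[of "2 * \<bar>C3\<bar>"] a_large[of "4 * C4\<^sup>2"]
  proof eventually_elim
    case (elim n)
    define a where "a = a_seq n"
    define \<delta>1 where "\<delta>1 = 1 / (2 * C1 * a)"
    define \<delta>2 where "\<delta>2 = scale_step n C1 C2 C3 C4"
    define D where "D = 2 * phi 0 + C3 + sqrt a * C4 + a + a\<^sup>2"
    have a: "2 \<le> a" "1 / C1 \<le> a" "2 * \<bar>C3\<bar> \<le> a" "4 * C4\<^sup>2 \<le> a" using elim by (auto simp: a_def)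
    have "C1 * (1 / C1) \<le> C1 * a" using a(2) C1_pos by (intro mult_left_mono) auto
    then have C1a: "1 \<le> C1 * a" using C1_pos by simp
    have "1 * a \<le> a * a" using a(1) by (intro mult_right_mono) auto
    then have aa: "a \<le> a\<^sup>2" "2 \<le> a\<^sup>2" using a(1) unfolding power2_eq_square by linarith+
    have sq: "\<bar>sqrt a * C4\<bar> \<le> a / 2"
    proof -
      have "(2 * \<bar>C4\<bar>)\<^sup>2 \<le> a" using a(4) by (simp add: power_mult_distrib)
      then have "2 * \<bar>C4\<bar> \<le> sqrt a" by (rule real_le_rsqrt)
      then have "sqrt a * (2 * \<bar>C4\<bar>) \<le> sqrt a * sqrt a" using a(1) by (intro mult_left_mono) auto
      then show ?thesis using a(1) by (simp add: abs_mult)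
    qed
    have phi0: "0 \<le> phi 0" "phi 0 \<le> 1" using phi_0_le_1 by auto
    \<comment> \<open>The terms with C3 and C4, of either sign, are at most a/2 in absolute value,
      so the summand a offsets them from below. From above, 2 \<open>phi 0\<close> <= a^2, the two
      terms together are at most a^2, and so is a.\<close>
    have D: "a\<^sup>2 \<le> D" "D \<le> 4 * a\<^sup>2" using a(3) sq phi0 aa unfolding D_def by linarith+
    have \<delta>2: "\<delta>2 = 1 / (2 * C1 * C2 * D)" by (simp add: \<delta>2_def scale_step_def D_def a_def)
    have D_pos: "0 < D" using D(1) aa by linarith
    have \<delta>: "0 < \<delta>1" "\<delta>1 \<le> a" "0 < \<delta>2"
    proof -
      show "0 < \<delta>1" using C1_pos a by (simp add: \<delta>1_def)
      show "0 < \<delta>2" using C1_pos C2_pos D_pos by (simp add: \<delta>2)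
      have "\<delta>1 \<le> 1 / 2" using C1a by (simp add: \<delta>1_def divide_simps)
      then show "\<delta>1 \<le> a" using a by simp
    qed
    have n: "3 \<le> n" using elim by simp
    have *: "\<bar>(\<integral>x. avg_loss n b h \<nu>f \<theta> (predictor b h \<nu>p \<nu>f (\<eta>D n x) (ennreal (\<tau>D n x)) x) \<partial>data_law n \<nu>p \<theta>)
        - (\<integral>x. avg_loss n b h \<nu>f \<theta> (predictor b h \<nu>p \<nu>f (\<eta>DOR n x) (\<tau>DOR n x) x) \<partial>data_law n \<nu>p \<theta>)\<bar>
      \<le> 2 * ((2 * a / \<delta>1 + 1) * (1 / \<delta>2 + 1) * rate n) + Ctot M0 * (\<delta>1 + \<delta>2 + 1 / a)"
    proof (rule regret_bound[where p="p n"])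
      fix x assume "x \<in> space (data_law n \<nu>p \<theta>)"
      then show "is_arg_min (\<lambda>(\<eta>, \<tau>). ARE_D n b h \<nu>p \<nu>f \<gamma> x \<eta> \<tau>)
        (\<lambda>(\<eta>, \<tau>). \<eta> \<in> location_candidates {\<eta>\<in>{- a .. a}. \<exists>j::int. \<eta> = p n + real_of_int j * \<delta>1} (location_range n b h x)
          \<and> \<tau> \<in> {\<tau>. 0 \<le> \<tau> \<and> (\<exists>j\<in>{1..nat \<lceil>1 / \<delta>2\<rceil>}. \<tau> / (\<tau> + 1) = (real j - 1) * \<delta>2)}) (\<eta>D n x, \<tau>D n x)"
        using elim(2) unfolding location_grid_def scale_grid_def a_def \<delta>1_def \<delta>2_def by blast
    qed (use elim n \<delta> in auto)
    have "0 \<le> Ctot M0"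
    proof -
      have "0 \<le> M0" using elim(4) abs_mean_nonneg[of n \<theta>] by simp
      then show ?thesis using const_pos
        by (auto simp: Ctot_def Cgood_def Cbad_def intro!: mult_nonneg_nonneg add_nonneg_nonneg)
    qed
    moreover have "0 \<le> rate n" using n const_pos by (simp add: rate_def)
    moreover have e1: "2 * a / \<delta>1 + 1 = 4 * C1 * a\<^sup>2 + 1" using C1_pos a by (simp add: \<delta>1_def power2_eq_square)
    moreover have "1 / \<delta>2 + 1 \<le> 8 * C1 * C2 * a\<^sup>2 + 1"
    proof -
      have "2 * C1 * C2 * D \<le> 2 * C1 * C2 * (4 * a\<^sup>2)" using D C1_pos C2_pos by (intro mult_left_mono) auto
      then show ?thesis by (simp add: \<delta>2)
    qed
    moreover have "\<delta>2 \<le> 1 / (2 * C1 * C2 * a\<^sup>2)"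
      unfolding \<delta>2 using D C1_pos C2_pos aa D_pos by (intro divide_left_mono mult_left_mono mult_pos_pos) auto
    ultimately have "2 * ((2 * a / \<delta>1 + 1) * (1 / \<delta>2 + 1) * rate n) + Ctot M0 * (\<delta>1 + \<delta>2 + 1 / a) \<le> bound n"
      unfolding bound_def a_def[symmetric] \<delta>1_def[symmetric] e1 using C1_pos a
      by (intro add_mono mult_left_mono mult_right_mono) auto
    with * show ?case unfolding risk_def real_norm_def by linarith
  qed
  then show ?thesis by (rule Lim_null_comparison[OF _ bound_lim])
qed



end
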